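(* Let $n$ be a positive integer, let $h_1,\dots,h_n\in\mathrm{Supp}_{BV}(Q)$ and let $F\in\mathcal S(L_2(Q))$ be given by $F(x)=\int_{L_2(Q)}\exp\{i\langle u,x\rangle\}\,df(u)$ with $f\in\mathcal M(L_2(Q))$. Then, for any nonzero real number $q$, the following iterated analytic Yeh--Feynman integral exists and is given by $$I_{h_n,x_n}^{\mathrm{an.}yf_q}\Big[\cdots\Big[I_{h_2,x_2}^{\mathrm{an.}yf_q}\Big[I_{h_1,x_1}^{\mathrm{an.}yf_q}\Big[F\Big(\sum_{j=1}^n\mathcal Y_{h_j}(x_j;\cdot,\cdot)\Big)\Big]\Big]\Big]\cdots\Big]=\int_{L_2(Q)}\exp\Big\{-\frac{i}{2q}\sum_{j=1}^n\|uh_j\|_2^2\Big\}\,df(u).$$ Moreover, if $\mathbf s=\mathbf s(h_1,\dots,h_n)$ is a function in $\mathrm{Supp}_{BV}(Q)$ satisfying $\mathbf s^2=h_1^2+\cdots+h_n^2$ $m_L^2$-a.e. on $Q$, then this iterated integral equals $I_{\mathbf s,x}^{\mathrm{an.}yf_q}[F(\mathcal Y_{\mathbf s}(x;\cdot,\cdot))]$.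
   Context: Fix $S,T>0$, let $Q=[0,S]\times[0,T]$, $m_L^2$ = Lebesgue measure on $Q$, and $L_2(Q)$ the real Hilbert space with inner product $(\cdot,\cdot)_2$ and norm $\|\cdot\|_2$. $C_0(Q)$ is the space of real continuous $x$ on $Q$ with $x(s,0)=x(0,t)=0$, with (completed) Yeh--Wiener measure $m_{\mathrm y}$, i.e. the centered Gaussian measure with $\int x(s,t)x(s',t')\,dm_{\mathrm y}(x)=\min(s,s')\min(t,t')$. A set $E$ is scale-invariant measurable if $\rho E$ is measurable for every $\rho>0$, a scale-invariant measurable set $N$ is scale-invariant null if $m_{\mathrm y}(\rho N)=0$ for every $\rho>0$; "s-a.e." means off a scale-invariant null set. A functional $F$ is scale-invariant measurable if it is defined on a scale-invariant measurable set and $F(\rho\,\cdot)$ is measurable for every $\rho>0$. PWZ integral: fix a complete orthonormal set $\{\phi_n\}$ of $L_2(Q)$ consisting of functions of bounded variation (Hardy--Krause sense); for $v\in L_2(Q)$, $\langle v,x\rangle=\lim_{n}\int_Q\sum_{j=1}^n(v,\phi_j)_2\phi_j\,dx$ where the limit exists (it exists for s-a.e. $x$ and is essentially independent of $\{\phi_n\}$). $\mathrm{Supp}_{BV}(Q)$ is the set of real functions $h$ on $Q$ of bounded variation (Hardy--Krause sense) with $h\neq0$ $m_L^2$-a.e. For such $h$, $\mathcal Y_h(x;s,t)=\langle\chi_{[0,s]\times[0,t]}h,x\rangle$; its sample paths $\mathcal Y_h(x;\cdot,\cdot)$ lie in $C_0(Q)$. $\mathcal M(L_2(Q))$ is the space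 of complex countably additive Borel measures on $L_2(Q)$. $\mathcal S(L_2(Q))$ is the set of functionals $F$ on $C_0(Q)$ of the form $F(x)=\int_{L_2(Q)}\exp\{i\langle u,x\rangle\}df(u)$ for s-a.e. $x$, for some $f\in\mathcal M(L_2(Q))$. Evaluation along Gaussian paths uses this formula together with $\langle u,\mathcal Y_h(x;\cdot,\cdot)\rangle=\langle uh,x\rangle$, i.e. for real $c_j$, $F(y+\sum_jc_j\mathcal Y_{h_j}(x_j;\cdot,\cdot))=\int\exp\{i\langle u,y\rangle+i\sum_jc_j\langle uh_j,x_j\rangle\}df(u)$. Analytic integrals: $\mathbb C_+=\{\mathrm{Re}\,\lambda>0\}$. For $h\in\mathrm{Supp}_{BV}(Q)$ suppose $J_F(h;\lambda)=\int_{C_0(Q)}F(\lambda^{-1/2}\mathcal Y_h(x;\cdot,\cdot))dm_{\mathrm y}(x)$ is finite for all $\lambda>0$ and has an analytic extension $J_F^*(h;\cdot)$ to $\mathbb C_+$. Then $I_{h,x}^{\mathrm{an.}yw_\lambda}[F(\mathcal Y_h(x;\cdot,\cdot))]=J^*_F(h;\lambda)$ for $\lambda\in\mathbb C_+$, and for real $q\ne0$, $I_{h,x}^{\mathrm{an.}yf_q}[F(\mathcal Y_h(x;\cdot,\cdot))]=\lim_{\lambda\to-iq,\,\lambda\in\mathbb C_+}J_F^*(h;\lambda)$ if the limit exists. In an iterated integral, the innermost integral is the functional $z\mapsto I_{h_1,x_1}^{\mathrm{an.}yf_q}[F(\mathcal Y_{h_1}(x_1;\cdot,\cdot)+z)]$,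 evaluated at $z=\sum_{j\ge2}\mathcal Y_{h_j}(x_j;\cdot,\cdot)$, and each subsequent integral is the analytic integral of the resulting functional along the next Gaussian path, in the same manner. *)

theory Defs
  imports "HOL-Probability.Probability" "HOL-Complex_Analysis.Complex_Analysis"
begin

text \<open>
  Functions on the rectangle are HOL functions on the plane. Elements of \<open>C\<^sub>0(Q)\<close> are made
  unique by requiring the value 0 off \<open>Q\<close>; for elements of \<open>L\<^sub>2(Q)\<close> and for functions of bounded
  variation the values off \<open>Q\<close> are irrelevant.
\<close>

type_synonym planefun = "real \<times> real \<Rightarrow> real"

definition rect :: "real \<Rightarrow> real \<Rightarrow> (real \<times> real) set" where
  "rect S T = {0..S} \<times> {0..T}"


section \<open>The space \<open>L\<^sub>2(Q)\<close> and complex Borel measures on it\<close>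

definition L2_carrier :: "real \<Rightarrow> real \<Rightarrow> planefun set" where
  "L2_carrier S T = {u \<in> borel_measurable (lebesgue_on (rect S T)).
     integrable (lebesgue_on (rect S T)) (\<lambda>p. (u p)\<^sup>2)}"

definition L2_inner :: "real \<Rightarrow> real \<Rightarrow> planefun \<Rightarrow> planefun \<Rightarrow> real" where
  "L2_inner S T u v = (\<integral>p. u p * v p \<partial>lebesgue_on (rect S T))"

definition L2_norm :: "real \<Rightarrow> real \<Rightarrow> planefun \<Rightarrow> real" where
  "L2_norm S T u = sqrt (L2_inner S T u u)"

text \<open>
  Functions are not identified when equal almost everywhere: an open set of the seminormed space
  below is exactly a preimage of an open set of the Hilbert space \<open>L\<^sub>2(Q)\<close> under the quotient map,
  so the sigma-algebra below (and every measure on it) is the pullback of the Borel one.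
\<close>

definition L2_open :: "real \<Rightarrow> real \<Rightarrow> planefun set \<Rightarrow> bool" where
  "L2_open S T U \<longleftrightarrow> U \<subseteq> L2_carrier S T \<and>
     (\<forall>u\<in>U. \<exists>\<epsilon>>0. \<forall>v\<in>L2_carrier S T. L2_norm S T (\<lambda>p. v p - u p) < \<epsilon> \<longrightarrow> v \<in> U)"

definition L2_borel :: "real \<Rightarrow> real \<Rightarrow> planefun measure" where
  "L2_borel S T = sigma (L2_carrier S T) {U. L2_open S T U}"

definition complex_measures :: "'a measure \<Rightarrow> ('a set \<Rightarrow> complex) set" where
  "complex_measures N = {f. \<forall>A :: nat \<Rightarrow> 'a set. range A \<subseteq> sets N \<longrightarrow> disjoint_family A \<longrightarrow>
     (\<lambda>i. f (A i)) sums f (\<Union>i. A i)}"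

text \<open>The positive part \<open>A \<mapsto> sup {r B | B \<subseteq> A}\<close> in the Jordan decomposition of a signed measure.\<close>

definition positive_variation :: "'a measure \<Rightarrow> ('a set \<Rightarrow> real) \<Rightarrow> 'a measure" where
  "positive_variation N r =
     measure_of (space N) (sets N) (\<lambda>A. SUP B\<in>{B \<in> sets N. B \<subseteq> A}. ennreal (r B))"

definition cm_integral :: "'a measure \<Rightarrow> ('a set \<Rightarrow> complex) \<Rightarrow> ('a \<Rightarrow> complex) \<Rightarrow> complex" where
  "cm_integral N f g =
     ((\<integral>u. g u \<partial>positive_variation N (\<lambda>A. Re (f A)))
       - (\<integral>u. g u \<partial>positive_variation N (\<lambda>A. - Re (f A))))
     + \<i> * ((\<integral>u. g u \<partial>positive_variation N (\<lambda>A. Im (f A)))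
       - (\<integral>u. g u \<partial>positive_variation N (\<lambda>A. - Im (f A))))"


section \<open>Bounded variation in the sense of Hardy and Krause, Riemann--Stieltjes integral\<close>

definition partition_of :: "real \<Rightarrow> nat \<Rightarrow> (nat \<Rightarrow> real) \<Rightarrow> bool" where
  "partition_of b k p \<longleftrightarrow> p 0 = 0 \<and> p k = b \<and> (\<forall>i<k. p i < p (Suc i))"

definition rect_increment :: "planefun \<Rightarrow> real \<Rightarrow> real \<Rightarrow> real \<Rightarrow> real \<Rightarrow> real" where
  "rect_increment x a b c d = x (b, d) - x (a, d) - x (b, c) + x (a, c)"

definition bounded_variation_1 :: "real \<Rightarrow> (real \<Rightarrow> real) \<Rightarrow> bool" where
  "bounded_variation_1 b g \<longleftrightarrow>
     (\<exists>B. \<forall>k p. partition_of b k p \<longrightarrow> (\<Sum>i<k. \<bar>g (p (Suc i)) - g (p i)\<bar>) \<le> B)"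

text \<open>
  Given finite variation over rectangles, bounded variation of one section in each direction
  implies it for all sections; the sections through the origin are used here.
\<close>

definition bounded_variation_HK :: "real \<Rightarrow> real \<Rightarrow> planefun \<Rightarrow> bool" where
  "bounded_variation_HK S T h \<longleftrightarrow>
     (\<exists>B. \<forall>k p l r. partition_of S k p \<longrightarrow> partition_of T l r \<longrightarrow>
        (\<Sum>i<k. \<Sum>j<l. \<bar>rect_increment h (p i) (p (Suc i)) (r j) (r (Suc j))\<bar>) \<le> B) \<and>
     bounded_variation_1 S (\<lambda>s. h (s, 0)) \<and>
     bounded_variation_1 T (\<lambda>t. h (0, t))"

definition Supp_BV :: "real \<Rightarrow> real \<Rightarrow> planefun set" where
  "Supp_BV S T = {h. bounded_variation_HK S T h \<and> (AE p in lebesgue_on (rect S T). h p \<noteq> 0)}"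

text \<open>
  The tags form a grid \<open>(\<xi> i, \<eta> j)\<close>. With an independent tag in every cell, the integral of a function
  of bounded variation against a continuous function need not exist.
\<close>

definition has_RS_integral ::
  "real \<Rightarrow> real \<Rightarrow> planefun \<Rightarrow> planefun \<Rightarrow> real \<Rightarrow> bool" where
  "has_RS_integral S T g x I \<longleftrightarrow>
     (\<forall>\<epsilon>>0. \<exists>\<delta>>0. \<forall>k p \<xi> l r \<eta>.
        partition_of S k p \<longrightarrow> partition_of T l r \<longrightarrow>
        (\<forall>i<k. p (Suc i) - p i < \<delta> \<and> \<xi> i \<in> {p i..p (Suc i)}) \<longrightarrow>
        (\<forall>j<l. r (Suc j) - r j < \<delta> \<and> \<eta> j \<in> {r j..r (Suc j)}) \<longrightarrow>
        \<bar>(\<Sum>i<k. \<Sum>j<l. g (\<xi> i, \<eta> j) * rect_increment x (p i) (p (Suc i)) (r j) (r (Suc j))) - I\<bar> < \<epsilon>)"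

definition RS_integral :: "real \<Rightarrow> real \<Rightarrow> planefun \<Rightarrow> planefun \<Rightarrow> real" where
  "RS_integral S T g x = (THE I. has_RS_integral S T g x I)"


section \<open>Yeh--Wiener space\<close>

definition C0 :: "real \<Rightarrow> real \<Rightarrow> planefun set" where
  "C0 S T = {x. continuous_on (rect S T) x \<and> (\<forall>s\<in>{0..S}. x (s, 0) = 0) \<and>
     (\<forall>t\<in>{0..T}. x (0, t) = 0) \<and> (\<forall>p. p \<notin> rect S T \<longrightarrow> x p = 0)}"

definition centered_normal :: "'a measure \<Rightarrow> ('a \<Rightarrow> real) \<Rightarrow> bool" where
  "centered_normal M X \<longleftrightarrow> X \<in> borel_measurable M \<and>
     ((AE x in M. X x = 0) \<or> (\<exists>\<sigma>>0. distributed M lborel X (normal_density 0 \<sigma>)))"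

text \<open>
  The predicate determines \<open>m\<close>: the trace of the product sigma-algebra on \<open>C\<^sub>0(Q)\<close> (which is the Borel
  one of the uniform norm) is generated by the evaluations, whose joint laws are prescribed.
\<close>

definition yeh_wiener :: "real \<Rightarrow> real \<Rightarrow> planefun measure \<Rightarrow> bool" where
  "yeh_wiener S T m \<longleftrightarrow> (\<exists>m0.
     prob_space m0 \<and>
     space m0 = C0 S T \<and>
     sets m0 = sets (restrict_space (Pi\<^sub>M UNIV (\<lambda>_. borel)) (C0 S T)) \<and>
     (\<forall>P c. finite P \<longrightarrow> P \<subseteq> rect S T \<longrightarrow> centered_normal m0 (\<lambda>x. \<Sum>p\<in>P. c p * x p)) \<and>
     (\<forall>(s, t)\<in>rect S T. \<forall>(s', t')\<in>rect S T.
        (\<integral>x. x (s, t) * x (s', t') \<partial>m0) = min s s' * min t t') \<and>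
     m = completion m0)"

definition si_measurable :: "planefun measure \<Rightarrow> planefun set \<Rightarrow> bool" where
  "si_measurable m E \<longleftrightarrow> E \<subseteq> space m \<and> (\<forall>\<rho>>0. (\<lambda>x p. \<rho> * x p) ` E \<in> sets m)"

definition si_null :: "planefun measure \<Rightarrow> planefun set \<Rightarrow> bool" where
  "si_null m N \<longleftrightarrow> si_measurable m N \<and> (\<forall>\<rho>>0. emeasure m ((\<lambda>x p. \<rho> * x p) ` N) = 0)"

definition s_ae :: "planefun measure \<Rightarrow> (planefun \<Rightarrow> bool) \<Rightarrow> bool" where
  "s_ae m P \<longleftrightarrow> (\<exists>N. si_null m N \<and> (\<forall>x\<in>space m - N. P x))"


section \<open>Paley--Wiener--Zygmund integral and Gaussian paths\<close>

definition complete_orthonormal_BV :: "real \<Rightarrow> real \<Rightarrow> (nat \<Rightarrow> planefun) \<Rightarrow> bool" where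
  "complete_orthonormal_BV S T \<phi> \<longleftrightarrow>
     (\<forall>j. \<phi> j \<in> L2_carrier S T \<and> bounded_variation_HK S T (\<phi> j)) \<and>
     (\<forall>i j. L2_inner S T (\<phi> i) (\<phi> j) = (if i = j then 1 else 0)) \<and>
     (\<forall>v\<in>L2_carrier S T. (\<forall>j. L2_inner S T v (\<phi> j) = 0) \<longrightarrow> L2_norm S T v = 0)"

definition PWZ :: "real \<Rightarrow> real \<Rightarrow> (nat \<Rightarrow> planefun) \<Rightarrow> planefun \<Rightarrow> planefun \<Rightarrow> real" where
  "PWZ S T \<phi> v x =
     lim (\<lambda>n. RS_integral S T (\<lambda>p. \<Sum>j<n. L2_inner S T v (\<phi> j) * \<phi> j p) x)"

definition gauss_path ::
  "real \<Rightarrow> real \<Rightarrow> (nat \<Rightarrow> planefun) \<Rightarrow> planefun \<Rightarrow> planefun \<Rightarrow> planefun" where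
  "gauss_path S T \<phi> h x = (\<lambda>(s, t). if (s, t) \<in> rect S T
     then PWZ S T \<phi> (\<lambda>p. indicator ({0..s} \<times> {0..t}) p * h p) x else 0)"


section \<open>Functionals and the class \<open>\<S>(L\<^sub>2(Q))\<close>\<close>

text \<open>Functionals are partial; \<open>None\<close> means undefined.\<close>

type_synonym functional = "planefun \<Rightarrow> complex option"

definition fresnel_rep ::
  "real \<Rightarrow> real \<Rightarrow> planefun measure \<Rightarrow> (nat \<Rightarrow> planefun) \<Rightarrow> (planefun set \<Rightarrow> complex) \<Rightarrow>
   functional \<Rightarrow> bool" where
  "fresnel_rep S T m \<phi> f F \<longleftrightarrow> f \<in> complex_measures (L2_borel S T) \<and>
     s_ae m (\<lambda>x. F x = Some (cm_integral (L2_borel S T) f (\<lambda>u. exp (\<i> * of_real (PWZ S T \<phi> u x)))))"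

text \<open>
  For non-constant \<open>h\<^sup>2\<close> the law of \<open>\<Y>\<^sub>h\<close> is singular to that of every multiple of the Yeh--Wiener process, so
  \<^const>\<open>fresnel_rep\<close> alone does not determine \<open>F\<close> along Gaussian paths. The convention is that there \<open>F\<close>
  is evaluated by the same formula, with \<open>\<langle>u, \<Y>\<^sub>h(x)\<rangle> = \<langle>uh, x\<rangle>\<close>. The exceptional set of
  \<open>(x\<^sub>1, \<dots>, x\<^sub>k)\<close> does not depend on the coefficients \<open>c\<close>, because the set of \<open>x\<close> with
  \<open>\<langle>u, \<Y>\<^sub>h(x)\<rangle> = \<langle>uh, x\<rangle>\<close> does not involve them and \<open>\<langle>u, \<cdot>\<rangle>\<close> is linear.
\<close>

definition evaluates_along_gauss_paths ::
  "real \<Rightarrow> real \<Rightarrow> planefun measure \<Rightarrow> (nat \<Rightarrow> planefun) \<Rightarrow> (planefun set \<Rightarrow> complex) \<Rightarrow>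
   functional \<Rightarrow> bool" where
  "evaluates_along_gauss_paths S T m \<phi> f F \<longleftrightarrow>
     (\<forall>k (h :: nat \<Rightarrow> planefun). (\<forall>j\<in>{1..k}. h j \<in> Supp_BV S T) \<longrightarrow>
        (AE x in Pi\<^sub>M {1..k} (\<lambda>_. m). \<forall>c :: nat \<Rightarrow> real.
           F (\<lambda>p. \<Sum>j=1..k. c j * gauss_path S T \<phi> (h j) (x j) p) =
           Some (cm_integral (L2_borel S T) f
             (\<lambda>u. exp (\<i> * of_real (\<Sum>j=1..k. c j * PWZ S T \<phi> (\<lambda>p. u p * h j p) (x j)))))))"


section \<open>Analytic Yeh--Feynman integrals\<close>

text \<open>
  The predicate \<open>is_yw_extension\<close> states that \<open>J(\<lambda>) = \<integral> F(\<lambda>\<^sup>-\<^sup>1\<^sup>/\<^sup>2 \<Y>\<^sub>h(x) + z) dm(x)\<close> is finite for all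
  \<open>\<lambda> > 0\<close> and that \<open>J'\<close> is its analytic extension to the right half-plane; \<open>J'(\<lambda>)\<close> is then the analytic
  Yeh--Wiener integral.
\<close>

definition is_yw_extension ::
  "real \<Rightarrow> real \<Rightarrow> planefun measure \<Rightarrow> (nat \<Rightarrow> planefun) \<Rightarrow> planefun \<Rightarrow> functional \<Rightarrow> planefun \<Rightarrow>
   (complex \<Rightarrow> complex) \<Rightarrow> bool" where
  "is_yw_extension S T m \<phi> h F z J' \<longleftrightarrow>
     (\<forall>a::real. a > 0 \<longrightarrow>
        (let G = (\<lambda>x. F (\<lambda>p. a powr (-1/2) * gauss_path S T \<phi> h x p + z p)) in
           (AE x in m. G x \<noteq> None) \<and> integrable m (\<lambda>x. the (G x)) \<and>
           J' (of_real a) = (\<integral>x. the (G x) \<partial>m))) \<and>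
     J' analytic_on {w. Re w > 0}"

definition has_yf_integral ::
  "real \<Rightarrow> real \<Rightarrow> planefun measure \<Rightarrow> (nat \<Rightarrow> planefun) \<Rightarrow> real \<Rightarrow> planefun \<Rightarrow> functional \<Rightarrow>
   planefun \<Rightarrow> complex \<Rightarrow> bool" where
  "has_yf_integral S T m \<phi> q h F z v \<longleftrightarrow>
     (\<exists>J'. is_yw_extension S T m \<phi> h F z J' \<and>
        (J' \<longlongrightarrow> v) (at (- \<i> * of_real q) within {w. Re w > 0}))"

text \<open>The functional \<open>z \<mapsto> I\<^sub>h\<^sub>,\<^sub>x[F(\<Y>\<^sub>h(x) + z)]\<close>, defined where the integral exists.\<close>

definition yf_integral ::
  "real \<Rightarrow> real \<Rightarrow> planefun measure \<Rightarrow> (nat \<Rightarrow> planefun) \<Rightarrow> real \<Rightarrow> planefun \<Rightarrow> functional \<Rightarrow>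
   functional" where
  "yf_integral S T m \<phi> q h F = (\<lambda>z.
     if \<exists>v. has_yf_integral S T m \<phi> q h F z v
     then Some (THE v. has_yf_integral S T m \<phi> q h F z v) else None)"

text \<open>The head of the list is the innermost integration.\<close>

definition iterated_yf_integral ::
  "real \<Rightarrow> real \<Rightarrow> planefun measure \<Rightarrow> (nat \<Rightarrow> planefun) \<Rightarrow> real \<Rightarrow> planefun list \<Rightarrow> functional \<Rightarrow>
   functional" where
  "iterated_yf_integral S T m \<phi> q hs F = fold (yf_integral S T m \<phi> q) hs F"

end

theory Submission
  imports Defs
begin

text \<open>
  Since \<open>\<langle>v, x\<rangle>\<close> is centred Gaussian with variance \<open>\<parallel>v\<parallel>\<^sub>2\<^sup>2\<close>, integrating one variable \<open>x\<^sub>j\<close> out of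
  \<open>\<integral> exp {i \<Sum> c\<^sub>j \<langle>u h\<^sub>j, x\<^sub>j\<rangle>} df(u)\<close> by Fubini replaces its factor by \<open>exp {- \<parallel>u h\<^sub>j\<parallel>\<^sup>2 / (2 \<lambda>)}\<close> when
  \<open>c\<^sub>j = \<lambda>\<^sup>-\<^sup>1\<^sup>/\<^sup>2\<close>. The result is holomorphic on \<open>Re \<lambda> > 0\<close> and extends continuously to the
  boundary point \<open>- i q\<close> by dominated convergence. Iterating adds the exponents, and \<open>\<Sum> \<parallel>u h\<^sub>j\<parallel>\<^sup>2 = \<parallel>u s\<parallel>\<^sup>2\<close>.

  The substance lies in the law of \<open>\<langle>v, x\<rangle>\<close>. Riemann--Stieltjes integrals of functions of bounded variation
  against continuous functions exist because the sums are equicontinuous in the integrator and converge for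
  polynomials; their Gaussian law is read off the Riemann--Stieltjes sums. Almost sure convergence of the
  defining series of \<open>\<langle>v, x\<rangle>\<close> follows from a maximal inequality based on the fourth moments of the
  increments, so that joint independence of the coordinates is never needed.
\<close>

section \<open>Hardy--Krause variation\<close>

text \<open>The paths \<open>x\<close> are merely continuous, so all regularity has to come from the
  integrand: summation by parts in both variables puts every difference on \<open>g\<close> and
  leaves only the sup norm of \<open>x\<close>, and the boundary terms are exactly the sections in
  the Hardy--Krause condition. Normal laws are given for finite linear combinations of evaluations;
  every Gaussian statement is made for such combinations and carried through limits by
  characteristic functions, or by Fatou for fourth moments. The functional adds two obstacles. No
  moments of \<open>f\<close> are available, so the unbounded exponents are controlled inside the
  half-plane by exponential decay, and on its boundary only by the modulus being at most 1. And
  \<open>F\<close> is known along Gaussian paths only almost everywhere, while one analytic integral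
  involves uncountably many \<lambda>. The induction over the integrations therefore keeps the
  quantifier over all coefficients inside the almost-everywhere statement, and completeness of the
  measure makes the integrands measurable.\<close>

lemma sum_weak_partition:
  fixes a :: "nat \<Rightarrow> real"
  assumes "a 0 = 0" and "\<And>i. i < k \<Longrightarrow> a i \<le> a (Suc i)"
  shows "\<exists>k' p. partition_of (a k) k' p \<and>
    (\<forall>G::real \<Rightarrow> real \<Rightarrow> real. (\<forall>s. G s s = 0) \<longrightarrow>
      (\<Sum>i<k. G (a i) (a (Suc i))) = (\<Sum>i<k'. G (p i) (p (Suc i))))"
  using assms
proof (induction k)
  case 0
  have "partition_of (a 0) 0 (\<lambda>_. 0)" using 0 by (simp add: partition_of_def)
  then show ?case by force
next
  case (Suc k)
  then obtain k' p where p: "partition_of (a k) k' p"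
    and eq: "\<And>G::real \<Rightarrow> real \<Rightarrow> real. (\<forall>s. G s s = 0) \<Longrightarrow>
      (\<Sum>i<k. G (a i) (a (Suc i))) = (\<Sum>i<k'. G (p i) (p (Suc i)))"
    by (meson less_SucI)
  show ?case
  proof (cases "a (Suc k) = a k")
    case True
    then show ?thesis using p eq by (intro exI[of _ k'] exI[of _ p]) auto
  next
    case False
    with Suc.prems(2)[of k] have lt: "a k < a (Suc k)" by simp
    \<comment> \<open>Only a strictly new point is appended. A repeated point contributes
      \<open>G s s = 0\<close> and is skipped, so the same \<open>p\<close> serves every
      \<open>G\<close>.\<close>
    define p' where "p' i = (if i \<le> k' then p i else a (Suc k))" for i
    have "partition_of (a (Suc k)) (Suc k') p'"
      using p lt by (auto simp: partition_of_def p'_def less_Suc_eq_le) (metis Suc_leI le_less_linear order.antisym)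
    moreover have "(\<Sum>i<Suc k. G (a i) (a (Suc i))) = (\<Sum>i<Suc k'. G (p' i) (p' (Suc i)))"
      if "\<forall>s. G s s = 0" for G :: "real \<Rightarrow> real \<Rightarrow> real"
    proof -
      have "p k' = a k" using p by (simp add: partition_of_def)
      then have "(\<Sum>i<Suc k'. G (p' i) (p' (Suc i))) = (\<Sum>i<k'. G (p i) (p (Suc i))) + G (a k) (a (Suc k))"
        by (simp add: p'_def)
      then show ?thesis using eq[of G] that by simp
    qed
    ultimately show ?thesis by blast
  qed
qed

text \<open>Compared with \<open>partition_of\<close>, points may repeat and the last one may stay
  below \<open>b\<close>: neighbouring tags can coincide, and a variation function of the end point
  needs partitions that stop early.\<close>

definition weak_partition :: "real \<Rightarrow> nat \<Rightarrow> (nat \<Rightarrow> real) \<Rightarrow> bool" where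
  "weak_partition b k a \<longleftrightarrow> a 0 = 0 \<and> a k \<le> b \<and> (\<forall>i<k. a i \<le> a (Suc i))"

lemma weak_partition_mono:
  assumes "weak_partition b k a" "i \<le> j" "j \<le> k"
  shows "a i \<le> a j"
  using assms(2,3)
proof (induction j rule: dec_induct)
  case (step j)
  then have "a j \<le> a (Suc j)" using assms(1) by (simp add: weak_partition_def)
  then show ?case using step by simp
qed simp

lemma weak_partition_range:
  assumes "weak_partition b k a" "i \<le> k"
  shows "a i \<in> {0..b}"
  using weak_partition_mono[OF assms(1), of 0 i] weak_partition_mono[OF assms(1), of i k] assms
  by (auto simp: weak_partition_def)

lemma partition_imp_weak: "partition_of b k p \<Longrightarrow> weak_partition b k p"
  by (auto simp: partition_of_def weak_partition_def less_imp_le)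

lemma sum_weak_partition_le:
  fixes G :: "real \<Rightarrow> real \<Rightarrow> real"
  assumes "weak_partition b k a" and "\<And>s. G s s = 0" and "\<And>s s'. 0 \<le> G s s'"
    and "\<And>k p. partition_of b k p \<Longrightarrow> (\<Sum>i<k. G (p i) (p (Suc i))) \<le> C"
  shows "(\<Sum>i<k. G (a i) (a (Suc i))) \<le> C"
proof -
  \<comment> \<open>The point \<open>b\<close> is appended at index \<open>Suc k\<close>, since a
    partition must end there; the additional term is nonnegative and only enlarges the sum.\<close>
  define a' where "a' i = (if i \<le> k then a i else b)" for i
  have "a' 0 = 0" "\<And>i. i < Suc k \<Longrightarrow> a' i \<le> a' (Suc i)" and b: "a' (Suc k) = b"
    using assms(1) by (auto simp: a'_def weak_partition_def le_antisym not_le less_Suc_eq)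
  from sum_weak_partition[OF this(1,2)] obtain k' p where "partition_of b k' p"
    and eq: "(\<Sum>i<Suc k. G (a' i) (a' (Suc i))) = (\<Sum>i<k'. G (p i) (p (Suc i)))"
    using assms(2) b by metis
  have "(\<Sum>i<k. G (a i) (a (Suc i))) = (\<Sum>i<k. G (a' i) (a' (Suc i)))"
    by (intro sum.cong) (auto simp: a'_def)
  also have "\<dots> \<le> (\<Sum>i<Suc k. G (a' i) (a' (Suc i)))" using assms(3) by simp
  also have "\<dots> \<le> C" unfolding eq by (rule assms(4)) fact
  finally show ?thesis .
qed

lemma rect_increment_degenerate [simp]:
  "rect_increment x a a c d = 0" "rect_increment x a b c c = 0"
  by (simp_all add: rect_increment_def)

text \<open>One constant for all three Hardy--Krause variations, over weak partitions, so that
  estimates can insert arbitrary monotone sequences of points.\<close>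

definition variation_bound :: "real \<Rightarrow> real \<Rightarrow> planefun \<Rightarrow> real \<Rightarrow> bool" where
  "variation_bound S T h B \<longleftrightarrow>
     (\<forall>k a l b. weak_partition S k a \<longrightarrow> weak_partition T l b \<longrightarrow>
       (\<Sum>i<k. \<Sum>j<l. \<bar>rect_increment h (a i) (a (Suc i)) (b j) (b (Suc j))\<bar>) \<le> B) \<and>
     (\<forall>k a. weak_partition S k a \<longrightarrow> (\<Sum>i<k. \<bar>h (a (Suc i), 0) - h (a i, 0)\<bar>) \<le> B) \<and>
     (\<forall>l b. weak_partition T l b \<longrightarrow> (\<Sum>j<l. \<bar>h (0, b (Suc j)) - h (0, b j)\<bar>) \<le> B)"

lemma variation_boundD:
  assumes "variation_bound S T h B"
  shows "weak_partition S k a \<Longrightarrow> weak_partition T l b \<Longrightarrow>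
       (\<Sum>i<k. \<Sum>j<l. \<bar>rect_increment h (a i) (a (Suc i)) (b j) (b (Suc j))\<bar>) \<le> B"
    and "weak_partition S k a \<Longrightarrow> (\<Sum>i<k. \<bar>h (a (Suc i), 0) - h (a i, 0)\<bar>) \<le> B"
    and "weak_partition T l b \<Longrightarrow> (\<Sum>j<l. \<bar>h (0, b (Suc j)) - h (0, b j)\<bar>) \<le> B"
  using assms unfolding variation_bound_def by blast+

lemma HK_variation_bound:
  assumes "bounded_variation_HK S T h"
  shows "\<exists>B. variation_bound S T h B"
proof -
  obtain B0 B1 B2 where
    B0: "\<And>k p l r. partition_of S k p \<Longrightarrow> partition_of T l r \<Longrightarrow>
      (\<Sum>i<k. \<Sum>j<l. \<bar>rect_increment h (p i) (p (Suc i)) (r j) (r (Suc j))\<bar>) \<le> B0" and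
    B1: "\<And>k p. partition_of S k p \<Longrightarrow> (\<Sum>i<k. \<bar>h (p (Suc i), 0) - h (p i, 0)\<bar>) \<le> B1" and
    B2: "\<And>k p. partition_of T k p \<Longrightarrow> (\<Sum>i<k. \<bar>h (0, p (Suc i)) - h (0, p i)\<bar>) \<le> B2"
    using assms unfolding bounded_variation_HK_def bounded_variation_1_def by blast
  \<comment> \<open>Strictness is relaxed one coordinate at a time: for fixed \<open>r\<close> the
    inner sum is an interval function of \<open>s\<close> and \<open>s'\<close>; exchanging the sums
    then treats the other coordinate.\<close>
  have *: "(\<Sum>i<k. \<Sum>j<l. \<bar>rect_increment h (a i) (a (Suc i)) (r j) (r (Suc j))\<bar>) \<le> B0"
    if "weak_partition S k a" "partition_of T l r" for k a l r
    by (rule sum_weak_partition_le[OF that(1),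
          where G = "\<lambda>s s'. \<Sum>j<l. \<bar>rect_increment h s s' (r j) (r (Suc j))\<bar>"])
       (auto intro: sum_nonneg B0 that)
  have "(\<Sum>i<k. \<Sum>j<l. \<bar>rect_increment h (a i) (a (Suc i)) (b j) (b (Suc j))\<bar>) \<le> B0"
    if "weak_partition S k a" "weak_partition T l b" for k a l b
    by (subst sum.swap, rule sum_weak_partition_le[OF that(2),
          where G = "\<lambda>t t'. \<Sum>i<k. \<bar>rect_increment h (a i) (a (Suc i)) t t'\<bar>"])
       (auto intro: sum_nonneg, subst sum.swap, intro * that)
  moreover have "(\<Sum>i<k. \<bar>h (a (Suc i), 0) - h (a i, 0)\<bar>) \<le> B1" if "weak_partition S k a" for k a
    by (rule sum_weak_partition_le[OF that, where G = "\<lambda>s s'. \<bar>h (s', 0) - h (s, 0)\<bar>"]) (auto intro: B1)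
  moreover have "(\<Sum>j<l. \<bar>h (0, b (Suc j)) - h (0, b j)\<bar>) \<le> B2" if "weak_partition T l b" for l b
    by (rule sum_weak_partition_le[OF that, where G = "\<lambda>s s'. \<bar>h (0, s') - h (0, s)\<bar>"]) (auto intro: B2)
  ultimately show ?thesis
    unfolding variation_bound_def
    by (intro exI[of _ "max B0 (max B1 B2)"]) (meson max.coboundedI1 max.coboundedI2)
qed

lemma bounded_variation_HK_add:
  assumes "bounded_variation_HK S T g" "bounded_variation_HK S T h"
  shows "bounded_variation_HK S T (\<lambda>p. g p + h p)"
proof -
  obtain B where B': "variation_bound S T g B" using HK_variation_bound[OF assms(1)] by blast
  note B = variation_boundD[OF B']
  obtain C where C': "variation_bound S T h C" using HK_variation_bound[OF assms(2)] by blast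
  note C = variation_boundD[OF C']
  have tri: "\<bar>rect_increment (\<lambda>p. g p + h p) a b c d\<bar> \<le> \<bar>rect_increment g a b c d\<bar> + \<bar>rect_increment h a b c d\<bar>"
    for a b c d by (simp add: rect_increment_def)
  have "(\<Sum>i<k. \<Sum>j<l. \<bar>rect_increment (\<lambda>p. g p + h p) (a i) (a (Suc i)) (b j) (b (Suc j))\<bar>) \<le> B + C"
    if "partition_of S k a" "partition_of T l b" for k a l b
    using B(1)[OF that[THEN partition_imp_weak]] C(1)[OF that[THEN partition_imp_weak]]
    by (intro order.trans[OF sum_mono[OF sum_mono[OF tri]]]) (simp add: sum.distrib)
  moreover have "(\<Sum>i<k. \<bar>(g (a (Suc i), 0) + h (a (Suc i), 0)) - (g (a i, 0) + h (a i, 0))\<bar>) \<le> B + C"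
    if "partition_of S k a" for k a
  proof -
    have "(\<Sum>i<k. \<bar>(g (a (Suc i), 0) + h (a (Suc i), 0)) - (g (a i, 0) + h (a i, 0))\<bar>)
      \<le> (\<Sum>i<k. \<bar>g (a (Suc i), 0) - g (a i, 0)\<bar> + \<bar>h (a (Suc i), 0) - h (a i, 0)\<bar>)"
      by (intro sum_mono) linarith
    then show ?thesis using B(2)[OF that[THEN partition_imp_weak]] C(2)[OF that[THEN partition_imp_weak]]
      by (simp add: sum.distrib)
  qed
  moreover have "(\<Sum>i<k. \<bar>(g (0, a (Suc i)) + h (0, a (Suc i))) - (g (0, a i) + h (0, a i))\<bar>) \<le> B + C"
    if "partition_of T k a" for k a
  proof -
    have "(\<Sum>i<k. \<bar>(g (0, a (Suc i)) + h (0, a (Suc i))) - (g (0, a i) + h (0, a i))\<bar>)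
      \<le> (\<Sum>i<k. \<bar>g (0, a (Suc i)) - g (0, a i)\<bar> + \<bar>h (0, a (Suc i)) - h (0, a i)\<bar>)"
      by (intro sum_mono) linarith
    then show ?thesis using B(3)[OF that[THEN partition_imp_weak]] C(3)[OF that[THEN partition_imp_weak]]
      by (simp add: sum.distrib)
  qed
  ultimately show ?thesis
    unfolding bounded_variation_HK_def bounded_variation_1_def by blast
qed

lemma bounded_variation_HK_scale:
  assumes "bounded_variation_HK S T g"
  shows "bounded_variation_HK S T (\<lambda>p. c * g p)"
proof -
  obtain B where B': "variation_bound S T g B" using HK_variation_bound[OF assms(1)] by blast
  note B = variation_boundD[OF B']
  have "rect_increment (\<lambda>p. c * g p) a b d e = c * rect_increment g a b d e" for a b d e
    by (simp add: rect_increment_def algebra_simps)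
  then show ?thesis
    unfolding bounded_variation_HK_def bounded_variation_1_def right_diff_distrib[symmetric]
    using B partition_imp_weak
    by (simp only: abs_mult sum_distrib_left[symmetric]) (meson abs_ge_zero mult_left_mono)
qed

lemma bounded_variation_HK_zero: "bounded_variation_HK S T (\<lambda>_. 0)"
  by (auto simp: bounded_variation_HK_def bounded_variation_1_def rect_increment_def)

lemma bounded_variation_HK_sum:
  "(\<And>j. j \<in> A \<Longrightarrow> bounded_variation_HK S T (g j)) \<Longrightarrow> bounded_variation_HK S T (\<lambda>p. \<Sum>j\<in>A. g j p)"
  by (induction A rule: infinite_finite_induct)
     (auto intro: bounded_variation_HK_add bounded_variation_HK_zero)

lemma bounded_variation_HK_swap:
  assumes "bounded_variation_HK S T h"
  shows "bounded_variation_HK T S (\<lambda>(t, s). h (s, t))"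
proof -
  have eq: "rect_increment (\<lambda>(t, s). h (s, t)) c d a b = rect_increment h a b c d" for a b c d
    by (simp add: rect_increment_def)
  obtain B where B': "variation_bound S T h B" using HK_variation_bound[OF assms(1)] by blast
  note B = variation_boundD[OF B']
  have "(\<Sum>i<k. \<Sum>j<l. \<bar>rect_increment (\<lambda>(t, s). h (s, t)) (p i) (p (Suc i)) (r j) (r (Suc j))\<bar>) \<le> B"
    if "partition_of T k p" "partition_of S l r" for k p l r
    unfolding eq by (subst sum.swap) (intro B(1) partition_imp_weak that)
  then have "\<exists>B. \<forall>k p l r. partition_of T k p \<longrightarrow> partition_of S l r \<longrightarrow>
    (\<Sum>i<k. \<Sum>j<l. \<bar>rect_increment (\<lambda>(t, s). h (s, t)) (p i) (p (Suc i)) (r j) (r (Suc j))\<bar>) \<le> B"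
    by blast
  then show ?thesis using assms unfolding bounded_variation_HK_def by simp
qed

section \<open>Uniform control of all sections by monotone functions\<close>

lemma partition_through_finite_set:
  assumes "finite A" "A \<subseteq> {0..b}" "b > 0"
  shows "\<exists>l r. partition_of b l r \<and> A \<subseteq> r ` {..l}"
proof -
  let ?A = "insert 0 (insert b A)"
  define xs where "xs = sorted_list_of_set ?A"
  have set: "set xs = ?A" and st: "sorted_wrt (<) xs" and len: "length xs = card ?A"
    unfolding xs_def using assms by (simp_all only: set_sorted_list_of_set length_sorted_list_of_set finite_insert strict_sorted_list_of_set)
  have ne: "xs \<noteq> []" using set by auto
  have mono: "i \<le> j \<Longrightarrow> j < length xs \<Longrightarrow> xs ! i \<le> xs ! j" for i j
    using sorted_wrt_nth_less[OF st, of i j] by (cases "i = j") auto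
  have rng: "i < length xs \<Longrightarrow> xs ! i \<in> {0..b}" for i
    using nth_mem[of i xs] assms unfolding set by auto
  have "xs ! 0 = 0"
  proof -
    obtain i where "i < length xs" "xs ! i = 0" using set by (metis in_set_conv_nth insertI1)
    then show ?thesis using mono[of 0 i] rng[of 0] by force
  qed
  moreover have "xs ! (length xs - 1) = b"
  proof -
    obtain i where "i < length xs" "xs ! i = b" using set by (metis in_set_conv_nth insertI1 insertI2)
    then show ?thesis using mono[of i "length xs - 1"] rng[of "length xs - 1"] by force
  qed
  ultimately have "partition_of b (length xs - 1) ((!) xs)"
    using sorted_wrt_nth_less[OF st] by (simp add: partition_of_def)
  moreover have "A \<subseteq> (!) xs ` {..length xs - 1}"
  proof
    fix x assume "x \<in> A"
    then have "x \<in> set xs" using set by simp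
    then obtain i where "i < length xs" "xs ! i = x" by (auto simp: in_set_conv_nth)
    then show "x \<in> (!) xs ` {..length xs - 1}" by (intro image_eqI[of _ _ i]) auto
  qed
  ultimately show ?thesis by blast
qed

lemma rect_increment_telescope:
  "rect_increment h a b (r 0) (r n) = (\<Sum>j<n. rect_increment h a b (r j) (r (Suc j)))"
  by (induction n) (auto simp: rect_increment_def)

text \<open>The height \<open>\<tau> i\<close> may vary with the interval, which makes the supremum over all such sums a
  monotone function of the end point that controls the sections at all heights at once.\<close>

lemma HK_varying_height_bound:
  assumes "bounded_variation_HK S T h" "T > 0"
  obtains C where "\<And>k a \<tau>. weak_partition S k a \<Longrightarrow> (\<And>i. \<tau> i \<in> {0..T}) \<Longrightarrow>
    (\<Sum>i<k. \<bar>h (a (Suc i), \<tau> i) - h (a i, \<tau> i)\<bar>) \<le> C"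
proof -
  obtain B where B': "variation_bound S T h B" using HK_variation_bound[OF assms(1)] by blast
  note B = variation_boundD[OF B']
  have "(\<Sum>i<k. \<bar>h (a (Suc i), \<tau> i) - h (a i, \<tau> i)\<bar>) \<le> 2 * B"
    if a: "weak_partition S k a" and \<tau>: "\<And>i. \<tau> i \<in> {0..T}" for k a \<tau>
  proof -
    \<comment> \<open>All heights lie on one partition \<open>r\<close>. The increment at height
      \<open>\<tau> i\<close> thus differs from the one at height 0 by an initial part of a
      telescoping sum of rectangle increments, and both contributions are bounded by
      \<open>B\<close>.\<close>
    obtain l r where r: "partition_of T l r" "\<tau> ` {..<k} \<subseteq> r ` {..l}"
      using partition_through_finite_set[of "\<tau> ` {..<k}" T] \<tau> assms(2) by (metis finite_imageI finite_lessThan image_subsetI)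
    have r0: "r 0 = 0" using r by (simp add: partition_of_def)
    have "\<bar>h (a (Suc i), \<tau> i) - h (a i, \<tau> i)\<bar> \<le> \<bar>h (a (Suc i), 0) - h (a i, 0)\<bar> +
      (\<Sum>j<l. \<bar>rect_increment h (a i) (a (Suc i)) (r j) (r (Suc j))\<bar>)" if "i < k" for i
    proof -
      from r(2) that obtain j where j: "j \<le> l" "\<tau> i = r j" by auto
      have "\<bar>rect_increment h (a i) (a (Suc i)) 0 (\<tau> i)\<bar>
        \<le> (\<Sum>j<j. \<bar>rect_increment h (a i) (a (Suc i)) (r j) (r (Suc j))\<bar>)"
        unfolding j r0[symmetric] rect_increment_telescope[where r = r] by (rule sum_abs)
      also have "\<dots> \<le> (\<Sum>j<l. \<bar>rect_increment h (a i) (a (Suc i)) (r j) (r (Suc j))\<bar>)"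
        using j by (intro sum_mono2) auto
      finally show ?thesis unfolding rect_increment_def by linarith
    qed
    then have "(\<Sum>i<k. \<bar>h (a (Suc i), \<tau> i) - h (a i, \<tau> i)\<bar>) \<le>
      (\<Sum>i<k. \<bar>h (a (Suc i), 0) - h (a i, 0)\<bar> + (\<Sum>j<l. \<bar>rect_increment h (a i) (a (Suc i)) (r j) (r (Suc j))\<bar>))"
      by (intro sum_mono) auto
    then show ?thesis using B(1)[OF a partition_imp_weak[OF r(1)]] B(2)[OF a]
      by (simp add: sum.distrib)
  qed
  then show thesis using that by blast
qed

lemma HK_mono_control_fst:
  assumes "bounded_variation_HK S T h" "S > 0" "T > 0"
  shows "\<exists>V::real \<Rightarrow> real. mono V \<and> (\<forall>s\<in>{0..S}. \<forall>s'\<in>{0..S}. \<forall>t\<in>{0..T}. \<bar>h (s, t) - h (s', t)\<bar> \<le> \<bar>V s - V s'\<bar>)"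
proof -
  obtain C where C: "\<And>k a \<tau>. weak_partition S k a \<Longrightarrow> (\<And>i. \<tau> i \<in> {0..T}) \<Longrightarrow>
    (\<Sum>i<k. \<bar>h (a (Suc i), \<tau> i) - h (a i, \<tau> i)\<bar>) \<le> C"
    using HK_varying_height_bound[OF assms(1,3)] by blast
  define D where "D s = {v. \<exists>k a \<tau>. v = (\<Sum>i<k. \<bar>h (a (Suc i), \<tau> i) - h (a i, \<tau> i)\<bar>) \<and>
    weak_partition S k a \<and> a k = s \<and> (\<forall>i. \<tau> i \<in> {0..T})}" for s
  define V where "V s = Sup (D s)" for s
  have bdd: "bdd_above (D s)" for s
    by (rule bdd_aboveI[of _ C]) (auto simp: D_def intro!: C)
  have ne: "D s \<noteq> {}" if "s \<in> {0..S}" for s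
  proof -
    have "weak_partition S 1 (\<lambda>i. if i = 0 then 0 else s)" using that by (auto simp: weak_partition_def)
    moreover have "\<forall>i::nat. (0::real) \<in> {0..T}" using assms by auto
    ultimately show ?thesis unfolding D_def by fastforce
  qed
  have step: "V s + \<bar>h (s', t) - h (s, t)\<bar> \<le> V s'" if s: "s \<in> {0..S}" "s' \<in> {0..S}" "s \<le> s'" "t \<in> {0..T}" for s s' t
  proof -
    have "V s \<le> V s' - \<bar>h (s', t) - h (s, t)\<bar>"
      unfolding V_def
    proof (rule cSup_least[OF ne[OF s(1)]])
      fix v assume "v \<in> D s"
      then obtain k a \<tau> where v: "v = (\<Sum>i<k. \<bar>h (a (Suc i), \<tau> i) - h (a i, \<tau> i)\<bar>)"
        "weak_partition S k a" "a k = s" "\<forall>i. \<tau> i \<in> {0..T}" by (auto simp: D_def)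
      \<comment> \<open>Appending \<open>s'\<close> with height \<open>t\<close> turns a sum ending
        at \<open>s\<close> into one ending at \<open>s'\<close> that is larger by exactly the
        increment at height \<open>t\<close>.\<close>
      define a' \<tau>' where "a' i = (if i \<le> k then a i else s')" and "\<tau>' i = (if i < k then \<tau> i else t)" for i
      have w: "weak_partition S (Suc k) a'"
        using v s by (auto simp: weak_partition_def a'_def less_Suc_eq)
      have "(\<Sum>i<k. \<bar>h (a' (Suc i), \<tau>' i) - h (a' i, \<tau>' i)\<bar>) = v"
        unfolding v(1) by (intro sum.cong) (auto simp: a'_def \<tau>'_def)
      then have "v + \<bar>h (s', t) - h (s, t)\<bar> = (\<Sum>i<Suc k. \<bar>h (a' (Suc i), \<tau>' i) - h (a' i, \<tau>' i)\<bar>)"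
        using v by (simp add: a'_def \<tau>'_def)
      moreover have "a' (Suc k) = s'" "\<forall>i. \<tau>' i \<in> {0..T}" using v s by (auto simp: a'_def \<tau>'_def)
      ultimately have "v + \<bar>h (s', t) - h (s, t)\<bar> \<in> D s'" using w unfolding D_def by blast
      from cSup_upper[OF this bdd] show "v \<le> Sup (D s') - \<bar>h (s', t) - h (s, t)\<bar>" by linarith
    qed
    then show ?thesis by linarith
  qed
  \<comment> \<open>Clamping to the interval from 0 to \<open>S\<close> gives a function monotone on
    the whole line, so that its discontinuities are countable.\<close>
  define V' where "V' s = V (max 0 (min S s))" for s
  have rng: "max 0 (min S s) \<in> {0..S}" for s using assms by auto
  have "mono V'"
  proof
    fix x y :: real assume "x \<le> y"
    then have "max 0 (min S x) \<le> max 0 (min S y)" by linarith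
    from step[OF rng rng this, of 0] assms(3) show "V' x \<le> V' y"
      unfolding V'_def by (auto intro: order.trans[rotated])
  qed
  moreover have "\<bar>h (s, t) - h (s', t)\<bar> \<le> \<bar>V' s - V' s'\<bar>" if "s \<in> {0..S}" "s' \<in> {0..S}" "t \<in> {0..T}" for s s' t
    using step[of s s' t] step[of s' s t] that by (simp add: V'_def) linarith
  ultimately show ?thesis by blast
qed

text \<open>A substitute for a two-dimensional Jordan decomposition: the oscillation on a cell is at
  most the sum of the increments of one monotone function per coordinate. Boundedness, measurability
  and the comparison of Riemann--Stieltjes sums with Lebesgue integrals are all derived from
  this.\<close>

definition mono_controlled :: "real \<Rightarrow> real \<Rightarrow> (real \<Rightarrow> real) \<Rightarrow> (real \<Rightarrow> real) \<Rightarrow> planefun \<Rightarrow> bool" where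
  "mono_controlled S T V W g \<longleftrightarrow> mono V \<and> mono W \<and>
     (\<forall>s\<in>{0..S}. \<forall>s'\<in>{0..S}. \<forall>t\<in>{0..T}. \<forall>t'\<in>{0..T}.
        \<bar>g (s, t) - g (s', t')\<bar> \<le> \<bar>V s - V s'\<bar> + \<bar>W t - W t'\<bar>)"

lemma HK_mono_controlled:
  assumes "bounded_variation_HK S T h" "S > 0" "T > 0"
  shows "\<exists>V W. mono_controlled S T V W h"
proof -
  obtain V where V: "mono V" "\<And>s s' t. s\<in>{0..S} \<Longrightarrow> s'\<in>{0..S} \<Longrightarrow> t\<in>{0..T} \<Longrightarrow> \<bar>h (s, t) - h (s', t)\<bar> \<le> \<bar>V s - V s'\<bar>"
    using HK_mono_control_fst[OF assms] by blast
  obtain W where W: "mono W" "\<And>t t' s. t\<in>{0..T} \<Longrightarrow> t'\<in>{0..T} \<Longrightarrow> s\<in>{0..S} \<Longrightarrow> \<bar>h (s, t) - h (s, t')\<bar> \<le> \<bar>W t - W t'\<bar>"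
    using HK_mono_control_fst[OF bounded_variation_HK_swap[OF assms(1)] assms(3,2)] by auto
  have "\<bar>h (s, t) - h (s', t')\<bar> \<le> \<bar>V s - V s'\<bar> + \<bar>W t - W t'\<bar>"
    if "s\<in>{0..S}" "s'\<in>{0..S}" "t\<in>{0..T}" "t'\<in>{0..T}" for s s' t t'
    using V(2)[of s s' t] W(2)[of t t' s'] that by linarith
  with V(1) W(1) show ?thesis unfolding mono_controlled_def by blast
qed

lemma mono_controlled_bounded:
  assumes "mono_controlled S T V W g" "S > 0" "T > 0"
  shows "\<exists>B>0. \<forall>p\<in>rect S T. \<bar>g p\<bar> \<le> B"
proof -
  have "\<bar>g p\<bar> \<le> \<bar>g (0, 0)\<bar> + (V S - V 0) + (W T - W 0)" if pr: "p \<in> rect S T" for p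
  proof -
    obtain s t where p: "p = (s, t)" "s \<in> {0..S}" "t \<in> {0..T}"
      using pr unfolding rect_def by blast
    have "\<bar>g (s, t) - g (0, 0)\<bar> \<le> \<bar>V s - V 0\<bar> + \<bar>W t - W 0\<bar>"
      using assms p by (auto simp: mono_controlled_def)
    moreover have "V 0 \<le> V s" "V s \<le> V S" "W 0 \<le> W t" "W t \<le> W T"
      using assms p by (auto simp: mono_controlled_def intro: monoD)
    ultimately show ?thesis unfolding p(1) by linarith
  qed
  then show ?thesis by (intro exI[of _ "max 1 (\<bar>g (0, 0)\<bar> + (V S - V 0) + (W T - W 0))"]) (auto simp: le_max_iff_disj)
qed

text \<open>The variance of a Riemann--Stieltjes sum is a Riemann--Stieltjes sum for the squared
  integrand, whose limit is needed. The factor \<open>2 * B\<close> bounds the sum in the factored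
  difference of squares.\<close>

lemma mono_controlled_square:
  assumes "mono_controlled S T V W g" "S > 0" "T > 0"
  shows "\<exists>V W. mono_controlled S T V W (\<lambda>p. (g p)\<^sup>2)"
proof -
  obtain B where B: "B > 0" "\<And>p. p \<in> rect S T \<Longrightarrow> \<bar>g p\<bar> \<le> B" using mono_controlled_bounded[OF assms] by blast
  have "\<bar>(g (s, t))\<^sup>2 - (g (s', t'))\<^sup>2\<bar> \<le> \<bar>2 * B * V s - 2 * B * V s'\<bar> + \<bar>2 * B * W t - 2 * B * W t'\<bar>"
    if "s\<in>{0..S}" "s'\<in>{0..S}" "t\<in>{0..T}" "t'\<in>{0..T}" for s s' t t'
  proof -
    have "\<bar>g (s, t) + g (s', t')\<bar> \<le> 2 * B"
      using B(2)[of "(s, t)"] B(2)[of "(s', t')"] that by (auto simp: rect_def)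
    moreover have "\<bar>g (s, t) - g (s', t')\<bar> \<le> \<bar>V s - V s'\<bar> + \<bar>W t - W t'\<bar>"
      using assms that by (auto simp: mono_controlled_def)
    ultimately have "\<bar>g (s, t) + g (s', t')\<bar> * \<bar>g (s, t) - g (s', t')\<bar> \<le> 2 * B * (\<bar>V s - V s'\<bar> + \<bar>W t - W t'\<bar>)"
      using B(1) by (intro mult_mono) auto
    then show ?thesis
      using B(1) by (simp add: power2_eq_square square_diff_square_factored abs_mult
          right_diff_distrib[symmetric] distrib_left)
  qed
  moreover have "mono (\<lambda>s. 2 * B * V s)" "mono (\<lambda>s. 2 * B * W s)"
    using assms B(1) by (auto simp: mono_controlled_def mono_def)
  ultimately show ?thesis unfolding mono_controlled_def by blast
qed

section \<open>Existence of the Riemann--Stieltjes integral\<close>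

text \<open>Abel summation with shifted indices: \<open>G (Suc i)\<close> belongs to the interval
  from \<open>i\<close> to \<open>Suc i\<close>, and \<open>G 0\<close> is an extra initial value,
  later the value of the integrand on an axis.\<close>

lemma summation_by_parts:
  fixes G y :: "nat \<Rightarrow> real"
  shows "(\<Sum>i<k. G (Suc i) * (y (Suc i) - y i)) =
    G 0 * (y k - y 0) + (\<Sum>a<k. (G (Suc a) - G a) * (y k - y a))"
proof (induction k)
  case (Suc k)
  have "(\<Sum>a<k. (G (Suc a) - G a) * (y (Suc k) - y a)) =
    (\<Sum>a<k. (G (Suc a) - G a) * (y k - y a)) + (\<Sum>a<k. G (Suc a) - G a) * (y (Suc k) - y k)"
    unfolding sum_distrib_right sum.distrib[symmetric] by (intro sum.cong) (simp_all add: algebra_simps)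
  moreover have "(\<Sum>a<k. G (Suc a) - G a) = G k - G 0" by (rule sum_lessThan_telescope)
  ultimately show ?case using Suc by (simp add: algebra_simps)
qed simp

lemma summation_by_parts_bound:
  fixes G y :: "nat \<Rightarrow> real"
  assumes "\<And>i. i \<le> k \<Longrightarrow> \<bar>y i\<bar> \<le> X"
  shows "\<bar>\<Sum>i<k. G (Suc i) * (y (Suc i) - y i)\<bar> \<le> 2 * X * (\<bar>G 0\<bar> + (\<Sum>a<k. \<bar>G (Suc a) - G a\<bar>))"
proof -
  have X: "\<bar>y k - y a\<bar> \<le> 2 * X" if "a \<le> k" for a
    using assms[of k] assms[OF that] by simp
  have "\<bar>\<Sum>i<k. G (Suc i) * (y (Suc i) - y i)\<bar>
    \<le> \<bar>G 0 * (y k - y 0)\<bar> + \<bar>\<Sum>a<k. (G (Suc a) - G a) * (y k - y a)\<bar>"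
    unfolding summation_by_parts by (rule abs_triangle_ineq)
  also have "\<dots> \<le> \<bar>G 0\<bar> * (2 * X) + (\<Sum>a<k. \<bar>G (Suc a) - G a\<bar> * (2 * X))"
    by (intro add_mono order.trans[OF sum_abs] sum_mono) (auto simp: abs_mult intro!: mult_left_mono X)
  also have "\<dots> = 2 * X * (\<bar>G 0\<bar> + (\<Sum>a<k. \<bar>G (Suc a) - G a\<bar>))"
    unfolding sum_distrib_right[symmetric] by (simp add: algebra_simps)
  finally show ?thesis .
qed

text \<open>Abel summation in each index in turn. The four terms are the corner value, the
  variations of the two sections through the origin and the variation over rectangles; each index
  doubles the bound on \<open>y\<close>, whence the factor 4.\<close>

lemma summation_by_parts_bound_2:
  fixes G y :: "nat \<Rightarrow> nat \<Rightarrow> real"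
  assumes "\<And>i j. i \<le> k \<Longrightarrow> j \<le> l \<Longrightarrow> \<bar>y i j\<bar> \<le> X"
  shows "\<bar>\<Sum>i<k. \<Sum>j<l. G (Suc i) (Suc j) * (y (Suc i) (Suc j) - y i (Suc j) - y (Suc i) j + y i j)\<bar>
    \<le> 4 * X * (\<bar>G 0 0\<bar> + (\<Sum>b<l. \<bar>G 0 (Suc b) - G 0 b\<bar>) + (\<Sum>a<k. \<bar>G (Suc a) 0 - G a 0\<bar>) +
      (\<Sum>a<k. \<Sum>b<l. \<bar>G (Suc a) (Suc b) - G a (Suc b) - G (Suc a) b + G a b\<bar>))"
    (is "\<bar>?L\<bar> \<le> _")
proof -
  have X: "\<bar>y k j - y a j\<bar> \<le> 2 * X" if "a \<le> k" "j \<le> l" for a j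
    using assms[of k j] assms[OF that] that by simp
  have "?L = (\<Sum>j<l. \<Sum>i<k. G (Suc i) (Suc j) * ((y (Suc i) (Suc j) - y (Suc i) j) - (y i (Suc j) - y i j)))"
    by (subst sum.swap) (simp add: algebra_simps)
  also have "\<dots> = (\<Sum>j<l. G 0 (Suc j) * ((y k (Suc j) - y 0 (Suc j)) - (y k j - y 0 j))) +
      (\<Sum>a<k. \<Sum>j<l. (G (Suc a) (Suc j) - G a (Suc j)) * ((y k (Suc j) - y a (Suc j)) - (y k j - y a j)))"
    unfolding summation_by_parts[of "\<lambda>i. G i _" "\<lambda>i. y i _ - y i _"] sum.distrib
    by (subst (2) sum.swap) (simp add: algebra_simps)
  finally have "\<bar>?L\<bar> \<le> \<bar>\<Sum>j<l. G 0 (Suc j) * ((y k (Suc j) - y 0 (Suc j)) - (y k j - y 0 j))\<bar> +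
      (\<Sum>a<k. \<bar>\<Sum>j<l. (G (Suc a) (Suc j) - G a (Suc j)) * ((y k (Suc j) - y a (Suc j)) - (y k j - y a j))\<bar>)"
    by (simp only:) (rule order.trans[OF abs_triangle_ineq add_left_mono[OF sum_abs]])
  also have "\<dots> \<le> 2 * (2 * X) * (\<bar>G 0 0\<bar> + (\<Sum>b<l. \<bar>G 0 (Suc b) - G 0 b\<bar>)) +
      (\<Sum>a<k. 2 * (2 * X) * (\<bar>G (Suc a) 0 - G a 0\<bar> +
        (\<Sum>b<l. \<bar>(G (Suc a) (Suc b) - G a (Suc b)) - (G (Suc a) b - G a b)\<bar>)))"
    by (intro add_mono sum_mono summation_by_parts_bound[where y = "\<lambda>j. y k j - y _ j"]
        summation_by_parts_bound[where G = "\<lambda>j. G (Suc _) j - G _ j"] X) auto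
  also have "\<dots> = 4 * X * (\<bar>G 0 0\<bar> + (\<Sum>b<l. \<bar>G 0 (Suc b) - G 0 b\<bar>) + (\<Sum>a<k. \<bar>G (Suc a) 0 - G a 0\<bar>) +
      (\<Sum>a<k. \<Sum>b<l. \<bar>G (Suc a) (Suc b) - G a (Suc b) - G (Suc a) b + G a b\<bar>))"
    by (simp add: sum_distrib_left[symmetric] sum.distrib algebra_simps)
  finally show ?thesis .
qed

section \<open>Riemann--Stieltjes sums as a limit along a filter of tagged grids\<close>

type_synonym tagged = "nat \<times> (nat \<Rightarrow> real) \<times> (nat \<Rightarrow> real)"

definition fine_tagged :: "real \<Rightarrow> real \<Rightarrow> tagged set" where
  "fine_tagged b \<delta> = {(k, p, \<xi>). partition_of b k p \<and> (\<forall>i<k. p (Suc i) - p i < \<delta> \<and> \<xi> i \<in> {p i..p (Suc i)})}"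

fun RS_sum :: "planefun \<Rightarrow> planefun \<Rightarrow> tagged \<times> tagged \<Rightarrow> real" where
  "RS_sum g x ((k, p, \<xi>), (l, r, \<eta>)) =
     (\<Sum>i<k. \<Sum>j<l. g (\<xi> i, \<eta> j) * rect_increment x (p i) (p (Suc i)) (r j) (r (Suc j)))"

text \<open>With this filter, \<open>has_RS_integral\<close> becomes an ordinary
  \<open>tendsto\<close> statement, and uniqueness and arithmetic of limits apply directly.\<close>

definition mesh_filter :: "real \<Rightarrow> real \<Rightarrow> (tagged \<times> tagged) filter" where
  "mesh_filter S T = (INF \<delta>\<in>{0<..}. principal (fine_tagged S \<delta> \<times> fine_tagged T \<delta>))"

lemma fine_tagged_mono: "\<delta> \<le> \<delta>' \<Longrightarrow> fine_tagged b \<delta> \<subseteq> fine_tagged b \<delta>'"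
  by (fastforce simp: fine_tagged_def)

lemma eventually_mesh_filter:
  "eventually P (mesh_filter S T) \<longleftrightarrow> (\<exists>\<delta>>0. \<forall>d\<in>fine_tagged S \<delta> \<times> fine_tagged T \<delta>. P d)"
  unfolding mesh_filter_def
proof (subst eventually_INF_base)
  show "\<exists>x\<in>{0<..}. principal (fine_tagged S x \<times> fine_tagged T x)
     \<le> inf (principal (fine_tagged S a \<times> fine_tagged T a)) (principal (fine_tagged S b \<times> fine_tagged T b))"
    if "a \<in> {0<..}" "b \<in> {0<..}" for a b :: real
    using that fine_tagged_mono[of "min a b" a] fine_tagged_mono[of "min a b" b]
    by (intro bexI[of _ "min a b"] le_infI) (auto intro!: Sigma_mono)
qed (auto simp: eventually_principal)

lemma has_RS_integral_iff_tendsto: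
  "has_RS_integral S T g x I \<longleftrightarrow> (RS_sum g x \<longlongrightarrow> I) (mesh_filter S T)"
  unfolding tendsto_iff has_RS_integral_def eventually_mesh_filter
  by (intro arg_cong[where f = All] ext arg_cong2[where f = "(\<longrightarrow>)"] arg_cong[where f = Ex] arg_cong2[where f = "(\<and>)"] refl)
     (auto simp: fine_tagged_def dist_real_def)

text \<open>Equal intervals tagged at their left end points, with \<open>Suc n\<close> of them to
  avoid division by zero. This sequence runs into the mesh filter; a sequence is what measurability
  of limits, Fatou and dominated convergence require.\<close>

definition uniform_tagged :: "real \<Rightarrow> nat \<Rightarrow> tagged" where
  "uniform_tagged b n = (Suc n, \<lambda>i. b * real i / real (Suc n), \<lambda>i. b * real i / real (Suc n))"

lemma uniform_tagged_fine:
  assumes "b > 0" "b / real (Suc n) < \<delta>"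
  shows "uniform_tagged b n \<in> fine_tagged b \<delta>"
proof -
  have step: "b * real (Suc i) / real (Suc n) - b * real i / real (Suc n) = b / real (Suc n)" for i
    by (simp add: diff_divide_distrib[symmetric] right_diff_distrib[symmetric])
  moreover have "b / real (Suc n) > 0" using assms by simp
  ultimately have "b * real i / real (Suc n) < b * real (Suc i) / real (Suc n)" for i
    by (metis diff_gt_0_iff_gt)
  then show ?thesis using assms(2) step
    by (simp add: uniform_tagged_def fine_tagged_def partition_of_def less_imp_le del: of_nat_Suc)
qed

lemma uniform_tagged_mesh:
  assumes "S > 0" "T > 0"
  shows "filterlim (\<lambda>n. (uniform_tagged S n, uniform_tagged T n)) (mesh_filter S T) sequentially"
  unfolding filterlim_iff eventually_mesh_filter
proof safe
  fix P :: "tagged \<times> tagged \<Rightarrow> bool" and \<delta> :: real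
  assume \<delta>: "\<delta> > 0" "\<forall>d\<in>fine_tagged S \<delta> \<times> fine_tagged T \<delta>. P d"
  have "(\<lambda>n. b / real (Suc n)) \<longlonglongrightarrow> 0" for b :: real
    using tendsto_mult_right_zero[OF LIMSEQ_inverse_real_of_nat, of b] by (simp add: divide_inverse)
  then have "\<forall>\<^sub>F n in sequentially. b / real (Suc n) < \<delta>" for b :: real
    using \<delta>(1) order_tendstoD(2) by blast
  from this[of S] this[of T] show "\<forall>\<^sub>F n in sequentially. P (uniform_tagged S n, uniform_tagged T n)"
    by eventually_elim (use \<delta>(2) assms uniform_tagged_fine in blast)
qed

lemma mesh_filter_neq_bot: "S > 0 \<Longrightarrow> T > 0 \<Longrightarrow> mesh_filter S T \<noteq> bot"
  using uniform_tagged_mesh[of S T] filterlim_mono[of _ "mesh_filter S T" sequentially bot sequentially]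
  by (auto simp: filterlim_iff trivial_limit_def)

lemma RS_integral_eqI:
  assumes "has_RS_integral S T g x I" "S > 0" "T > 0"
  shows "RS_integral S T g x = I"
  unfolding RS_integral_def using assms(1) tendsto_unique[OF mesh_filter_neq_bot[OF assms(2,3)]]
  unfolding has_RS_integral_iff_tendsto by (intro the_equality) auto

lemma rect_increment_add: "rect_increment (\<lambda>p. x p + y p) a b c d = rect_increment x a b c d + rect_increment y a b c d"
  by (simp add: rect_increment_def)

lemma rect_increment_diff: "rect_increment (\<lambda>p. x p - y p) a b c d = rect_increment x a b c d - rect_increment y a b c d"
  by (simp add: rect_increment_def)

lemma RS_sum_diff_right: "RS_sum g (\<lambda>p. x p - y p) d = RS_sum g x d - RS_sum g y d"
  by (cases "(g, x, d)" rule: RS_sum.cases) (simp add: rect_increment_diff right_diff_distrib sum_subtractf)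

lemma RS_sum_sum_left: "RS_sum (\<lambda>p. \<Sum>j\<in>A. c j * g j p) x d = (\<Sum>j\<in>A. c j * RS_sum (g j) x d)"
  by (induction A rule: infinite_finite_induct; cases "(x, x, d)" rule: RS_sum.cases)
     (simp_all add: distrib_right sum.distrib sum_distrib_left mult.assoc)

lemma has_RS_integral_sum_left:
  assumes "\<And>j. j \<in> A \<Longrightarrow> has_RS_integral S T (g j) x (I j)"
  shows "has_RS_integral S T (\<lambda>p. \<Sum>j\<in>A. c j * g j p) x (\<Sum>j\<in>A. c j * I j)"
  using assms unfolding has_RS_integral_iff_tendsto RS_sum_sum_left
  by (intro tendsto_sum tendsto_mult_left) auto

lemma fine_tagged_range:
  assumes "(k, p, \<xi>) \<in> fine_tagged b \<delta>"
  shows "i \<le> k \<Longrightarrow> p i \<in> {0..b}" "i < k \<Longrightarrow> \<xi> i \<in> {0..b}" "p 0 = 0" "p k = b" "i < k \<Longrightarrow> p i \<le> p (Suc i)"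
    "i < k \<Longrightarrow> \<xi> i \<in> {p i..p (Suc i)}" "i < k \<Longrightarrow> p (Suc i) - p i \<le> \<delta>"
proof -
  from assms have w: "weak_partition b k p" by (auto simp: fine_tagged_def intro: partition_imp_weak)
  show *: "i \<le> k \<Longrightarrow> p i \<in> {0..b}" for i using weak_partition_range[OF w] .
  show "i < k \<Longrightarrow> \<xi> i \<in> {0..b}" using assms *[of i] *[of "Suc i"] by (force simp: fine_tagged_def)
qed (use assms in \<open>auto simp: fine_tagged_def partition_of_def less_imp_le\<close>)

text \<open>The tags, preceded by 0, form a weak partition, so the variation of \<open>g\<close> along them is bounded.\<close>

lemma RS_sum_bound:
  assumes "bounded_variation_HK S T g"
  shows "\<exists>C>0. \<forall>x X d \<delta>. (\<forall>p\<in>rect S T. \<bar>x p\<bar> \<le> X) \<longrightarrow> 0 \<le> X \<longrightarrow> d \<in> fine_tagged S \<delta> \<times> fine_tagged T \<delta> \<longrightarrow> \<bar>RS_sum g x d\<bar> \<le> C * X"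
proof -
  obtain B where B': "variation_bound S T g B" using HK_variation_bound[OF assms] by blast
  note B = variation_boundD[OF B']
  \<comment> \<open>The three copies of \<open>B\<close> account for the two axes and the
    rectangles, the 4 for the double summation by parts; the final 1 makes \<open>C\<close>
    positive.\<close>
  define C where "C = 4 * (\<bar>g (0, 0)\<bar> + 3 * \<bar>B\<bar>) + 1"
  have "\<bar>RS_sum g x d\<bar> \<le> C * X"
    if x: "\<forall>p\<in>rect S T. \<bar>x p\<bar> \<le> X" and X: "0 \<le> X" and d: "d \<in> fine_tagged S \<delta> \<times> fine_tagged T \<delta>" for x X d \<delta>
  proof -
    obtain k p \<xi> l r \<eta> where d_eq: "d = ((k, p, \<xi>), (l, r, \<eta>))" by (metis prod.collapse)
    have p: "(k, p, \<xi>) \<in> fine_tagged S \<delta>" and r: "(l, r, \<eta>) \<in> fine_tagged T \<delta>" using d d_eq by auto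
    define \<xi>' \<eta>' where "\<xi>' i = (case i of 0 \<Rightarrow> 0 | Suc i \<Rightarrow> \<xi> i)" and "\<eta>' j = (case j of 0 \<Rightarrow> 0 | Suc j \<Rightarrow> \<eta> j)" for i j
    have weak: "weak_partition b n (case_nat 0 z)" if z: "(n, q, z) \<in> fine_tagged b \<delta>" and "b \<ge> 0" for b n q z
      unfolding weak_partition_def
    proof (intro conjI allI impI)
      show "case_nat 0 z n \<le> b"
        using fine_tagged_range(2)[OF z, of "n - 1"] \<open>b \<ge> 0\<close> by (cases n) auto
      fix i assume "i < n"
      then show "case_nat 0 z i \<le> case_nat 0 z (Suc i)"
        using fine_tagged_range(2)[OF z, of i] fine_tagged_range(6)[OF z, of i] fine_tagged_range(6)[OF z, of "i - 1"]
        by (cases i) auto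
    qed simp
    have ST: "S \<ge> 0" "T \<ge> 0" using fine_tagged_range(1)[OF p, of 0] fine_tagged_range(1)[OF r, of 0] by auto
    have w: "weak_partition S k \<xi>'" "weak_partition T l \<eta>'"
      using weak[OF p ST(1)] weak[OF r ST(2)] by (simp_all add: \<xi>'_def[abs_def] \<eta>'_def[abs_def])
    define G where "G i j = g (\<xi>' i, \<eta>' j)" for i j
    have "\<bar>x (p i, r j)\<bar> \<le> X" if "i \<le> k" "j \<le> l" for i j
      using x fine_tagged_range(1)[OF p that(1)] fine_tagged_range(1)[OF r that(2)] by (auto simp: rect_def)
    from summation_by_parts_bound_2[of k l "\<lambda>i j. x (p i, r j)", OF this, of G]
    have "\<bar>RS_sum g x d\<bar> \<le> 4 * X * (\<bar>G 0 0\<bar> + (\<Sum>b<l. \<bar>G 0 (Suc b) - G 0 b\<bar>) + (\<Sum>a<k. \<bar>G (Suc a) 0 - G a 0\<bar>) +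
      (\<Sum>a<k. \<Sum>b<l. \<bar>G (Suc a) (Suc b) - G a (Suc b) - G (Suc a) b + G a b\<bar>))"
      by (simp add: d_eq G_def \<xi>'_def \<eta>'_def rect_increment_def)
    also have "\<dots> \<le> 4 * X * (\<bar>g (0, 0)\<bar> + \<bar>B\<bar> + \<bar>B\<bar> + \<bar>B\<bar>)"
      using B(1)[OF w] B(2)[OF w(1)] B(3)[OF w(2)] X
      by (intro mult_left_mono add_mono) (auto simp: G_def \<xi>'_def \<eta>'_def rect_increment_def)
    also have "\<dots> \<le> C * X" using X by (simp add: C_def algebra_simps)
    finally show ?thesis .
  qed
  moreover have "C > 0" by (simp add: C_def add_nonneg_pos)
  ultimately show ?thesis by blast
qed

text \<open>By the previous bound the Riemann--Stieltjes sums are equicontinuous in the integrator.\<close>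

lemma has_RS_integral_uniform_closure:
  assumes g: "bounded_variation_HK S T g" and ST: "S > 0" "T > 0"
    and dense: "\<And>e. e > 0 \<Longrightarrow> \<exists>y I. (\<forall>p\<in>rect S T. \<bar>x p - y p\<bar> < e) \<and> has_RS_integral S T g y I"
  shows "\<exists>I. has_RS_integral S T g x I"
proof -
  obtain C where C0: "C > 0" and C: "\<And>x X d \<delta>. \<forall>p\<in>rect S T. \<bar>x p\<bar> \<le> X \<Longrightarrow> 0 \<le> X \<Longrightarrow> d \<in> fine_tagged S \<delta> \<times> fine_tagged T \<delta> \<Longrightarrow> \<bar>RS_sum g x d\<bar> \<le> C * X"
    using RS_sum_bound[OF g] by blast
  have "\<forall>n. \<exists>y I. (\<forall>p\<in>rect S T. \<bar>x p - y p\<bar> < 1 / real (Suc n)) \<and> has_RS_integral S T g y I"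
    by (intro allI dense) simp
  then obtain y I where y: "\<And>n p. p \<in> rect S T \<Longrightarrow> \<bar>x p - y n p\<bar> < 1 / real (Suc n)"
    and I: "\<And>n. has_RS_integral S T g (y n) (I n)" by metis
  let ?F = "mesh_filter S T"
  have close: "\<bar>RS_sum g x d - RS_sum g (y n) d\<bar> \<le> C / real (Suc n)" if "d \<in> fine_tagged S \<delta> \<times> fine_tagged T \<delta>" for d n \<delta>
    using C[of "\<lambda>p. x p - y n p" "1 / real (Suc n)", OF _ _ that] y[of _ n] by (simp add: RS_sum_diff_right less_imp_le)
  have ev: "\<forall>\<^sub>F d in ?F. \<exists>\<delta>. d \<in> fine_tagged S \<delta> \<times> fine_tagged T \<delta>"
    unfolding eventually_mesh_filter by (intro exI[of _ 1]) (auto simp: fine_tagged_def)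
  have C_small: "\<exists>N. \<forall>n\<ge>N. C / real (Suc n) < e" if "e > 0" for e
  proof -
    have "(\<lambda>n. C / real (Suc n)) \<longlonglongrightarrow> 0"
      using tendsto_mult_right_zero[OF LIMSEQ_inverse_real_of_nat, of C] by (simp add: divide_inverse)
    from order_tendstoD(2)[OF this that] show ?thesis unfolding eventually_sequentially .
  qed
  \<comment> \<open>The sums for \<open>y n\<close> and \<open>y k\<close> are compared with those
    for \<open>x\<close> on a common tagged grid, and the inequality survives the limit along the
    filter.\<close>
  have II: "\<bar>I n - I k\<bar> \<le> C / real (Suc n) + C / real (Suc k)" for n k
  proof (rule tendsto_upperbound)
    show "((\<lambda>d. \<bar>RS_sum g (y n) d - RS_sum g (y k) d\<bar>) \<longlongrightarrow> \<bar>I n - I k\<bar>) ?F"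
      using I unfolding has_RS_integral_iff_tendsto by (intro tendsto_intros) auto
    show "\<forall>\<^sub>F d in ?F. \<bar>RS_sum g (y n) d - RS_sum g (y k) d\<bar> \<le> C / real (Suc n) + C / real (Suc k)"
      using ev
    proof eventually_elim
      case (elim d)
      then obtain \<delta> where "d \<in> fine_tagged S \<delta> \<times> fine_tagged T \<delta>" ..
      from close[OF this, of n] close[OF this, of k] show ?case by linarith
    qed
  qed (use mesh_filter_neq_bot ST in blast)
  have "Cauchy I"
  proof (rule metric_CauchyI)
    fix e :: real assume "e > 0"
    then obtain N where "\<forall>n\<ge>N. C / real (Suc n) < e / 2" using C_small[of "e / 2"] by auto
    then show "\<exists>N. \<forall>m\<ge>N. \<forall>n\<ge>N. dist (I m) (I n) < e"
      using order.strict_trans1[OF II] by (intro exI[of _ N] allI impI) (metis add_strict_mono dist_real_def field_sum_of_halves)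
  qed
  then obtain L where L: "I \<longlonglongrightarrow> L" using Cauchy_convergent convergent_def by blast
  have "(RS_sum g x \<longlongrightarrow> L) ?F"
    unfolding tendsto_iff
  proof safe
    fix e :: real assume e: "e > 0"
    obtain N where N: "\<forall>n\<ge>N. C / real (Suc n) < e / 3" using C_small[of "e / 3"] e by auto
    have "\<forall>\<^sub>F n in sequentially. dist (I n) L < e / 3" using tendstoD[OF L, of "e / 3"] e by simp
    then have "\<forall>\<^sub>F n in sequentially. dist (I n) L < e / 3 \<and> n \<ge> N" using eventually_ge_at_top by eventually_elim simp
    then obtain n where n: "dist (I n) L < e / 3" "n \<ge> N" using eventually_happens' sequentially_bot by blast
    have "\<forall>\<^sub>F d in ?F. dist (RS_sum g (y n) d) (I n) < e / 3"
      using tendstoD[OF I[of n, unfolded has_RS_integral_iff_tendsto], of "e / 3"] e by simp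
    then show "\<forall>\<^sub>F d in ?F. dist (RS_sum g x d) L < e"
      using ev
    proof eventually_elim
      case (elim d)
      then obtain \<delta> where "d \<in> fine_tagged S \<delta> \<times> fine_tagged T \<delta>" by blast
      then have "\<bar>RS_sum g x d - RS_sum g (y n) d\<bar> < e / 3" using order.strict_trans1[OF close[of d \<delta> n]] N n(2) by blast
      then show ?case using n(1) elim(1) unfolding dist_real_def by linarith
    qed
  qed
  then show ?thesis unfolding has_RS_integral_iff_tendsto by blast
qed

section \<open>Riemann--Stieltjes sums and Lebesgue integrals\<close>

abbreviation leb_rect :: "real \<Rightarrow> real \<Rightarrow> (real \<times> real) measure" where
  "leb_rect S T \<equiv> lebesgue_on (rect S T)"

lemma rect_lborel [measurable]: "rect S T \<in> sets lborel"
  unfolding rect_def lborel_prod[symmetric] by (intro pair_measureI) auto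

lemma rect_borel [measurable]: "rect S T \<in> sets borel"
  using rect_lborel by simp

lemma rect_lebesgue [simp]: "rect S T \<in> sets lebesgue"
  using rect_lborel by (simp only: sets_completionI_sets)

lemma finite_measure_leb_rect: "finite_measure (leb_rect S T)"
proof
  have "rect S T = cbox (0, 0) (S, T)" by (auto simp: rect_def cbox_def Basis_prod_def inner_prod_def)
  then have "emeasure lborel (rect S T) \<noteq> \<infinity>"
    by (metis emeasure_lborel_cbox_finite infinity_ennreal_def less_top)
  then show "emeasure (leb_rect S T) (space (leb_rect S T)) \<noteq> \<infinity>"
    by (simp add: emeasure_restrict_space)
qed

lemma AE_leb_rect_coordinates:
  assumes "countable A" "countable B"
  shows "AE p in leb_rect S T. fst p \<notin> A \<and> snd p \<notin> B"
proof -
  have "A \<times> UNIV \<in> null_sets (lborel :: (real \<times> real) measure)"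
    unfolding lborel_prod[symmetric]
    using countable_imp_null_set_lborel[OF assms(1)] by (intro lborel.times_in_null_sets1) auto
  moreover have "UNIV \<times> B \<in> null_sets (lborel :: (real \<times> real) measure)"
    unfolding lborel_prod[symmetric]
    using countable_imp_null_set_lborel[OF assms(2)] by (intro lborel.times_in_null_sets2) auto
  ultimately have "AE p in lebesgue. p \<notin> A \<times> UNIV \<and> p \<notin> UNIV \<times> B"
    by (intro AE_conjI AE_completion AE_not_in)
  then show ?thesis by (auto simp: AE_restrict_space_iff)
qed

text \<open>Serves twice: for functions of bounded variation, which are almost everywhere limits of
  measurable functions, and for the functional along Gaussian paths, which is known only almost
  everywhere.\<close>

lemma (in complete_measure) borel_measurable_AE_eq:
  fixes f g :: "'a \<Rightarrow> 'b::topological_space"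
  assumes "g \<in> borel_measurable M" "AE x in M. f x = g x"
  shows "f \<in> borel_measurable M"
proof (rule measurableI)
  fix A :: "'b set" assume A: "A \<in> sets borel"
  show "f -` A \<inter> space M \<in> sets M"
  proof (rule in_sets_AE)
    show "AE x in M. x \<in> g -` A \<inter> space M \<longleftrightarrow> x \<in> f -` A \<inter> space M"
      using assms(2) AE_space by eventually_elim auto
  qed (use assms(1) A in \<open>auto intro: measurable_sets\<close>)
qed simp

lemma borel_measurable_lebesgue_on_AE_eq:
  fixes f g :: "'a::euclidean_space \<Rightarrow> real"
  assumes "g \<in> borel_measurable (lebesgue_on A)" "AE x in lebesgue_on A. f x = g x" "A \<in> sets lebesgue"
  shows "f \<in> borel_measurable (lebesgue_on A)"
proof -
  have "AE x in lebesgue. (if x \<in> A then f x else 0) = (if x \<in> A then g x else 0)"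
    using assms(2,3) by (auto simp: AE_restrict_space_iff)
  from completion.borel_measurable_AE_eq[OF borel_measurable_if_I[OF assms(1,3)] this]
  show ?thesis by (rule borel_measurable_if_D)
qed

text \<open>Sampling \<open>g\<close> at lattice points factors through a countable set and is
  therefore measurable whatever \<open>g\<close> is. Rounding down stays inside the rectangle, and
  the samples converge wherever \<open>V\<close> and \<open>W\<close> are continuous, that is, off
  countably many horizontal and vertical lines.\<close>

lemma mono_controlled_measurable:
  assumes "mono_controlled S T V W g"
  shows "g \<in> borel_measurable (leb_rect S T)"
proof -
  define r where "r n t = real_of_int \<lfloor>t * real (Suc n)\<rfloor> / real (Suc n)" for n and t :: real
  define f where "f n p = g (r n (fst p), r n (snd p))" for n p
  have r_le: "r n t \<le> t" and r_ge: "t - 1 / real (Suc n) \<le> r n t" for n t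
  proof -
    have "real_of_int \<lfloor>t * real (Suc n)\<rfloor> \<le> t * real (Suc n)" by linarith
    then show "r n t \<le> t" unfolding r_def by (simp add: divide_le_eq)
    have "t * real (Suc n) - 1 \<le> real_of_int \<lfloor>t * real (Suc n)\<rfloor>" by linarith
    then have "(t * real (Suc n) - 1) / real (Suc n) \<le> r n t" unfolding r_def by (intro divide_right_mono) auto
    then show "t - 1 / real (Suc n) \<le> r n t" by (simp add: diff_divide_distrib)
  qed
  have r_nonneg: "0 \<le> r n t" if "0 \<le> t" for n t unfolding r_def using that by simp
  have r_lim: "(\<lambda>n. r n t) \<longlonglongrightarrow> t" for t
  proof (rule tendsto_sandwich)
    have "(\<lambda>n. t - 1 / real (Suc n)) \<longlonglongrightarrow> t - 0"
      by (intro tendsto_intros LIMSEQ_inverse_real_of_nat[unfolded inverse_eq_divide])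
    then show "(\<lambda>n. t - 1 / real (Suc n)) \<longlonglongrightarrow> t" by simp
  qed (use r_le r_ge in auto)
  have f_meas: "f n \<in> borel_measurable borel" for n
  proof -
    have fl: "(\<lambda>p::real \<times> real. (\<lfloor>fst p * real (Suc n)\<rfloor>, \<lfloor>snd p * real (Suc n)\<rfloor>)) \<in> measurable borel (count_space UNIV)"
      unfolding pair_measure_countable[symmetric, of UNIV UNIV, simplified] borel_prod[symmetric] by measurable
    have "(\<lambda>p. (\<lambda>(i, j). g (real_of_int i / real (Suc n), real_of_int j / real (Suc n)))
        (\<lfloor>fst p * real (Suc n)\<rfloor>, \<lfloor>snd p * real (Suc n)\<rfloor>)) \<in> borel_measurable borel"
      by (rule measurable_compose[OF fl]) simp
    then show ?thesis by (simp add: f_def[abs_def] r_def)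
  qed
  have VW: "mono V" "mono W" using assms by (auto simp: mono_controlled_def)
  have "AE p in leb_rect S T. fst p \<notin> {a. \<not> isCont V a} \<and> snd p \<notin> {a. \<not> isCont W a}"
    by (intro AE_leb_rect_coordinates mono_ctble_discont VW)
  then have "AE p in leb_rect S T. g p = lim (\<lambda>n. f n p)"
    using AE_space
  proof eventually_elim
    case (elim p)
    then obtain s t where p: "p = (s, t)" "s \<in> {0..S}" "t \<in> {0..T}" "isCont V s" "isCont W t"
      by (auto simp: rect_def)
    have "(\<lambda>n. f n p) \<longlonglongrightarrow> g p"
    proof (rule LIM_zero_cancel, rule Lim_null_comparison)
      have "(\<lambda>n. \<bar>V (r n s) - V s\<bar> + \<bar>W (r n t) - W t\<bar>) \<longlonglongrightarrow> \<bar>V s - V s\<bar> + \<bar>W t - W t\<bar>"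
        by (intro tendsto_intros isCont_tendsto_compose[OF p(4)] isCont_tendsto_compose[OF p(5)] r_lim)
      then show "(\<lambda>n. \<bar>V (r n s) - V s\<bar> + \<bar>W (r n t) - W t\<bar>) \<longlonglongrightarrow> 0" by simp
      have rr: "r n s \<in> {0..S}" "r n t \<in> {0..T}" for n
        using r_nonneg[of s n] r_le[of n s] r_nonneg[of t n] r_le[of n t] p by auto
      then show "\<forall>\<^sub>F n in sequentially. norm (f n p - g p) \<le> \<bar>V (r n s) - V s\<bar> + \<bar>W (r n t) - W t\<bar>"
        using assms p(2,3) unfolding mono_controlled_def f_def p(1) by simp
    qed
    then show ?case by (simp add: limI)
  qed
  moreover have "(\<lambda>p. lim (\<lambda>n. f n p)) \<in> borel_measurable (leb_rect S T)"
    using f_meas by (intro borel_measurable_lim_metric measurable_restrict_space1 measurable_completion) simp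
  ultimately show ?thesis by (intro borel_measurable_lebesgue_on_AE_eq[of _ "rect S T" g]) auto
qed

lemma integrable_leb_rect_bounded:
  fixes f :: "real \<times> real \<Rightarrow> real"
  assumes "f \<in> borel_measurable (leb_rect S T)" "\<And>p. p \<in> rect S T \<Longrightarrow> \<bar>f p\<bar> \<le> B"
  shows "integrable (leb_rect S T) f"
  using assms finite_measure_leb_rect
  by (intro finite_measure.integrable_const_bound[where B = B]) auto

section \<open>Integrators whose rectangle increments have a density\<close>

abbreviation cell :: "real \<Rightarrow> real \<Rightarrow> real \<Rightarrow> real \<Rightarrow> (real \<times> real) set" where
  "cell a b c d \<equiv> {a<..b} \<times> {c<..d}"

lemma cell_borel [measurable]: "cell a b c d \<in> sets borel"
  unfolding borel_prod[symmetric] by (intro pair_measureI) auto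

lemma borel_imp_leb_rect: "f \<in> borel_measurable borel \<Longrightarrow> f \<in> borel_measurable (leb_rect S T)"
  by (intro measurable_restrict_space1 measurable_completion) simp

text \<open>\<open>k\<close> plays the role of the mixed partial derivative of \<open>x\<close>.
  There are two applications: polynomials, which are dense among the integrators, and the product of
  the coordinates with density 1, which yields areas and variances.\<close>

definition has_density :: "real \<Rightarrow> real \<Rightarrow> planefun \<Rightarrow> planefun \<Rightarrow> bool" where
  "has_density S T x k \<longleftrightarrow> k \<in> borel_measurable borel \<and> (\<exists>K\<ge>0. \<forall>p\<in>rect S T. \<bar>k p\<bar> \<le> K) \<and>
     (\<forall>a b c d. 0 \<le> a \<longrightarrow> a \<le> b \<longrightarrow> b \<le> S \<longrightarrow> 0 \<le> c \<longrightarrow> c \<le> d \<longrightarrow> d \<le> T \<longrightarrow>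
        rect_increment x a b c d = (\<integral>p. indicator (cell a b c d) p * k p \<partial>leb_rect S T))"

lemma has_density_integrable:
  assumes "has_density S T x k" "f \<in> borel_measurable (leb_rect S T)" "\<And>p. p \<in> rect S T \<Longrightarrow> \<bar>f p\<bar> \<le> B"
  shows "integrable (leb_rect S T) (\<lambda>p. f p * k p)"
proof -
  from assms(1) obtain K where [measurable]: "k \<in> borel_measurable borel" and K: "K \<ge> 0" "\<And>p. p \<in> rect S T \<Longrightarrow> \<bar>k p\<bar> \<le> K"
    by (auto simp: has_density_def)
  show ?thesis
  proof (rule integrable_leb_rect_bounded[where B = "\<bar>B\<bar> * K"])
    show "(\<lambda>p. f p * k p) \<in> borel_measurable (leb_rect S T)"
      by (intro borel_measurable_times assms borel_imp_leb_rect) measurable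
    show "\<bar>f p * k p\<bar> \<le> \<bar>B\<bar> * K" if "p \<in> rect S T" for p
      unfolding abs_mult using assms(3)[OF that] K that by (intro mult_mono) auto
  qed
qed

lemma has_density_add:
  assumes "has_density S T x k" "has_density S T y l"
  shows "has_density S T (\<lambda>p. x p + y p) (\<lambda>p. k p + l p)"
proof -
  have ind: "(\<lambda>p. indicator (cell a b c d) p :: real) \<in> borel_measurable (leb_rect S T)" for a b c d
    by (intro borel_imp_leb_rect) measurable
  have 1: "integrable (leb_rect S T) (\<lambda>p. indicator (cell a b c d) p * k p)" for a b c d
    by (rule has_density_integrable[OF assms(1) ind, where B = 1]) (auto simp: indicator_def)
  have 2: "integrable (leb_rect S T) (\<lambda>p. indicator (cell a b c d) p * l p)" for a b c d
    by (rule has_density_integrable[OF assms(2) ind, where B = 1]) (auto simp: indicator_def)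
  from assms obtain K L where "K \<ge> 0" "\<forall>p\<in>rect S T. \<bar>k p\<bar> \<le> K" "L \<ge> 0" "\<forall>p\<in>rect S T. \<bar>l p\<bar> \<le> L"
    by (auto simp: has_density_def)
  then have "\<exists>K\<ge>0. \<forall>p\<in>rect S T. \<bar>k p + l p\<bar> \<le> K"
    by (intro exI[of _ "K + L"]) (force intro: order.trans[OF abs_triangle_ineq add_mono])
  then show ?thesis using assms
    unfolding has_density_def rect_increment_add by (auto simp: distrib_left 1 2)
qed

text \<open>For \<open>m = 0\<close> the exponent \<open>m - 1\<close> is truncated, but the factor
  \<open>real m\<close> vanishes. \<open>C\<close> stays outside the one-dimensional integrals
  because the fundamental theorem is used in its version for nonnegative derivatives, which fits
  since the cells lie in the first quadrant.\<close>

lemma has_density_monomial: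
  "has_density S T (\<lambda>p. C * fst p ^ m * snd p ^ n)
     (\<lambda>p. C * (real m * fst p ^ (m - 1)) * (real n * snd p ^ (n - 1)))"
proof -
  define D where "D m s = real m * s ^ (m - 1)" for m and s :: real
  have D: "has_bochner_integral lborel (\<lambda>s. D m s * indicator {a<..b} s) (b ^ m - a ^ m)" if "0 \<le> a" "a \<le> b" for a b :: real and m
  proof -
    have 1: "has_bochner_integral lborel (\<lambda>s. D m s * indicator {a..b} s) (b ^ m - a ^ m)"
      using that by (intro has_bochner_integral_FTC_Icc_nonneg) (auto simp: D_def intro!: derivative_eq_intros)
    have "AE s in lborel. s \<noteq> a" by (rule AE_lborel_singleton)
    then have 2: "AE s in lborel. D m s * indicator {a..b} s = D m s * indicator {a<..b} s"
      by eventually_elim (auto simp: indicator_def)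
    show ?thesis
      by (rule has_bochner_integral_cong_AE[THEN iffD1, OF _ _ 2 1]) (auto simp: D_def)
  qed
  have cellint: "rect_increment (\<lambda>p. C * fst p ^ m * snd p ^ n) a b c d =
    (\<integral>p. indicator (cell a b c d) p * (C * D m (fst p) * D n (snd p)) \<partial>leb_rect S T)"
    if ab: "0 \<le> a" "a \<le> b" "b \<le> S" and cd: "0 \<le> c" "c \<le> d" "d \<le> T" for a b c d
  proof -
    define f where "f p = indicator (cell a b c d) p * (C * D m (fst p) * D n (snd p))" for p
    have [measurable]: "(\<lambda>p. D m (fst p)) \<in> borel_measurable (borel :: (real \<times> real) measure)"
      "(\<lambda>p. D n (snd p)) \<in> borel_measurable (borel :: (real \<times> real) measure)"
      unfolding D_def by (intro borel_measurable_continuous_onI continuous_intros)+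
    have fm: "f \<in> borel_measurable borel" unfolding f_def by measurable
    have f_eq: "f (s, t) = C * (D m s * indicator {a<..b} s) * (D n t * indicator {c<..d} t)" for s t
      by (auto simp: f_def indicator_def)
    note Dm = D[of a b m, OF ab(1,2)] and Dn = D[of c d n, OF cd(1,2)]
    have int: "integrable (lborel \<Otimes>\<^sub>M lborel) f"
    proof (rule lborel_pair.Fubini_integrable)
      show "f \<in> borel_measurable (lborel \<Otimes>\<^sub>M lborel)" using fm by (simp add: lborel_prod)
      show "integrable lborel (\<lambda>x. \<integral> y. norm (f (x, y)) \<partial>lborel)"
      proof -
        have "integrable lborel (\<lambda>s. norm (D m s * indicator {a<..b} s))"
          using Dm by (intro integrable_norm) (simp add: has_bochner_integral_iff)
        then show ?thesis unfolding f_eq norm_mult by simp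
      qed
      show "AE x in lborel. integrable lborel (\<lambda>y. f (x, y))"
        unfolding f_eq using Dn by (simp add: has_bochner_integral_iff)
    qed
    have "(\<integral>p. f p \<partial>leb_rect S T) = (\<integral>p. indicator (rect S T) p *\<^sub>R f p \<partial>lebesgue)"
      by (rule integral_restrict_space) simp
    also have "\<dots> = (\<integral>p. f p \<partial>lebesgue)"
      using ab cd by (intro Bochner_Integration.integral_cong refl) (auto simp: f_def rect_def indicator_def)
    also have "\<dots> = (\<integral>p. f p \<partial>(lborel \<Otimes>\<^sub>M lborel))"
      unfolding lborel_prod using fm by (intro integral_completion) simp
    also have "\<dots> = (\<integral>s. (\<integral>t. f (s, t) \<partial>lborel) \<partial>lborel)"
      using lborel_pair.integral_fst'[OF int] by simp
    also have "\<dots> = C * (b ^ m - a ^ m) * (d ^ n - c ^ n)"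
      unfolding f_eq using Dm Dn by (simp add: has_bochner_integral_iff)
    finally show ?thesis by (simp add: f_def rect_increment_def algebra_simps)
  qed
  have "\<exists>K\<ge>0. \<forall>p\<in>rect S T. \<bar>C * D m (fst p) * D n (snd p)\<bar> \<le> K"
  proof -
    have "compact (rect S T)" by (auto simp: rect_def intro: compact_Times)
    moreover have "continuous_on (rect S T) (\<lambda>p. C * D m (fst p) * D n (snd p))"
      unfolding D_def by (intro continuous_intros)
    ultimately have "bounded ((\<lambda>p. C * D m (fst p) * D n (snd p)) ` rect S T)"
      by (intro compact_imp_bounded compact_continuous_image)
    then obtain K where "\<forall>p\<in>rect S T. \<bar>C * D m (fst p) * D n (snd p)\<bar> \<le> K" by (auto simp: bounded_iff)
    then show ?thesis by (intro exI[of _ "\<bar>K\<bar>"]) force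
  qed
  moreover have "(\<lambda>p. C * D m (fst p) * D n (snd p)) \<in> borel_measurable (borel :: (real \<times> real) measure)"
    unfolding D_def by (intro borel_measurable_continuous_onI continuous_intros)
  ultimately show ?thesis unfolding has_density_def D_def[symmetric] using cellint by blast
qed

text \<open>Half-open cells are disjoint and cover everything except the axes, a null set. Each
  one-dimensional indicator is a difference of indicators of half-lines, so the sum
  telescopes.\<close>

lemma sum_indicator_cells:
  assumes p: "\<And>i. i < k \<Longrightarrow> p i \<le> p (Suc i)" "p 0 = 0" "p k = S" and r: "\<And>i. i < l \<Longrightarrow> r i \<le> r (Suc i)" "r 0 = 0" "r l = T"
    and "s \<in> {0<..S}" "t \<in> {0<..T}"
  shows "(\<Sum>i<k. \<Sum>j<l. indicator (cell (p i) (p (Suc i)) (r j) (r (Suc j))) (s, t)) = (1::real)"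
proof -
  have *: "(\<Sum>i<k. indicator {p i<..p (Suc i)} s) = (1::real)"
    if "\<And>i. i < k \<Longrightarrow> p i \<le> p (Suc i)" "p 0 = 0" "p k = S" "s \<in> {0<..S}" for k and p :: "nat \<Rightarrow> real" and s S
  proof -
    have "(\<Sum>i<k. indicator {p i<..p (Suc i)} s) = (\<Sum>i<k. indicator {..p (Suc i)} s - indicator {..p i} s :: real)"
      using that(1) by (intro sum.cong) (force simp: indicator_def)+
    also have "\<dots> = indicator {..p k} s - indicator {..p 0} s" by (rule sum_lessThan_telescope)
    finally show ?thesis using that by (simp add: indicator_def)
  qed
  have "(\<Sum>i<k. \<Sum>j<l. indicator (cell (p i) (p (Suc i)) (r j) (r (Suc j))) (s, t)) =
    (\<Sum>i<k. indicator {p i<..p (Suc i)} s) * (\<Sum>j<l. indicator {r j<..r (Suc j)} t :: real)"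
    unfolding sum_product by (intro sum.cong) (auto simp: indicator_def)
  then show ?thesis using *[OF p assms(7)] *[OF r assms(8)] by simp
qed

text \<open>On each cell \<open>g\<close> oscillates by at most the increments of the monotone functions \<open>V\<close> and \<open>W\<close>; these
  increments add up to a fixed constant, and the mesh factors out.\<close>

lemma RS_sum_density_estimate:
  assumes g: "mono_controlled S T V W g" and k: "has_density S T x k" and ST: "S > 0" "T > 0"
    and K: "\<And>p. p \<in> rect S T \<Longrightarrow> \<bar>k p\<bar> \<le> K" and d: "d \<in> fine_tagged S \<delta> \<times> fine_tagged T \<delta>"
  shows "\<bar>RS_sum g x d - (\<integral>p. g p * k p \<partial>leb_rect S T)\<bar> \<le> K * \<delta> * ((V S - V 0) * T + (W T - W 0) * S)"
proof -
  obtain n q \<xi> l r \<eta> where d_eq: "d = ((n, q, \<xi>), (l, r, \<eta>))" by (metis prod.collapse)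
  have q: "(n, q, \<xi>) \<in> fine_tagged S \<delta>" and r: "(l, r, \<eta>) \<in> fine_tagged T \<delta>" using d d_eq by auto
  note q' = fine_tagged_range[OF q] and r' = fine_tagged_range[OF r]
  have K0: "0 \<le> K" using K[of "(0, 0)"] ST by (auto simp: rect_def)
  have \<delta>: "\<delta> \<ge> 0"
  proof -
    have "n > 0" using q'(3,4) ST by (cases n) auto
    then show ?thesis using q'(5,7)[of 0] by linarith
  qed
  have VW: "mono V" "mono W" using g by (auto simp: mono_controlled_def)
  define C where "C i j = cell (q i) (q (Suc i)) (r j) (r (Suc j))" for i j
  define one where "one i j = (\<lambda>p. indicator (C i j) p :: real)" for i j
  let ?I = "\<lambda>f. \<integral>p. f p \<partial>leb_rect S T"
  note [measurable] = mono_controlled_measurable[OF g]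
  obtain B where B: "B > 0" "\<forall>p\<in>rect S T. \<bar>g p\<bar> \<le> B" using mono_controlled_bounded[OF g ST] by blast
  have one[measurable]: "one i j \<in> borel_measurable (leb_rect S T)" for i j
    unfolding one_def C_def by (intro borel_imp_leb_rect) measurable
  have int1: "integrable (leb_rect S T) (\<lambda>p. one i j p * k p)" for i j
    by (rule has_density_integrable[OF k one, where B = 1]) (auto simp: one_def indicator_def)
  have int2: "integrable (leb_rect S T) (\<lambda>p. one i j p * g p * k p)" for i j
  proof (rule has_density_integrable[OF k, where B = B])
    show "\<bar>one i j p * g p\<bar> \<le> B" if "p \<in> rect S T" for p using B that by (auto simp: one_def indicator_def)
  qed measurable
  have k_meas[measurable]: "k \<in> borel_measurable (leb_rect S T)" using k by (auto simp: has_density_def borel_imp_leb_rect)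
  have "AE p in leb_rect S T. fst p \<notin> {0} \<and> snd p \<notin> {0}" by (intro AE_leb_rect_coordinates) auto
  then have "AE p in leb_rect S T. g p * k p = (\<Sum>i<n. \<Sum>j<l. one i j p * g p * k p)"
    using AE_space
  proof eventually_elim
    case (elim p)
    then have "(\<Sum>i<n. \<Sum>j<l. one i j (fst p, snd p)) = 1"
      unfolding one_def C_def using q' r' by (intro sum_indicator_cells) (auto simp: rect_def)
    then show ?case by (simp add: sum_distrib_right[symmetric])
  qed
  then have "?I (\<lambda>p. g p * k p) = ?I (\<lambda>p. \<Sum>i<n. \<Sum>j<l. one i j p * g p * k p)"
    by (intro integral_cong_AE) measurable
  also have "\<dots> = (\<Sum>i<n. \<Sum>j<l. ?I (\<lambda>p. one i j p * g p * k p))"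
    using int2 by (simp add: Bochner_Integration.integral_sum)
  finally have Igk: "?I (\<lambda>p. g p * k p) = (\<Sum>i<n. \<Sum>j<l. ?I (\<lambda>p. one i j p * g p * k p))" .
  have RS: "RS_sum g x d = (\<Sum>i<n. \<Sum>j<l. ?I (\<lambda>p. g (\<xi> i, \<eta> j) * (one i j p * k p)))"
    using k q' r' by (auto simp: d_eq one_def C_def has_density_def intro!: sum.cong)
  have cellbd: "\<bar>?I (\<lambda>p. g (\<xi> i, \<eta> j) * (one i j p * k p)) - ?I (\<lambda>p. one i j p * g p * k p)\<bar>
      \<le> K * \<delta> * ((V (q (Suc i)) - V (q i)) * (r (Suc j) - r j) + (W (r (Suc j)) - W (r j)) * (q (Suc i) - q i))"
    if ij: "i < n" "j < l" for i j
  proof -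
    define c where "c = V (q (Suc i)) - V (q i) + (W (r (Suc j)) - W (r j))"
    have incr: "0 \<le> V (q (Suc i)) - V (q i)" "0 \<le> W (r (Suc j)) - W (r j)"
      using VW q'(5)[OF ij(1)] r'(5)[OF ij(2)] by (auto dest: monoD)
    \<comment> \<open>The product of the coordinates has density 1, so its rectangle increment is
      the area of the cell.\<close>
    have k1: "has_density S T (\<lambda>p. 1 * fst p ^ 1 * snd p ^ 1) (\<lambda>p. 1 * (real 1 * fst p ^ (1 - 1)) * (real 1 * snd p ^ (1 - 1)))"
      by (rule has_density_monomial)
    have area: "?I (one i j) = (q (Suc i) - q i) * (r (Suc j) - r j)"
      using k1 q'(1)[of i] q'(1)[of "Suc i"] q'(5)[of i] r'(1)[of j] r'(1)[of "Suc j"] r'(5)[of j] ij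
      by (simp add: has_density_def one_def C_def rect_increment_def algebra_simps)
    have int0: "integrable (leb_rect S T) (one i j)"
      by (rule integrable_leb_rect_bounded[OF one, where B = 1]) (auto simp: one_def indicator_def)
    have "?I (\<lambda>p. g (\<xi> i, \<eta> j) * (one i j p * k p)) - ?I (\<lambda>p. one i j p * g p * k p)
      = ?I (\<lambda>p. g (\<xi> i, \<eta> j) * (one i j p * k p) - one i j p * g p * k p)"
      using int1 int2 by simp
    also have "\<bar>\<dots>\<bar> \<le> ?I (\<lambda>p. K * c * one i j p)"
    proof (rule integral_abs_bound_integral)
      fix p assume "p \<in> space (leb_rect S T)"
      then have p: "p \<in> rect S T" by simp
      show "\<bar>g (\<xi> i, \<eta> j) * (one i j p * k p) - one i j p * g p * k p\<bar> \<le> K * c * one i j p"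
      proof (cases "p \<in> C i j")
        case True
        obtain s t where st: "p = (s, t)" "s \<in> {0..S}" "t \<in> {0..T}" using p by (auto simp: rect_def)
        have "\<bar>g (\<xi> i, \<eta> j) - g (s, t)\<bar> \<le> \<bar>V (\<xi> i) - V s\<bar> + \<bar>W (\<eta> j) - W t\<bar>"
          using g st q'(2)[OF ij(1)] r'(2)[OF ij(2)] by (auto simp: mono_controlled_def)
        also have "\<dots> \<le> c"
        proof -
          have "V (q i) \<le> V s" "V s \<le> V (q (Suc i))" "V (q i) \<le> V (\<xi> i)" "V (\<xi> i) \<le> V (q (Suc i))"
            "W (r j) \<le> W t" "W t \<le> W (r (Suc j))" "W (r j) \<le> W (\<eta> j)" "W (\<eta> j) \<le> W (r (Suc j))"
            using True st q'(6)[OF ij(1)] r'(6)[OF ij(2)] VW by (auto simp: C_def intro!: monoD[OF VW(1)] monoD[OF VW(2)])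
          then show ?thesis unfolding c_def by linarith
        qed
        finally have "\<bar>k p\<bar> * \<bar>g (\<xi> i, \<eta> j) - g p\<bar> \<le> K * c" using K[OF p] K0 st(1) by (intro mult_mono) auto
        moreover have "g (\<xi> i, \<eta> j) * (one i j p * k p) - one i j p * g p * k p = k p * (g (\<xi> i, \<eta> j) - g p)"
          using True by (simp add: one_def algebra_simps)
        ultimately show ?thesis using True by (simp add: one_def abs_mult)
      qed (simp add: one_def)
    next
      show "integrable (leb_rect S T) (\<lambda>p. K * c * one i j p)" using int0 by simp
    qed (use int1 int2 in simp)
    also have "\<dots> = K * (c * ((q (Suc i) - q i) * (r (Suc j) - r j)))" using area by simp
    \<comment> \<open>In the \<open>V\<close> term the width is bounded by \<delta> and the height
      kept, in the \<open>W\<close> term the reverse. Summation over all cells then telescopes in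
      both coordinates.\<close>
    also have "\<dots> \<le> K * (\<delta> * ((V (q (Suc i)) - V (q i)) * (r (Suc j) - r j) + (W (r (Suc j)) - W (r j)) * (q (Suc i) - q i)))"
    proof (rule mult_left_mono[OF _ K0])
      have q1: "0 \<le> q (Suc i) - q i" "q (Suc i) - q i \<le> \<delta>" and r1: "0 \<le> r (Suc j) - r j" "r (Suc j) - r j \<le> \<delta>"
        using q'(5,7)[OF ij(1)] r'(5,7)[OF ij(2)] by auto
      have "(V (q (Suc i)) - V (q i)) * (r (Suc j) - r j) * (q (Suc i) - q i) \<le> (V (q (Suc i)) - V (q i)) * (r (Suc j) - r j) * \<delta>"
        using incr q1 r1 by (intro mult_left_mono) auto
      moreover have "(W (r (Suc j)) - W (r j)) * (q (Suc i) - q i) * (r (Suc j) - r j) \<le> (W (r (Suc j)) - W (r j)) * (q (Suc i) - q i) * \<delta>"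
        using incr q1 r1 by (intro mult_left_mono) auto
      ultimately show "c * ((q (Suc i) - q i) * (r (Suc j) - r j)) \<le> \<delta> * ((V (q (Suc i)) - V (q i)) * (r (Suc j) - r j) + (W (r (Suc j)) - W (r j)) * (q (Suc i) - q i))"
        unfolding c_def by (simp add: algebra_simps)
    qed
    finally show ?thesis by (simp add: mult.assoc)
  qed
  have "\<bar>RS_sum g x d - ?I (\<lambda>p. g p * k p)\<bar> \<le>
    (\<Sum>i<n. \<Sum>j<l. \<bar>?I (\<lambda>p. g (\<xi> i, \<eta> j) * (one i j p * k p)) - ?I (\<lambda>p. one i j p * g p * k p)\<bar>)"
    unfolding RS Igk sum_subtractf[symmetric] by (intro order.trans[OF sum_abs] sum_mono order.refl)
  also have "\<dots> \<le> (\<Sum>i<n. \<Sum>j<l. K * \<delta> * ((V (q (Suc i)) - V (q i)) * (r (Suc j) - r j) + (W (r (Suc j)) - W (r j)) * (q (Suc i) - q i)))"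
    by (intro sum_mono cellbd) auto
  also have "\<dots> = K * \<delta> * ((\<Sum>i<n. V (q (Suc i)) - V (q i)) * (\<Sum>j<l. r (Suc j) - r j) + (\<Sum>j<l. W (r (Suc j)) - W (r j)) * (\<Sum>i<n. q (Suc i) - q i))"
  proof -
    have "(\<Sum>j<l. W (r (Suc j)) - W (r j)) * (\<Sum>i<n. q (Suc i) - q i) =
      (\<Sum>i<n. \<Sum>j<l. (W (r (Suc j)) - W (r j)) * (q (Suc i) - q i))"
      unfolding sum_product by (rule sum.swap)
    then show ?thesis
      unfolding sum_product by (simp only: sum.distrib[symmetric] sum_distrib_left)
  qed
  also have "\<dots> = K * \<delta> * ((V S - V 0) * T + (W T - W 0) * S)"
    using sum_lessThan_telescope[of "\<lambda>i. V (q i)" n] sum_lessThan_telescope[of "\<lambda>i. W (r i)" l]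
      sum_lessThan_telescope[of q n] sum_lessThan_telescope[of r l] q'(3,4) r'(3,4) by simp
  finally show ?thesis .
qed

lemma has_RS_integral_density:
  assumes g: "mono_controlled S T V W g" and k: "has_density S T x k" and ST: "S > 0" "T > 0"
  shows "has_RS_integral S T g x (\<integral>p. g p * k p \<partial>leb_rect S T)"
proof -
  from k obtain K where K: "K \<ge> 0" "\<And>p. p \<in> rect S T \<Longrightarrow> \<bar>k p\<bar> \<le> K" by (auto simp: has_density_def)
  define C where "C = K * ((V S - V 0) * T + (W T - W 0) * S) + 1"
  have "V 0 \<le> V S" "W 0 \<le> W T" using g ST by (auto simp: mono_controlled_def intro: monoD)
  then have "C > 0" using ST K(1) unfolding C_def
    by (intro add_nonneg_pos mult_nonneg_nonneg add_nonneg_nonneg) auto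
  have *: "\<bar>RS_sum g x d - (\<integral>p. g p * k p \<partial>leb_rect S T)\<bar> < e"
    if e: "e > 0" and d: "d \<in> fine_tagged S (e / C) \<times> fine_tagged T (e / C)" for d e
  proof -
    have "\<bar>RS_sum g x d - (\<integral>p. g p * k p \<partial>leb_rect S T)\<bar> \<le> (e / C) * (C - 1)"
      using RS_sum_density_estimate[OF g k ST K(2) d] by (simp add: C_def mult.commute mult.left_commute)
    also have "\<dots> < e" using e \<open>C > 0\<close> by (simp add: field_simps)
    finally show ?thesis .
  qed
  show ?thesis
    unfolding has_RS_integral_iff_tendsto tendsto_iff eventually_mesh_filter dist_real_def
  proof (intro allI impI)
    fix e :: real assume "0 < e"
    then show "\<exists>\<delta>>0. \<forall>d\<in>fine_tagged S \<delta> \<times> fine_tagged T \<delta>. \<bar>RS_sum g x d - (\<integral>p. g p * k p \<partial>leb_rect S T)\<bar> < e"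
      using * \<open>C > 0\<close> by (intro exI[of _ "e / C"]) simp
  qed
qed

text \<open>An additive normal form: densities are explicit for monomials and add up, but they do
  not multiply, so the product rule of \<open>real_polynomial_function\<close> has to be eliminated
  beforehand.\<close>

inductive bipolynomial :: "planefun \<Rightarrow> bool" where
  monomial: "bipolynomial (\<lambda>p. C * fst p ^ m * snd p ^ n)"
| add: "bipolynomial x \<Longrightarrow> bipolynomial y \<Longrightarrow> bipolynomial (\<lambda>p. x p + y p)"

lemma bipolynomial_mult:
  assumes "bipolynomial x" "bipolynomial y"
  shows "bipolynomial (\<lambda>p. x p * y p)"
  using assms(1)
proof induction
  case (monomial C m n)
  show ?case using assms(2)
  proof induction
    case (monomial C' m' n')
    have "(\<lambda>p. C * fst p ^ m * snd p ^ n * (C' * fst p ^ m' * snd p ^ n')) =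
      (\<lambda>p::real \<times> real. (C * C') * fst p ^ (m + m') * snd p ^ (n + n'))"
      by (simp add: power_add fun_eq_iff)
    then show ?case using bipolynomial.monomial by presburger
  next
    case (add x y)
    then show ?case using bipolynomial.add by (simp add: distrib_left)
  qed
next
  case (add x y)
  then show ?case using bipolynomial.add by (simp add: distrib_right)
qed

lemma real_polynomial_function_imp_bipolynomial:
  fixes x :: planefun
  assumes "real_polynomial_function x"
  shows "bipolynomial x"
  using assms
proof induction
  case (linear f)
  then interpret bounded_linear f .
  have "f p = f (1, 0) * fst p ^ 1 * snd p ^ 0 + f (0, 1) * fst p ^ 0 * snd p ^ 1" for p
  proof -
    have "p = fst p *\<^sub>R (1, 0) + snd p *\<^sub>R (0, 1)" by (simp add: prod_eq_iff)
    then have "f p = fst p *\<^sub>R f (1, 0) + snd p *\<^sub>R f (0, 1)" by (metis add scaleR)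
    then show ?thesis by (simp add: mult.commute)
  qed
  then have "f = (\<lambda>p. f (1, 0) * fst p ^ 1 * snd p ^ 0 + f (0, 1) * fst p ^ 0 * snd p ^ 1)" by blast
  moreover have "bipolynomial (\<lambda>p. f (1, 0) * fst p ^ 1 * snd p ^ 0 + f (0, 1) * fst p ^ 0 * snd p ^ 1)"
    by (rule bipolynomial.add[OF monomial monomial])
  ultimately show ?case by (simp only:)
next
  case (const c)
  then show ?case using monomial[of c 0 0] by simp
qed (auto intro: bipolynomial.add bipolynomial_mult)

lemma bipolynomial_has_density: "bipolynomial x \<Longrightarrow> \<exists>k. has_density S T x k"
  by (induction rule: bipolynomial.induct) (blast intro: has_density_monomial has_density_add)+

lemma has_RS_integral_continuous:
  assumes g: "bounded_variation_HK S T g" and x: "continuous_on (rect S T) x" and ST: "S > 0" "T > 0"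
  shows "has_RS_integral S T g x (RS_integral S T g x)"
proof -
  have "\<exists>I. has_RS_integral S T g x I"
  proof (rule has_RS_integral_uniform_closure[OF g ST])
    fix e :: real assume "e > 0"
    have "compact (rect S T)" by (auto simp: rect_def intro: compact_Times)
    from Stone_Weierstrass_real_polynomial_function[OF this x \<open>e > 0\<close>] obtain y
      where y: "real_polynomial_function y" "\<And>p. p \<in> rect S T \<Longrightarrow> \<bar>x p - y p\<bar> < e" by blast
    from bipolynomial_has_density[OF real_polynomial_function_imp_bipolynomial[OF y(1)]]
    obtain k where "has_density S T y k" by blast
    with HK_mono_controlled[OF g ST] has_RS_integral_density ST have "\<exists>I. has_RS_integral S T g y I" by blast
    with y(2) show "\<exists>y I. (\<forall>p\<in>rect S T. \<bar>x p - y p\<bar> < e) \<and> has_RS_integral S T g y I" by blast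
  qed
  then show ?thesis using RS_integral_eqI ST by blast
qed

section \<open>The space \<open>L\<^sub>2(Q)\<close>\<close>

lemma abs_mult_le_sum_squares:
  fixes a b :: real
  shows "\<bar>a * b\<bar> \<le> a\<^sup>2 + b\<^sup>2"
proof -
  have "2 * \<bar>a\<bar> * \<bar>b\<bar> \<le> a\<^sup>2 + b\<^sup>2" using sum_squares_bound[of "\<bar>a\<bar>" "\<bar>b\<bar>"] by simp
  moreover have "0 \<le> \<bar>a\<bar> * \<bar>b\<bar>" by simp
  ultimately show ?thesis unfolding abs_mult by linarith
qed

lemma L2_integrable_mult:
  assumes "u \<in> L2_carrier S T" "v \<in> L2_carrier S T"
  shows "integrable (leb_rect S T) (\<lambda>p. u p * v p)"
proof (rule Bochner_Integration.integrable_bound)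
  show "integrable (leb_rect S T) (\<lambda>p. (u p)\<^sup>2 + (v p)\<^sup>2)"
    using assms by (auto simp: L2_carrier_def)
  show "AE p in leb_rect S T. norm (u p * v p) \<le> norm ((u p)\<^sup>2 + (v p)\<^sup>2)"
    using abs_mult_le_sum_squares by simp
qed (use assms in \<open>auto simp: L2_carrier_def\<close>)

lemma L2_scale: "u \<in> L2_carrier S T \<Longrightarrow> (\<lambda>p. c * u p) \<in> L2_carrier S T"
  by (auto simp: L2_carrier_def power_mult_distrib)

lemma L2_add:
  assumes "u \<in> L2_carrier S T" "v \<in> L2_carrier S T"
  shows "(\<lambda>p. u p + v p) \<in> L2_carrier S T"
proof -
  have "integrable (leb_rect S T) (\<lambda>p. (u p)\<^sup>2 + 2 * (u p * v p) + (v p)\<^sup>2)"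
    using assms L2_integrable_mult[OF assms] by (auto simp: L2_carrier_def)
  then show ?thesis using assms by (auto simp: L2_carrier_def power2_sum algebra_simps)
qed

lemma L2_diff:
  assumes "u \<in> L2_carrier S T" "v \<in> L2_carrier S T"
  shows "(\<lambda>p. u p - v p) \<in> L2_carrier S T"
  using L2_add[OF assms(1) L2_scale[OF assms(2), of "-1"]] by simp

lemma L2_zero: "(\<lambda>_. 0) \<in> L2_carrier S T"
  by (simp add: L2_carrier_def)

lemma L2_sum: "(\<And>j. j \<in> A \<Longrightarrow> u j \<in> L2_carrier S T) \<Longrightarrow> (\<lambda>p. \<Sum>j\<in>A. u j p) \<in> L2_carrier S T"
  by (induction A rule: infinite_finite_induct) (auto intro: L2_add L2_zero)

lemma L2_bounded:
  assumes "u \<in> borel_measurable (leb_rect S T)" "\<And>p. p \<in> rect S T \<Longrightarrow> \<bar>u p\<bar> \<le> B"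
  shows "u \<in> L2_carrier S T"
proof -
  have "\<bar>(u p)\<^sup>2\<bar> \<le> B\<^sup>2" if "p \<in> rect S T" for p
    using assms(2)[OF that] abs_le_square_iff[of "u p" B] by simp
  then have "integrable (leb_rect S T) (\<lambda>p. (u p)\<^sup>2)"
    using assms(1) by (intro integrable_leb_rect_bounded[of _ S T "B\<^sup>2"]) auto
  then show ?thesis using assms(1) by (simp add: L2_carrier_def)
qed

lemma L2_bounded_mult:
  assumes "u \<in> L2_carrier S T" "h \<in> borel_measurable (leb_rect S T)" "\<And>p. p \<in> rect S T \<Longrightarrow> \<bar>h p\<bar> \<le> B"
  shows "(\<lambda>p. u p * h p) \<in> L2_carrier S T"
proof -
  have "integrable (leb_rect S T) (\<lambda>p. (u p * h p)\<^sup>2)"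
  proof (rule Bochner_Integration.integrable_bound)
    show "integrable (leb_rect S T) (\<lambda>p. B\<^sup>2 * (u p)\<^sup>2)" using assms by (auto simp: L2_carrier_def)
    show "AE p in leb_rect S T. norm ((u p * h p)\<^sup>2) \<le> norm (B\<^sup>2 * (u p)\<^sup>2)"
      using AE_space
    proof eventually_elim
      case (elim p)
      then have "(h p)\<^sup>2 \<le> B\<^sup>2" using assms(3)[of p] abs_le_square_iff[of "h p" B] by simp
      then show ?case by (simp add: power_mult_distrib mult.commute mult_right_mono)
    qed
  qed (use assms in \<open>auto simp: L2_carrier_def\<close>)
  then show ?thesis using assms by (auto simp: L2_carrier_def)
qed

lemma HK_measurable_bounded:
  assumes "bounded_variation_HK S T h" "S > 0" "T > 0"
  shows "h \<in> borel_measurable (leb_rect S T)" "\<exists>B. \<forall>p\<in>rect S T. \<bar>h p\<bar> \<le> B"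
proof -
  obtain V W where "mono_controlled S T V W h" using HK_mono_controlled[OF assms] by blast
  from mono_controlled_measurable[OF this] mono_controlled_bounded[OF this assms(2,3)]
  show "h \<in> borel_measurable (leb_rect S T)" "\<exists>B. \<forall>p\<in>rect S T. \<bar>h p\<bar> \<le> B" by blast+
qed

lemma HK_L2_mult:
  assumes "bounded_variation_HK S T h" "S > 0" "T > 0" "u \<in> L2_carrier S T"
  shows "(\<lambda>p. u p * h p) \<in> L2_carrier S T"
  using HK_measurable_bounded[OF assms(1-3)] L2_bounded_mult[OF assms(4)] by blast

lemma L2_inner_commute: "L2_inner S T u v = L2_inner S T v u"
  by (simp add: L2_inner_def mult.commute)

lemma L2_inner_diff_left:
  assumes "u \<in> L2_carrier S T" "v \<in> L2_carrier S T" "w \<in> L2_carrier S T"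
  shows "L2_inner S T (\<lambda>p. u p - v p) w = L2_inner S T u w - L2_inner S T v w"
  unfolding L2_inner_def using L2_integrable_mult[OF assms(1,3)] L2_integrable_mult[OF assms(2,3)]
  by (simp add: left_diff_distrib)

lemma L2_inner_scale_left: "L2_inner S T (\<lambda>p. c * u p) w = c * L2_inner S T u w"
  by (simp add: L2_inner_def mult.assoc)

lemma L2_inner_sum_left:
  assumes "\<And>j. j \<in> A \<Longrightarrow> u j \<in> L2_carrier S T" "w \<in> L2_carrier S T"
  shows "L2_inner S T (\<lambda>p. \<Sum>j\<in>A. c j * u j p) w = (\<Sum>j\<in>A. c j * L2_inner S T (u j) w)"
  unfolding L2_inner_def
  using L2_integrable_mult[OF assms(1) assms(2)]
  by (simp add: sum_distrib_right Bochner_Integration.integral_sum mult.assoc)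

lemma L2_inner_self_nonneg: "0 \<le> L2_inner S T u u"
  by (simp add: L2_inner_def integral_nonneg_AE)

lemma L2_norm_power2: "(L2_norm S T u)\<^sup>2 = L2_inner S T u u"
  by (simp add: L2_norm_def L2_inner_self_nonneg)

lemma L2_norm_nonneg: "0 \<le> L2_norm S T u"
  by (simp add: L2_norm_def L2_inner_self_nonneg)

lemma L2_Cauchy_Schwarz:
  assumes u: "u \<in> L2_carrier S T" and v: "v \<in> L2_carrier S T"
  shows "\<bar>L2_inner S T u v\<bar> \<le> L2_norm S T u * L2_norm S T v"
proof -
  define a b c where "a = L2_inner S T u u" and "b = L2_inner S T u v" and "c = L2_inner S T v v"
  have pos: "0 \<le> a" "0 \<le> c" unfolding a_def c_def by (rule L2_inner_self_nonneg)+
  have quad: "0 \<le> a - 2 * r * b + r\<^sup>2 * c" for r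
  proof -
    have rv: "(\<lambda>p. r * v p) \<in> L2_carrier S T" using v by (rule L2_scale)
    have "0 \<le> L2_inner S T (\<lambda>p. u p - r * v p) (\<lambda>p. u p - r * v p)" by (rule L2_inner_self_nonneg)
    also have "\<dots> = a - 2 * r * b + r\<^sup>2 * c"
      unfolding L2_inner_diff_left[OF u rv L2_diff[OF u rv]] L2_inner_commute[of S T _ "\<lambda>p. u p - r * v p"]
        L2_inner_diff_left[OF u rv u] L2_inner_diff_left[OF u rv rv] L2_inner_scale_left
      unfolding L2_inner_commute[of S T _ "\<lambda>p. r * v p"] L2_inner_scale_left
      unfolding L2_inner_commute[of S T v "\<lambda>p. u p - r * v p"] L2_inner_diff_left[OF u rv v] L2_inner_scale_left
      unfolding L2_inner_commute[of S T v u] a_def b_def c_def by (simp add: power2_eq_square algebra_simps)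
    finally show ?thesis .
  qed
  have "b\<^sup>2 \<le> a * c"
  proof (cases "c = 0")
    case True
    have "b = 0"
    proof (rule ccontr)
      assume "b \<noteq> 0"
      \<comment> \<open>For this \<open>r\<close> and \<open>c = 0\<close> the quadratic equals
        \<open>a - (a + 1) = -1\<close>.\<close>
      with quad[of "(a + 1) / (2 * b)"] True show False by (simp add: field_simps)
    qed
    then show ?thesis using True by simp
  next
    case False
    then have "c > 0" using pos by simp
    with quad[of "b / c"] have "0 \<le> a - b\<^sup>2 / c" by (simp add: power2_eq_square field_simps)
    with \<open>c > 0\<close> show ?thesis by (simp add: field_simps)
  qed
  then have "sqrt (b\<^sup>2) \<le> sqrt (a * c)" by (rule real_sqrt_le_mono)
  then show ?thesis unfolding L2_norm_def a_def[symmetric] b_def[symmetric] c_def[symmetric] by (simp add: real_sqrt_mult)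
qed

text \<open>Riesz--Fischer with a rate. On a finite measure space Cauchy--Schwarz against the
  constant 1 gives an L1-Cauchy sequence, hence an almost everywhere convergent subsequence; Fatou
  transfers the bound \<open>\<tau> n\<close> to its limit.\<close>

lemma L2_complete:
  assumes w: "\<And>n. w n \<in> L2_carrier S T"
    and cauchy: "\<And>m n. m \<le> n \<Longrightarrow> L2_inner S T (\<lambda>p. w n p - w m p) (\<lambda>p. w n p - w m p) \<le> \<tau> m"
    and \<tau>: "\<tau> \<longlonglongrightarrow> 0"
  obtains u where "u \<in> L2_carrier S T"
    "\<And>n. L2_inner S T (\<lambda>p. u p - w n p) (\<lambda>p. u p - w n p) \<le> \<tau> n"
proof -
  let ?M = "leb_rect S T"
  interpret finite_measure ?M by (rule finite_measure_leb_rect)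
  have one: "(\<lambda>_. 1) \<in> L2_carrier S T" by (rule L2_bounded[where B = 1]) auto
  have meas[measurable]: "w n \<in> borel_measurable ?M" for n using w[of n] by (simp add: L2_carrier_def)
  have \<tau>0: "0 \<le> \<tau> m" for m using cauchy[of m m] L2_inner_self_nonneg order.trans by blast
  have int_w: "integrable ?M (w n)" for n using L2_integrable_mult[OF w one] by simp
  have L1: "(\<integral>p. norm (w n p - w m p) \<partial>?M) \<le> sqrt (\<tau> m) * L2_norm S T (\<lambda>_. 1)" if "m \<le> n" for m n
  proof -
    have abs: "(\<lambda>p. \<bar>w n p - w m p\<bar>) \<in> L2_carrier S T"
      using L2_diff[OF w[of n] w[of m]] by (auto simp: L2_carrier_def)
    have "(\<integral>p. norm (w n p - w m p) \<partial>?M) = L2_inner S T (\<lambda>p. \<bar>w n p - w m p\<bar>) (\<lambda>_. 1)"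
      by (simp add: L2_inner_def)
    also have "\<dots> \<le> L2_norm S T (\<lambda>p. \<bar>w n p - w m p\<bar>) * L2_norm S T (\<lambda>_. 1)"
      using L2_Cauchy_Schwarz[OF abs one] by simp
    also have "L2_norm S T (\<lambda>p. \<bar>w n p - w m p\<bar>) \<le> sqrt (\<tau> m)"
      using cauchy[OF that] unfolding L2_norm_def L2_inner_def by (simp add: abs_mult_self_eq)
    finally show ?thesis by (simp add: mult_right_mono L2_norm_nonneg)
  qed
  have "\<exists>N. \<forall>i\<ge>N. \<forall>j\<ge>N. (\<integral>p. norm (w i p - w j p) \<partial>?M) < e" if "e > 0" for e
  proof -
    have "(\<lambda>m. sqrt (\<tau> m) * L2_norm S T (\<lambda>_. 1)) \<longlonglongrightarrow> sqrt 0 * L2_norm S T (\<lambda>_. 1)"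
      by (intro tendsto_intros \<tau>)
    then have "\<forall>\<^sub>F m in sequentially. sqrt (\<tau> m) * L2_norm S T (\<lambda>_. 1) < e"
      using that by (intro order_tendstoD) simp_all
    then obtain N where N: "\<forall>m\<ge>N. sqrt (\<tau> m) * L2_norm S T (\<lambda>_. 1) < e" unfolding eventually_sequentially by blast
    have "(\<integral>p. norm (w i p - w j p) \<partial>?M) < e" if "i \<ge> N" "j \<ge> N" for i j
    proof (cases "i \<le> j")
      case True
      have "(\<integral>p. norm (w j p - w i p) \<partial>?M) < e" using order.strict_trans1[OF L1[OF True]] N that by blast
      then show ?thesis by (simp add: abs_minus_commute)
    next
      case False
      then show ?thesis using order.strict_trans1[OF L1[of j i]] N that by auto
    qed
    then show ?thesis by blast
  qed
  from cauchy_L1_AE_cauchy_subseq[OF int_w this] obtain r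
    where r: "strict_mono r" and ae: "AE p in ?M. Cauchy (\<lambda>i. w (r i) p)" by blast
  define u where "u p = lim (\<lambda>i. w (r i) p)" for p
  have u_meas[measurable]: "u \<in> borel_measurable ?M" unfolding u_def by measurable
  have ae_lim: "AE p in ?M. (\<lambda>i. w (r i) p) \<longlonglongrightarrow> u p"
    using ae by eventually_elim (simp add: u_def Cauchy_convergent_iff convergent_LIMSEQ_iff)
  have nn: "(\<integral>\<^sup>+p. ennreal ((u p - w n p)\<^sup>2) \<partial>?M) \<le> ennreal (\<tau> n)" for n
  proof -
    have "(\<integral>\<^sup>+p. ennreal ((u p - w n p)\<^sup>2) \<partial>?M) = (\<integral>\<^sup>+p. liminf (\<lambda>i. ennreal ((w (r i) p - w n p)\<^sup>2)) \<partial>?M)"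
    proof (rule nn_integral_cong_AE, use ae_lim in eventually_elim)
      case (elim p)
      then have "(\<lambda>i. ennreal ((w (r i) p - w n p)\<^sup>2)) \<longlonglongrightarrow> ennreal ((u p - w n p)\<^sup>2)"
        by (intro tendsto_intros)
      from lim_imp_Liminf[OF sequentially_bot this] show ?case by (rule sym)
    qed
    also have "\<dots> \<le> liminf (\<lambda>i. \<integral>\<^sup>+p. ennreal ((w (r i) p - w n p)\<^sup>2) \<partial>?M)"
      by (rule nn_integral_liminf) measurable
    also have "\<dots> \<le> liminf (\<lambda>i. ennreal (\<tau> n))"
    proof (rule Liminf_mono)
      show "\<forall>\<^sub>F i in sequentially. (\<integral>\<^sup>+p. ennreal ((w (r i) p - w n p)\<^sup>2) \<partial>?M) \<le> ennreal (\<tau> n)"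
        using eventually_ge_at_top[of n]
      proof eventually_elim
        case (elim i)
        then have "n \<le> r i" using seq_suble[OF r, of i] by linarith
        have "integrable ?M (\<lambda>p. (w (r i) p - w n p)\<^sup>2)" using L2_diff[OF w w] by (simp add: L2_carrier_def)
        then have "(\<integral>\<^sup>+p. ennreal ((w (r i) p - w n p)\<^sup>2) \<partial>?M) = ennreal (L2_inner S T (\<lambda>p. w (r i) p - w n p) (\<lambda>p. w (r i) p - w n p))"
          by (subst nn_integral_eq_integral) (auto simp: L2_inner_def power2_eq_square)
        also have "\<dots> \<le> ennreal (\<tau> n)" using cauchy[OF \<open>n \<le> r i\<close>] by (rule ennreal_leI)
        finally show ?case .
      qed
    qed
    finally show ?thesis by (simp add: Liminf_const)
  qed
  have diff_L2: "(\<lambda>p. u p - w n p) \<in> L2_carrier S T" for n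
    using nn[of n] by (auto simp: L2_carrier_def intro!: integrableI_bounded order.strict_trans1[OF nn[of n]])
  have "u \<in> L2_carrier S T" using L2_add[OF diff_L2[of 0] w[of 0]] by simp
  moreover have "L2_inner S T (\<lambda>p. u p - w n p) (\<lambda>p. u p - w n p) \<le> \<tau> n" for n
  proof -
    have "ennreal (L2_inner S T (\<lambda>p. u p - w n p) (\<lambda>p. u p - w n p)) \<le> ennreal (\<tau> n)"
      using nn[of n] diff_L2[of n] unfolding L2_inner_def power2_eq_square[symmetric]
      by (subst nn_integral_eq_integral[symmetric]) (auto simp: L2_carrier_def)
    then show ?thesis using \<tau>0 by simp
  qed
  ultimately show thesis using that by blast
qed

lemma orthonormal_sum_inner:
  assumes "complete_orthonormal_BV S T \<phi>" "finite A"
  shows "L2_inner S T (\<lambda>p. \<Sum>j\<in>A. c j * \<phi> j p) (\<lambda>p. \<Sum>j\<in>A. c j * \<phi> j p) = (\<Sum>j\<in>A. (c j)\<^sup>2)"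
    and "L2_inner S T (\<lambda>p. \<Sum>j\<in>A. c j * \<phi> j p) (\<phi> i) = (if i \<in> A then c i else 0)"
proof -
  have \<phi>: "\<phi> j \<in> L2_carrier S T" and on: "L2_inner S T (\<phi> i) (\<phi> j) = (if i = j then 1 else 0)" for i j
    using assms by (auto simp: complete_orthonormal_BV_def)
  show 1: "L2_inner S T (\<lambda>p. \<Sum>j\<in>A. c j * \<phi> j p) (\<phi> i) = (if i \<in> A then c i else 0)" for i
    using assms(2) by (simp add: L2_inner_sum_left \<phi> on if_distrib[of "(*) _"] sum.delta' cong: if_cong)
  have s: "(\<lambda>p. \<Sum>j\<in>A. c j * \<phi> j p) \<in> L2_carrier S T" by (intro L2_sum L2_scale \<phi>)
  have "L2_inner S T (\<lambda>p. \<Sum>j\<in>A. c j * \<phi> j p) (\<lambda>p. \<Sum>j\<in>A. c j * \<phi> j p) =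
    (\<Sum>j\<in>A. c j * L2_inner S T (\<lambda>p. \<Sum>j\<in>A. c j * \<phi> j p) (\<phi> j))"
    by (subst L2_inner_sum_left[OF \<phi> s]) (auto intro!: sum.cong L2_inner_commute)
  then show "L2_inner S T (\<lambda>p. \<Sum>j\<in>A. c j * \<phi> j p) (\<lambda>p. \<Sum>j\<in>A. c j * \<phi> j p) = (\<Sum>j\<in>A. (c j)\<^sup>2)"
    unfolding 1 by (simp add: power2_eq_square)
qed

text \<open>Completeness is given as triviality of the orthogonal complement. The partial sums
  \<open>w n\<close> converge to some \<open>u\<close> by \<open>L2_complete\<close>;
  \<open>v - u\<close> is orthogonal to every \<open>\<phi> j\<close>, because \<open>w n\<close>
  has the right coefficient once \<open>n > j\<close>. Hence \<open>v - u\<close> has norm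
  0.\<close>

lemma Parseval:
  assumes \<phi>: "complete_orthonormal_BV S T \<phi>" and v: "v \<in> L2_carrier S T"
  shows "(\<lambda>j. (L2_inner S T v (\<phi> j))\<^sup>2) sums L2_inner S T v v"
proof -
  have \<phi>L: "\<phi> j \<in> L2_carrier S T" for j using \<phi> by (auto simp: complete_orthonormal_BV_def)
  define c where "c j = L2_inner S T v (\<phi> j)" for j
  define w where "w n = (\<lambda>p. \<Sum>j<n. c j * \<phi> j p)" for n
  have wL: "w n \<in> L2_carrier S T" for n unfolding w_def by (intro L2_sum L2_scale \<phi>L)
  have vw: "L2_inner S T v (w n) = (\<Sum>j<n. (c j)\<^sup>2)" for n
    unfolding L2_inner_commute[of S T v] w_def
    by (subst L2_inner_sum_left[OF \<phi>L v]) (auto simp: c_def power2_eq_square L2_inner_commute[of S T v] intro!: sum.cong)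
  have ww: "L2_inner S T (w n) (w n) = (\<Sum>j<n. (c j)\<^sup>2)" for n
    unfolding w_def by (rule orthonormal_sum_inner[OF \<phi>]) simp
  have res: "L2_inner S T (\<lambda>p. v p - w n p) (\<lambda>p. v p - w n p) = L2_inner S T v v - (\<Sum>j<n. (c j)\<^sup>2)" for n
  proof -
    have "L2_inner S T (\<lambda>p. v p - w n p) (\<lambda>p. v p - w n p) =
      L2_inner S T v v - L2_inner S T v (w n) - (L2_inner S T v (w n) - L2_inner S T (w n) (w n))"
      unfolding L2_inner_diff_left[OF v wL L2_diff[OF v wL]] L2_inner_commute[of S T _ "\<lambda>p. v p - w n p"]
        L2_inner_diff_left[OF v wL v] L2_inner_diff_left[OF v wL wL] L2_inner_commute[of S T "w n" v] by simp
    then show ?thesis using vw ww by simp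
  qed
  have "summable (\<lambda>j. (c j)\<^sup>2)"
  proof (rule summableI_nonneg_bounded)
    show "(\<Sum>j<n. (c j)\<^sup>2) \<le> L2_inner S T v v" for n
      using res[of n] L2_inner_self_nonneg[of S T "\<lambda>p. v p - w n p"] by linarith
  qed simp
  then obtain s where s: "(\<lambda>j. (c j)\<^sup>2) sums s" by (auto simp: summable_def)
  define \<tau> where "\<tau> n = s - (\<Sum>j<n. (c j)\<^sup>2)" for n
  have \<tau>: "\<tau> \<longlonglongrightarrow> 0" using tendsto_diff[OF tendsto_const s[unfolded sums_def], of s] by (simp add: \<tau>_def[abs_def])
  have le_s: "(\<Sum>j<n. (c j)\<^sup>2) \<le> s" for n
    using s sum_le_suminf[of "\<lambda>j. (c j)\<^sup>2" "{..<n}"] by (simp add: sums_iff)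
  have "L2_inner S T (\<lambda>p. w n p - w m p) (\<lambda>p. w n p - w m p) \<le> \<tau> m" if "m \<le> n" for m n
  proof -
    have eq: "w n p - w m p = (\<Sum>j\<in>{m..<n}. c j * \<phi> j p)" for p
      unfolding w_def using that by (simp add: sum_diff_nat_ivl atLeast0LessThan[symmetric])
    have "L2_inner S T (\<lambda>p. w n p - w m p) (\<lambda>p. w n p - w m p) = (\<Sum>j\<in>{m..<n}. (c j)\<^sup>2)"
      unfolding eq by (rule orthonormal_sum_inner[OF \<phi>]) simp
    also have "\<dots> = (\<Sum>j<n. (c j)\<^sup>2) - (\<Sum>j<m. (c j)\<^sup>2)"
      using that by (simp add: sum_diff_nat_ivl atLeast0LessThan[symmetric])
    finally show ?thesis using le_s[of n] by (simp add: \<tau>_def)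
  qed
  from L2_complete[OF wL this \<tau>] obtain u where u: "u \<in> L2_carrier S T"
    and uw: "\<And>n. L2_inner S T (\<lambda>p. u p - w n p) (\<lambda>p. u p - w n p) \<le> \<tau> n" by blast
  have "L2_inner S T (\<lambda>p. v p - u p) (\<phi> j) = 0" for j
  proof -
    have "\<bar>L2_inner S T (\<lambda>p. v p - u p) (\<phi> j)\<bar> \<le> sqrt (\<tau> n) * L2_norm S T (\<phi> j)" if "n > j" for n
    proof -
      have "L2_inner S T (w n) (\<phi> j) = c j"
        unfolding w_def using that by (subst orthonormal_sum_inner[OF \<phi>]) auto
      then have "L2_inner S T (\<lambda>p. v p - u p) (\<phi> j) = - L2_inner S T (\<lambda>p. u p - w n p) (\<phi> j)"
        by (simp add: L2_inner_diff_left[OF v u \<phi>L] L2_inner_diff_left[OF u wL \<phi>L] c_def)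
      then have "\<bar>L2_inner S T (\<lambda>p. v p - u p) (\<phi> j)\<bar> \<le> L2_norm S T (\<lambda>p. u p - w n p) * L2_norm S T (\<phi> j)"
        using L2_Cauchy_Schwarz[OF L2_diff[OF u wL] \<phi>L] by simp
      also have "\<dots> \<le> sqrt (\<tau> n) * L2_norm S T (\<phi> j)"
        using uw[of n] by (intro mult_right_mono L2_norm_nonneg) (simp add: L2_norm_def)
      finally show ?thesis .
    qed
    moreover have "(\<lambda>n. sqrt (\<tau> n) * L2_norm S T (\<phi> j)) \<longlonglongrightarrow> sqrt 0 * L2_norm S T (\<phi> j)"
      by (intro tendsto_intros \<tau>)
    ultimately have "\<bar>L2_inner S T (\<lambda>p. v p - u p) (\<phi> j)\<bar> \<le> sqrt 0 * L2_norm S T (\<phi> j)"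
      by (intro tendsto_lowerbound[where F = sequentially]) (auto intro: eventually_mono[OF eventually_gt_at_top[of j]])
    then show ?thesis by simp
  qed
  then have "L2_norm S T (\<lambda>p. v p - u p) = 0"
    using \<phi> L2_diff[OF v u] by (auto simp: complete_orthonormal_BV_def)
  then have vu0: "L2_inner S T (\<lambda>p. v p - u p) (\<lambda>p. v p - u p) = 0" by (simp add: L2_norm_def)
  \<comment> \<open>The factor 2 is the cost of splitting the square of a sum; it is harmless
    because \<open>\<tau>\<close> tends to 0.\<close>
  have upper: "L2_inner S T v v - (\<Sum>j<n. (c j)\<^sup>2) \<le> 2 * \<tau> n" for n
  proof -
    have "L2_inner S T (\<lambda>p. v p - w n p) (\<lambda>p. v p - w n p) \<le>
      (\<integral>p. 2 * ((v p - u p) * (v p - u p)) + 2 * ((u p - w n p) * (u p - w n p)) \<partial>leb_rect S T)"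
      unfolding L2_inner_def
    proof (rule integral_mono)
      show "(v p - w n p) * (v p - w n p) \<le> 2 * ((v p - u p) * (v p - u p)) + 2 * ((u p - w n p) * (u p - w n p))" for p
        using zero_le_square[of "(v p - u p) - (u p - w n p)"] by (simp add: algebra_simps)
    qed (intro Bochner_Integration.integrable_add integrable_mult_right L2_integrable_mult L2_diff v u wL)+
    also have "\<dots> = 2 * L2_inner S T (\<lambda>p. v p - u p) (\<lambda>p. v p - u p) + 2 * L2_inner S T (\<lambda>p. u p - w n p) (\<lambda>p. u p - w n p)"
      using L2_integrable_mult[OF L2_diff[OF v u] L2_diff[OF v u]] L2_integrable_mult[OF L2_diff[OF u wL] L2_diff[OF u wL]]
      by (simp add: L2_inner_def)
    finally show ?thesis using res[of n] vu0 uw[of n] by simp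
  qed
  have lower: "0 \<le> L2_inner S T v v - (\<Sum>j<n. (c j)\<^sup>2)" for n
    using res[of n] L2_inner_self_nonneg[of S T "\<lambda>p. v p - w n p"] by linarith
  have "(\<lambda>n. 2 * \<tau> n) \<longlonglongrightarrow> 0" using tendsto_mult_right_zero[OF \<tau>] by simp
  then have "(\<lambda>n. L2_inner S T v v - (\<Sum>j<n. (c j)\<^sup>2)) \<longlonglongrightarrow> 0"
    by (rule tendsto_sandwich[OF always_eventually always_eventually tendsto_const, rotated 2])
       (use lower upper in blast)+
  from tendsto_diff[OF tendsto_const this, of "L2_inner S T v v"] show ?thesis
    by (simp add: sums_def c_def)
qed

section \<open>A maximal inequality from fourth moments\<close>

text \<open>If \<open>y\<close> is at most a tenth of \<open>x\<close>, then
  \<open>1.1 ^ 4 = 1.4641\<close> is below 3/2; otherwise the sum is at most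
  \<open>11 * \<bar>y\<bar>\<close>, and \<open>11 ^ 4 = 14641\<close>. The coefficient of
  \<open>x\<close> has to stay below 3 for the later induction, that of \<open>y\<close> may be
  large.\<close>

lemma add_power4_le:
  fixes x y :: real
  shows "\<bar>x + y\<bar> ^ 4 \<le> 3 / 2 * \<bar>x\<bar> ^ 4 + 14641 * \<bar>y\<bar> ^ 4"
proof (cases "10 * \<bar>y\<bar> \<le> \<bar>x\<bar>")
  case True
  then have "\<bar>x + y\<bar> \<le> 11 / 10 * \<bar>x\<bar>" by linarith
  then have "\<bar>x + y\<bar> ^ 4 \<le> (11 / 10 * \<bar>x\<bar>) ^ 4" by (intro power_mono) auto
  also have "\<dots> = 14641 / 10000 * \<bar>x\<bar> ^ 4" unfolding power_mult_distrib by (simp add: power_divide)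
  also have "\<dots> \<le> 3 / 2 * \<bar>x\<bar> ^ 4" by (intro mult_right_mono) auto
  finally show ?thesis using zero_le_power[OF abs_ge_zero[of y], of 4] by linarith
next
  case False
  then have "\<bar>x + y\<bar> ^ 4 \<le> (11 * \<bar>y\<bar>) ^ 4" by (intro power_mono) auto
  also have "\<dots> = 14641 * \<bar>y\<bar> ^ 4" unfolding power_mult_distrib by simp
  finally show ?thesis using zero_le_power[OF abs_ge_zero[of x], of 4] by linarith
qed

lemma ennreal_combination:
  assumes "0 \<le> u" "0 \<le> v" "0 \<le> w"
  shows "ennreal (u + 3 / 2 * v + 14641 * w) = ennreal u + 3 / 2 * ennreal v + 14641 * ennreal w"
proof -
  have "(3 / 2 :: ennreal) = ennreal (3 / 2)" by (simp add: divide_ennreal[symmetric])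
  then show ?thesis using assms by (simp add: ennreal_plus ennreal_mult' del: times_divide_eq_left)
qed

text \<open>Values in \<open>ennreal\<close> keep suprema and integrals total, including the
  supremum over an infinite tail.\<close>

definition max_osc :: "(nat \<Rightarrow> 'a \<Rightarrow> real) \<Rightarrow> nat \<Rightarrow> nat \<Rightarrow> 'a \<Rightarrow> ennreal" where
  "max_osc X a b x = (SUP n\<in>{a..b}. ennreal (\<bar>X n x - X a x\<bar> ^ 4))"

lemma max_osc_measurable [measurable]:
  assumes [measurable]: "\<And>n. X n \<in> borel_measurable M"
  shows "max_osc X a b \<in> borel_measurable M"
  unfolding max_osc_def[abs_def] by (intro borel_measurable_SUP) auto

text \<open>Indices before \<open>h\<close> are compared with \<open>X a\<close> directly, the
  others through \<open>X h\<close>. The blocks are \<open>a..h - 1\<close> and \<open>h..b\<close>,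
  so the step from \<open>h - 1\<close> to \<open>h\<close> occurs in neither of them and is
  absorbed by the last term.\<close>

lemma max_osc_split:
  assumes "a < h" "h \<le> b"
  shows "max_osc X a b x \<le> max_osc X a (h - 1) x + 3 / 2 * max_osc X h b x + 14641 * ennreal (\<bar>X h x - X a x\<bar> ^ 4)"
  unfolding max_osc_def[of X a b]
proof (rule SUP_least)
  fix n assume n: "n \<in> {a..b}"
  show "ennreal (\<bar>X n x - X a x\<bar> ^ 4) \<le> max_osc X a (h - 1) x + 3 / 2 * max_osc X h b x + 14641 * ennreal (\<bar>X h x - X a x\<bar> ^ 4)"
  proof (cases "n < h")
    case True
    then have "ennreal (\<bar>X n x - X a x\<bar> ^ 4) \<le> max_osc X a (h - 1) x"
      unfolding max_osc_def using n by (intro SUP_upper) auto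
    then show ?thesis by (simp add: add_increasing2 add.assoc)
  next
    case False
    have "\<bar>X n x - X a x\<bar> ^ 4 \<le> 3 / 2 * \<bar>X n x - X h x\<bar> ^ 4 + 14641 * \<bar>X h x - X a x\<bar> ^ 4"
      using add_power4_le[of "X n x - X h x" "X h x - X a x"] by simp
    then have "ennreal (\<bar>X n x - X a x\<bar> ^ 4) \<le> ennreal (3 / 2 * \<bar>X n x - X h x\<bar> ^ 4 + 14641 * \<bar>X h x - X a x\<bar> ^ 4)"
      by (rule ennreal_leI)
    also have "\<dots> = 3 / 2 * ennreal (\<bar>X n x - X h x\<bar> ^ 4) + 14641 * ennreal (\<bar>X h x - X a x\<bar> ^ 4)"
      using ennreal_combination[of 0 "\<bar>X n x - X h x\<bar> ^ 4" "\<bar>X h x - X a x\<bar> ^ 4"] by simp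
    also have "3 / 2 * ennreal (\<bar>X n x - X h x\<bar> ^ 4) \<le> 3 / 2 * max_osc X h b x"
      unfolding max_osc_def using n False by (intro mult_left_mono SUP_upper) auto
    finally show ?thesis by (simp add: add_increasing add.assoc add_right_mono)
  qed
qed

text \<open>Splitting the block at the index where half of its mass is reached costs only the factor
  \<open>(1 + 3/2) / 4 < 1\<close>, so the constant survives the induction. No independence is involved.\<close>

lemma maximal_inequality_4:
  fixes t :: "nat \<Rightarrow> real"
  assumes [measurable]: "\<And>n. X n \<in> borel_measurable M" and "mono t"
    and mom: "\<And>a b. a \<le> b \<Longrightarrow> (\<integral>\<^sup>+x. ennreal (\<bar>X b x - X a x\<bar> ^ 4) \<partial>M) \<le> ennreal (3 * (t b - t a)\<^sup>2)"
    and "a \<le> b"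
  shows "(\<integral>\<^sup>+x. max_osc X a b x \<partial>M) \<le> ennreal (117128 * (t b - t a)\<^sup>2)"
  using \<open>a \<le> b\<close>
proof (induction "b - a" arbitrary: a b rule: less_induct)
  case less
  show ?case
  proof (cases "a = b")
    case True
    moreover have "max_osc X b b = (\<lambda>_. 0)" by (simp add: max_osc_def fun_eq_iff)
    ultimately show ?thesis by simp
  next
    case False
    then have ab: "a < b" using less.prems by simp
    define U where "U = t b - t a"
    have U: "U \<ge> 0" using \<open>mono t\<close> ab by (simp add: U_def monoD)
    define h where "h = (LEAST h. a < h \<and> U / 2 \<le> t h - t a)"
    have ex: "a < b \<and> U / 2 \<le> t b - t a" using ab U by (simp add: U_def)
    have h: "a < h \<and> U / 2 \<le> t h - t a" unfolding h_def by (rule LeastI[of _ b]) (rule ex)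
    have hb: "h \<le> b" unfolding h_def by (rule Least_le) (rule ex)
    \<comment> \<open>Minimality of \<open>h\<close> bounds the left block, and the choice of
      \<open>h\<close> bounds the right one. A single step may carry nearly all of \<open>U\<close>;
      it then falls between the blocks.\<close>
    have left: "t (h - 1) - t a \<le> U / 2"
    proof (cases "h - 1 = a")
      case True
      then show ?thesis using U by simp
    next
      case False
      then have "\<not> (a < h - 1 \<and> U / 2 \<le> t (h - 1) - t a)"
        using not_less_Least[of "h - 1" "\<lambda>h. a < h \<and> U / 2 \<le> t h - t a"] h unfolding h_def[symmetric] by simp
      then show ?thesis using False h by auto
    qed
    have sq: "(t d - t c)\<^sup>2 \<le> U\<^sup>2 / 4" if "c \<le> d" "t d - t c \<le> U / 2" for c d
    proof -
      have "(t d - t c)\<^sup>2 \<le> (U / 2)\<^sup>2" using that monoD[OF \<open>mono t\<close> that(1)] by (intro power_mono) auto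
      then show ?thesis by (simp add: power_divide)
    qed
    have 1: "(\<integral>\<^sup>+x. max_osc X a (h - 1) x \<partial>M) \<le> ennreal (117128 * (U\<^sup>2 / 4))"
      using less.hyps[of "h - 1" a] h hb sq[OF _ left] by (fastforce intro: order.trans ennreal_leI)
    have right: "t b - t h \<le> U / 2" using conjunct2[OF h] unfolding U_def by (simp add: field_simps)
    have 2: "(\<integral>\<^sup>+x. max_osc X h b x \<partial>M) \<le> ennreal (117128 * (U\<^sup>2 / 4))"
      using less.hyps[of b h] h hb ab sq[OF hb right] by (fastforce intro: order.trans ennreal_leI)
    have "(t h - t a)\<^sup>2 \<le> U\<^sup>2"
      using h monoD[OF \<open>mono t\<close> hb] monoD[OF \<open>mono t\<close>, of a h] by (intro power_mono) (auto simp: U_def)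
    then have 3: "(\<integral>\<^sup>+x. ennreal (\<bar>X h x - X a x\<bar> ^ 4) \<partial>M) \<le> ennreal (3 * U\<^sup>2)"
      using mom[of a h] h by (fastforce intro: order.trans ennreal_leI)
    have "(\<integral>\<^sup>+x. max_osc X a b x \<partial>M) \<le> (\<integral>\<^sup>+x. max_osc X a (h - 1) x + 3 / 2 * max_osc X h b x + 14641 * ennreal (\<bar>X h x - X a x\<bar> ^ 4) \<partial>M)"
      using h hb by (intro nn_integral_mono max_osc_split) auto
    also have "\<dots> = (\<integral>\<^sup>+x. max_osc X a (h - 1) x \<partial>M) + 3 / 2 * (\<integral>\<^sup>+x. max_osc X h b x \<partial>M) + 14641 * (\<integral>\<^sup>+x. ennreal (\<bar>X h x - X a x\<bar> ^ 4) \<partial>M)"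
      by (simp add: nn_integral_add nn_integral_cmult del: ennreal_power)
    also have "\<dots> \<le> ennreal (117128 * (U\<^sup>2 / 4)) + 3 / 2 * ennreal (117128 * (U\<^sup>2 / 4)) + 14641 * ennreal (3 * U\<^sup>2)"
      by (intro add_mono mult_left_mono 1 2 3) auto
    also have "\<dots> = ennreal (117128 * (U\<^sup>2 / 4) + 3 / 2 * (117128 * (U\<^sup>2 / 4)) + 14641 * (3 * U\<^sup>2))"
      by (rule ennreal_combination[symmetric]) auto
    \<comment> \<open>The constant is the fixed point of \<open>C = 5/8 * C + 3 * 14641\<close>,
      that is, \<open>8 * 11 ^ 4\<close>.\<close>
    also have "\<dots> \<le> ennreal (117128 * U\<^sup>2)" by (rule ennreal_leI) simp
    finally show ?thesis unfolding U_def .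
  qed
qed

text \<open>\<open>Z a\<close> is the oscillation of the whole tail after \<open>a\<close>. Its
  integral is at most a constant times \<open>(L - t a)\<^sup>2\<close>, which tends to 0, so the
  infimum over \<open>a\<close> vanishes almost everywhere: this is the Cauchy criterion.\<close>

lemma AE_convergent_from_fourth_moments:
  fixes t :: "nat \<Rightarrow> real"
  assumes meas[measurable]: "\<And>n. X n \<in> borel_measurable M" and "mono t" and lim: "t \<longlonglongrightarrow> L"
    and mom: "\<And>a b. a \<le> b \<Longrightarrow> (\<integral>\<^sup>+x. ennreal (\<bar>X b x - X a x\<bar> ^ 4) \<partial>M) \<le> ennreal (3 * (t b - t a)\<^sup>2)"
  shows "AE x in M. convergent (\<lambda>n. X n x)"
proof -
  define Z where "Z a x = (SUP k. max_osc X a (a + k) x)" for a x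
  have t_le: "t n \<le> L" for n using incseq_le[OF \<open>mono t\<close> lim] .
  have Z[measurable]: "Z a \<in> borel_measurable M" for a unfolding Z_def[abs_def] by measurable
  have Z_int: "(\<integral>\<^sup>+x. Z a x \<partial>M) \<le> ennreal (117128 * (L - t a)\<^sup>2)" for a
  proof -
    have "(\<integral>\<^sup>+x. Z a x \<partial>M) = (SUP k. \<integral>\<^sup>+x. max_osc X a (a + k) x \<partial>M)"
      unfolding Z_def
    proof (rule nn_integral_monotone_convergence_SUP)
      show "incseq (\<lambda>k. max_osc X a (a + k))"
        by (auto simp: incseq_def le_fun_def max_osc_def intro!: SUP_subset_mono)
    qed measurable
    also have "\<dots> \<le> ennreal (117128 * (L - t a)\<^sup>2)"
    proof (rule SUP_least)
      fix k
      have "(t (a + k) - t a)\<^sup>2 \<le> (L - t a)\<^sup>2"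
        using t_le[of "a + k"] monoD[OF \<open>mono t\<close>, of a "a + k"] by (intro power_mono) auto
      then have "ennreal (117128 * (t (a + k) - t a)\<^sup>2) \<le> ennreal (117128 * (L - t a)\<^sup>2)"
        by (intro ennreal_leI) simp
      with maximal_inequality_4[OF meas \<open>mono t\<close> mom, of a "a + k"]
      show "(\<integral>\<^sup>+x. max_osc X a (a + k) x \<partial>M) \<le> ennreal (117128 * (L - t a)\<^sup>2)"
        by (simp add: order.trans)
    qed
    finally show ?thesis .
  qed
  have "(\<integral>\<^sup>+x. (INF a. Z a x) \<partial>M) \<le> 0"
  proof (rule LIMSEQ_le_const)
    have "(\<lambda>a. ennreal (117128 * (L - t a)\<^sup>2)) \<longlonglongrightarrow> ennreal (117128 * (L - L)\<^sup>2)"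
      by (intro tendsto_intros lim)
    then show "(\<lambda>a. ennreal (117128 * (L - t a)\<^sup>2)) \<longlonglongrightarrow> 0" by simp
    have "(\<integral>\<^sup>+x. (INF a. Z a x) \<partial>M) \<le> (\<integral>\<^sup>+x. Z a x \<partial>M)" for a
      by (intro nn_integral_mono INF_lower) auto
    then show "\<exists>N. \<forall>a\<ge>N. (\<integral>\<^sup>+x. (INF a. Z a x) \<partial>M) \<le> ennreal (117128 * (L - t a)\<^sup>2)"
      using Z_int order.trans by blast
  qed
  then have "AE x in M. (INF a. Z a x) = 0"
    by (subst nn_integral_0_iff_AE[symmetric]) auto
  then show ?thesis
  proof eventually_elim
    case (elim x)
    have "Cauchy (\<lambda>n. X n x)"
    proof (rule metric_CauchyI)
      fix e :: real assume "e > 0"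
      then have "(INF a. Z a x) < ennreal ((e / 2) ^ 4)" using elim by (simp add: ennreal_zero_less_mult_iff del: ennreal_power)
      then obtain a where a: "Z a x < ennreal ((e / 2) ^ 4)" by (auto simp: INF_less_iff)
      have close: "\<bar>X n x - X a x\<bar> < e / 2" if "n \<ge> a" for n
      proof -
        have "ennreal (\<bar>X n x - X a x\<bar> ^ 4) \<le> max_osc X a (a + (n - a)) x"
          unfolding max_osc_def using that by (intro SUP_upper) auto
        also have "\<dots> \<le> Z a x" unfolding Z_def by (rule SUP_upper) simp
        finally have "ennreal (\<bar>X n x - X a x\<bar> ^ 4) < ennreal ((e / 2) ^ 4)" using a by (rule order.strict_trans1)
        then have "\<bar>X n x - X a x\<bar> ^ 4 < (e / 2) ^ 4" by (simp add: ennreal_less_iff del: ennreal_power)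
        then show ?thesis by (rule power_less_imp_less_base) (use \<open>e > 0\<close> in simp)
      qed
      have "dist (X m x) (X n x) < e" if "m \<ge> a" "n \<ge> a" for m n
        using close[OF that(1)] close[OF that(2)] unfolding dist_real_def by linarith
      then show "\<exists>N. \<forall>m\<ge>N. \<forall>n\<ge>N. dist (X m x) (X n x) < e" by blast
    qed
    then show ?case by (simp add: Cauchy_convergent_iff)
  qed
qed

section \<open>Gaussian integrals over Yeh--Wiener space\<close>

text \<open>Everything is expressed by the second moment, so that degenerate and nondegenerate laws
  share one formula and variances can be passed to limits.\<close>

lemma (in prob_space) centered_normal_moments:
  assumes "centered_normal M X"
  shows "integrable M (\<lambda>x. (X x)\<^sup>2)" "integrable M (\<lambda>x. X x ^ 4)"
    "(\<integral>x. X x ^ 4 \<partial>M) = 3 * (\<integral>x. (X x)\<^sup>2 \<partial>M)\<^sup>2"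
    "(\<integral>x. exp (\<i> * of_real (X x)) \<partial>M) = of_real (exp (- (\<integral>x. (X x)\<^sup>2 \<partial>M) / 2))"
proof -
  have [measurable]: "X \<in> borel_measurable M" using assms by (simp add: centered_normal_def)
  consider "AE x in M. X x = 0" | \<sigma> where "\<sigma> > 0" "distributed M lborel X (normal_density 0 \<sigma>)"
    using assms by (auto simp: centered_normal_def)
  then have "integrable M (\<lambda>x. (X x)\<^sup>2) \<and> integrable M (\<lambda>x. X x ^ 4) \<and>
    (\<integral>x. X x ^ 4 \<partial>M) = 3 * (\<integral>x. (X x)\<^sup>2 \<partial>M)\<^sup>2 \<and>
    (\<integral>x. exp (\<i> * of_real (X x)) \<partial>M) = of_real (exp (- (\<integral>x. (X x)\<^sup>2 \<partial>M) / 2))"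
  proof cases
    case 1
    have i2: "integrable M (\<lambda>x. (X x)\<^sup>2) \<longleftrightarrow> integrable M (\<lambda>x. 0 :: real)" "(\<integral>x. (X x)\<^sup>2 \<partial>M) = (\<integral>x. 0 \<partial>M)"
      using 1 by (intro integrable_cong_AE integral_cong_AE; force)+
    have i4: "integrable M (\<lambda>x. X x ^ 4) \<longleftrightarrow> integrable M (\<lambda>x. 0 :: real)" "(\<integral>x. X x ^ 4 \<partial>M) = (\<integral>x. 0 \<partial>M)"
      using 1 by (intro integrable_cong_AE integral_cong_AE; force)+
    have "(\<integral>x. exp (\<i> * of_real (X x)) \<partial>M) = (\<integral>x. 1 \<partial>M)"
      using 1 by (intro integral_cong_AE) auto
    then show ?thesis using i2 i4 by (simp add: prob_space)
  next
    case 2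
    note D = 2(2)
    have mom: "integrable M (\<lambda>x. X x ^ (2 * k)) \<and> (\<integral>x. X x ^ (2 * k) \<partial>M) = fact (2 * k) / ((2 / \<sigma>\<^sup>2) ^ k * fact k)" for k
      using normal_moment_even[OF 2(1), of 0 k] distributed_integrable[OF D, of "\<lambda>x. x ^ (2 * k)"]
        distributed_integral[OF D, of "\<lambda>x. x ^ (2 * k)"]
      by (simp add: has_bochner_integral_iff)
    have v: "(\<integral>x. (X x)\<^sup>2 \<partial>M) = \<sigma>\<^sup>2" using mom[of 1] by (simp add: fact_numeral)
    have f: "(\<integral>x. X x ^ 4 \<partial>M) = 3 * (\<sigma>\<^sup>2)\<^sup>2" using mom[of 2] by (simp add: fact_numeral power_divide field_simps)
    \<comment> \<open>The known characteristic function is that of the standard normal law; it is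
      evaluated at \<sigma> after standardizing.\<close>
    have std: "distributed M lborel (\<lambda>x. X x / \<sigma>) std_normal_density"
      using D normal_standard_normal_convert[OF 2(1), of X 0] by simp
    have "distr M borel (\<lambda>x. X x / \<sigma>) = std_normal_distribution"
      using distributed_distr_eq_density[OF std] distr_cong[of M M lborel borel] by (metis sets_lborel)
    then have "(\<integral>x. iexp (\<sigma> * (X x / \<sigma>)) \<partial>M) = char std_normal_distribution \<sigma>"
      unfolding char_def by (subst \<open>distr M borel _ = _\<close>[symmetric], subst integral_distr) auto
    then have "(\<integral>x. exp (\<i> * of_real (X x)) \<partial>M) = of_real (exp (- \<sigma>\<^sup>2 / 2))"
      using 2(1) by (simp add: char_std_normal_distribution)
    then show ?thesis using mom[of 1] mom[of 2] v f by simp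
  qed
  then show "integrable M (\<lambda>x. (X x)\<^sup>2)" "integrable M (\<lambda>x. X x ^ 4)"
    "(\<integral>x. X x ^ 4 \<partial>M) = 3 * (\<integral>x. (X x)\<^sup>2 \<partial>M)\<^sup>2"
    "(\<integral>x. exp (\<i> * of_real (X x)) \<partial>M) = of_real (exp (- (\<integral>x. (X x)\<^sup>2 \<partial>M) / 2))" by auto
qed

text \<open>Normality is assumed for sums over a set of distinct points, whereas Riemann--Stieltjes
  sums use each grid point several times. Closure of this class under addition merges the
  coefficients.\<close>

definition lin_eval :: "real \<Rightarrow> real \<Rightarrow> (planefun \<Rightarrow> real) \<Rightarrow> bool" where
  "lin_eval S T X \<longleftrightarrow> (\<exists>P c. finite P \<and> P \<subseteq> rect S T \<and> X = (\<lambda>x. \<Sum>p\<in>P. c p * x p))"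

lemma lin_eval_point: "p \<in> rect S T \<Longrightarrow> lin_eval S T (\<lambda>x. x p)"
  unfolding lin_eval_def by (intro exI[of _ "{p}"] exI[of _ "\<lambda>_. 1"]) auto

lemma lin_eval_scale: "lin_eval S T X \<Longrightarrow> lin_eval S T (\<lambda>x. a * X x)"
  unfolding lin_eval_def
proof (elim exE conjE)
  fix P c assume P: "finite P" "P \<subseteq> rect S T" "X = (\<lambda>x. \<Sum>p\<in>P. c p * x p)"
  then show "\<exists>P c. finite P \<and> P \<subseteq> rect S T \<and> (\<lambda>x. a * X x) = (\<lambda>x. \<Sum>p\<in>P. c p * x p)"
    by (intro exI[of _ P] exI[of _ "\<lambda>p. a * c p"]) (auto simp: sum_distrib_left mult.assoc)
qed

lemma lin_eval_add:
  assumes "lin_eval S T X" "lin_eval S T Y"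
  shows "lin_eval S T (\<lambda>x. X x + Y x)"
proof -
  from assms obtain P c Q d where P: "finite P" "P \<subseteq> rect S T" "X = (\<lambda>x. \<Sum>p\<in>P. c p * x p)"
    and Q: "finite Q" "Q \<subseteq> rect S T" "Y = (\<lambda>x. \<Sum>p\<in>Q. d p * x p)" by (auto simp: lin_eval_def)
  define e where "e p = (if p \<in> P then c p else 0) + (if p \<in> Q then d p else 0)" for p
  have "X x + Y x = (\<Sum>p\<in>P \<union> Q. e p * x p)" for x
  proof -
    have "X x = (\<Sum>p\<in>P \<union> Q. (if p \<in> P then c p else 0) * x p)"
      unfolding P(3) using P(1) Q(1) by (intro sum.mono_neutral_cong_left) auto
    moreover have "Y x = (\<Sum>p\<in>P \<union> Q. (if p \<in> Q then d p else 0) * x p)"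
      unfolding Q(3) using P(1) Q(1) by (intro sum.mono_neutral_cong_left) auto
    ultimately show ?thesis by (simp add: e_def distrib_right sum.distrib)
  qed
  then show ?thesis using P Q unfolding lin_eval_def by (intro exI[of _ "P \<union> Q"] exI[of _ e]) auto
qed

lemma lin_eval_zero: "lin_eval S T (\<lambda>_. 0)"
  unfolding lin_eval_def by (intro exI[of _ "{}"]) auto

lemma lin_eval_sum: "(\<And>i. i \<in> A \<Longrightarrow> lin_eval S T (X i)) \<Longrightarrow> lin_eval S T (\<lambda>x. \<Sum>i\<in>A. X i x)"
  by (induction A rule: infinite_finite_induct) (auto intro: lin_eval_add lin_eval_zero)

lemma lin_eval_rect_increment:
  assumes "{a, b} \<subseteq> {0..S}" "{c, d} \<subseteq> {0..T}"
  shows "lin_eval S T (\<lambda>x. rect_increment x a b c d)"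
proof -
  have "lin_eval S T (\<lambda>x. x (b, d) + (-1) * x (a, d) + (-1) * x (b, c) + x (a, c))"
    using assms by (intro lin_eval_add lin_eval_scale lin_eval_point) (auto simp: rect_def)
  then show ?thesis by (simp add: rect_increment_def)
qed

lemma lin_eval_RS_sum:
  assumes "d \<in> fine_tagged S \<delta> \<times> fine_tagged T \<delta>"
  shows "lin_eval S T (\<lambda>x. RS_sum g x d)"
proof -
  obtain k p \<xi> l r \<eta> where d: "d = ((k, p, \<xi>), (l, r, \<eta>))" by (metis prod.collapse)
  have "(k, p, \<xi>) \<in> fine_tagged S \<delta>" "(l, r, \<eta>) \<in> fine_tagged T \<delta>" using assms d by auto
  note p = fine_tagged_range(1)[OF this(1)] and r = fine_tagged_range(1)[OF this(2)]
  show ?thesis unfolding d RS_sum.simps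
    using p r by (intro lin_eval_sum lin_eval_scale lin_eval_rect_increment) (auto simp: Suc_le_eq less_imp_le)
qed

text \<open>\<open>M\<close> is the measure before completion: joint measurability is proved there,
  and results pass to \<open>completion M\<close> afterwards. Measurability of the evaluations comes
  from \<open>centered_normal\<close>.\<close>

locale yeh_wiener_space = prob_space M for M :: "planefun measure" +
  fixes S T :: real
  assumes ST: "S > 0" "T > 0"
    and space_M: "space M = C0 S T"
    and normal: "\<And>P c. finite P \<Longrightarrow> P \<subseteq> rect S T \<Longrightarrow> centered_normal M (\<lambda>x. \<Sum>p\<in>P. c p * x p)"
    and cov: "\<And>s t s' t'. (s, t) \<in> rect S T \<Longrightarrow> (s', t') \<in> rect S T \<Longrightarrow>
      (\<integral>x. x (s, t) * x (s', t') \<partial>M) = min s s' * min t t'"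
begin

lemma lin_eval_normal: "lin_eval S T X \<Longrightarrow> centered_normal M X"
  unfolding lin_eval_def using normal by blast

lemma lin_eval_measurable: "lin_eval S T X \<Longrightarrow> X \<in> borel_measurable M"
  using lin_eval_normal by (auto simp: centered_normal_def)

lemma lin_eval_integrable_mult:
  assumes "lin_eval S T X" "lin_eval S T Y"
  shows "integrable M (\<lambda>x. X x * Y x)"
proof (rule Bochner_Integration.integrable_bound)
  note [measurable] = lin_eval_measurable[OF assms(1)] lin_eval_measurable[OF assms(2)]
  show "integrable M (\<lambda>x. (X x)\<^sup>2 + (Y x)\<^sup>2)"
    using assms by (intro Bochner_Integration.integrable_add centered_normal_moments lin_eval_normal)
  show "(\<lambda>x. X x * Y x) \<in> borel_measurable M" by measurable
  show "AE x in M. norm (X x * Y x) \<le> norm ((X x)\<^sup>2 + (Y x)\<^sup>2)"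
    using abs_mult_le_sum_squares by simp
qed

text \<open>For \<open>a \<le> b\<close> and \<open>a' \<le> b'\<close> each factor is the length of
  the overlap of two intervals, so the covariance is the area in which the two cells meet.\<close>

lemma cov_increments:
  assumes "{a, b, a', b'} \<subseteq> {0..S}" "{c, d, c', d'} \<subseteq> {0..T}"
  shows "(\<integral>x. rect_increment x a b c d * rect_increment x a' b' c' d' \<partial>M) =
    (min b b' - min a b' - min b a' + min a a') * (min d d' - min c d' - min d c' + min c c')"
proof -
  have i: "integrable M (\<lambda>x. x (s, t) * x (s', t'))" if "s \<in> {a, b}" "t \<in> {c, d}" "s' \<in> {a', b'}" "t' \<in> {c', d'}" for s t s' t'
    using assms that by (intro lin_eval_integrable_mult lin_eval_point) (auto simp: rect_def)
  have K: "(\<integral>x. x (s, t) * x (s', t') \<partial>M) = min s s' * min t t'" if "s \<in> {a, b}" "t \<in> {c, d}" "s' \<in> {a', b'}" "t' \<in> {c', d'}" for s t s' t'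
    using assms that by (intro cov) (auto simp: rect_def)
  let ?row = "\<lambda>x s t. x (s, t) * x (b', d') - x (s, t) * x (a', d') - x (s, t) * x (b', c') + x (s, t) * x (a', c')"
  have row: "integrable M (\<lambda>x. ?row x s t)" "(\<integral>x. ?row x s t \<partial>M) =
      min s b' * min t d' - min s a' * min t d' - min s b' * min t c' + min s a' * min t c'"
    if "s \<in> {a, b}" "t \<in> {c, d}" for s t
    using i[OF that] K[OF that] by simp_all
  have "(\<integral>x. rect_increment x a b c d * rect_increment x a' b' c' d' \<partial>M) =
    (\<integral>x. ?row x b d - ?row x a d - ?row x b c + ?row x a c \<partial>M)"
    by (intro Bochner_Integration.integral_cong refl) (simp add: rect_increment_def algebra_simps)
  also have "\<dots> = (\<integral>x. ?row x b d \<partial>M) - (\<integral>x. ?row x a d \<partial>M) - (\<integral>x. ?row x b c \<partial>M) + (\<integral>x. ?row x a c \<partial>M)"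
    using row(1) by simp
  also have "\<dots> =
      (min b b' * min d d' - min b a' * min d d' - min b b' * min d c' + min b a' * min d c') -
      (min a b' * min d d' - min a a' * min d d' - min a b' * min d c' + min a a' * min d c') -
      (min b b' * min c d' - min b a' * min c d' - min b b' * min c c' + min b a' * min c c') +
      (min a b' * min c d' - min a a' * min c d' - min a b' * min c c' + min a a' * min c c')"
    by (intro arg_cong2[where f = "(-)"] arg_cong2[where f = "(+)"] row(2)) auto
  also have "\<dots> = (min b b' - min a b' - min b a' + min a a') * (min d d' - min c d' - min d c' + min c c')"
    by (simp only: distrib_left distrib_right left_diff_distrib right_diff_distrib)
  finally show ?thesis .
qed

text \<open>Distinct cells of a grid are uncorrelated, so only the diagonal survives, weighted by
  cell areas. It is written as a Riemann--Stieltjes sum against the monomial with exponents 1, whose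
  density 1 makes the limit computable.\<close>

lemma second_moment_RS_sum:
  assumes "d \<in> fine_tagged S \<delta> \<times> fine_tagged T \<delta>"
  shows "(\<integral>x. (RS_sum g x d)\<^sup>2 \<partial>M) = RS_sum (\<lambda>p. (g p)\<^sup>2) (\<lambda>p. 1 * fst p ^ 1 * snd p ^ 1) d"
proof -
  obtain k p \<xi> l r \<eta> where d: "d = ((k, p, \<xi>), (l, r, \<eta>))" by (metis prod.collapse)
  have pd: "(k, p, \<xi>) \<in> fine_tagged S \<delta>" and rd: "(l, r, \<eta>) \<in> fine_tagged T \<delta>" using assms d by auto
  note p = fine_tagged_range[OF pd] and r = fine_tagged_range[OF rd]
  define D where "D = (\<lambda>(i, j) x. rect_increment x (p i) (p (Suc i)) (r j) (r (Suc j)))"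
  define A where "A = (\<lambda>(i, j). g (\<xi> i, \<eta> j))"
  let ?Z = "{..<k} \<times> {..<l}"
  have incr: "min (q (Suc i)) (q (Suc i')) - min (q i) (q (Suc i')) - min (q (Suc i)) (q i') + min (q i) (q i') =
      (if i = i' then q (Suc i) - q i else 0)" if q: "(n, q, z) \<in> fine_tagged b \<delta>" and i: "i < n" "i' < n" for n q z b i i'
  proof -
    have w: "weak_partition b n q" using q by (auto simp: fine_tagged_def intro: partition_imp_weak)
    consider "i = i'" | "Suc i \<le> i'" | "Suc i' \<le> i" by linarith
    then show ?thesis
    proof cases
      case 1
      then show ?thesis using weak_partition_mono[OF w, of i "Suc i"] i by simp
    next
      case 2
      then have "q i \<le> q (Suc i)" "q (Suc i) \<le> q i'" "q i' \<le> q (Suc i')"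
        using i by (auto intro!: weak_partition_mono[OF w])
      then show ?thesis using 2 by simp
    next
      case 3
      then have "q i' \<le> q (Suc i')" "q (Suc i') \<le> q i" "q i \<le> q (Suc i)"
        using i by (auto intro!: weak_partition_mono[OF w])
      then show ?thesis using 3 by simp
    qed
  qed
  have DD: "(\<integral>x. D z x * D z' x \<partial>M) = (if z = z' then (p (Suc (fst z)) - p (fst z)) * (r (Suc (snd z)) - r (snd z)) else 0)"
    if "z \<in> ?Z" "z' \<in> ?Z" for z z'
  proof -
    obtain i j i' j' where z: "z = (i, j)" "z' = (i', j')" "i < k" "j < l" "i' < k" "j' < l" using \<open>z \<in> ?Z\<close> \<open>z' \<in> ?Z\<close> by blast
    have "(\<integral>x. D z x * D z' x \<partial>M) = (if i = i' then p (Suc i) - p i else 0) * (if j = j' then r (Suc j) - r j else 0)"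
      unfolding z D_def prod.case incr[OF pd z(3,5), symmetric] incr[OF rd z(4,6), symmetric]
      using z p(1)[of i] p(1)[of "Suc i"] p(1)[of i'] p(1)[of "Suc i'"] r(1)[of j] r(1)[of "Suc j"] r(1)[of j'] r(1)[of "Suc j'"]
      by (intro cov_increments) auto
    then show ?thesis using z by simp
  qed
  have Dlin: "lin_eval S T (D z)" if "z \<in> ?Z" for z
  proof -
    obtain i j where "z = (i, j)" "i < k" "j < l" using \<open>z \<in> ?Z\<close> by blast
    then show ?thesis using p(1)[of i] p(1)[of "Suc i"] r(1)[of j] r(1)[of "Suc j"]
      by (auto simp: D_def intro!: lin_eval_rect_increment)
  qed
  have RS: "RS_sum g x d = (\<Sum>z\<in>?Z. A z * D z x)" for x
    unfolding d RS_sum.simps sum.cartesian_product by (intro sum.cong) (auto simp: A_def D_def)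
  have "(RS_sum g x d)\<^sup>2 = (\<Sum>z\<in>?Z. \<Sum>z'\<in>?Z. (A z * A z') * (D z x * D z' x))" for x
    unfolding RS power2_eq_square sum_product by (intro sum.cong refl) (simp add: ac_simps)
  then have "(\<integral>x. (RS_sum g x d)\<^sup>2 \<partial>M) = (\<integral>x. (\<Sum>z\<in>?Z. \<Sum>z'\<in>?Z. (A z * A z') * (D z x * D z' x)) \<partial>M)" by simp
  also have "\<dots> = (\<Sum>z\<in>?Z. \<Sum>z'\<in>?Z. (A z * A z') * (\<integral>x. D z x * D z' x \<partial>M))"
  proof -
    have i: "integrable M (\<lambda>x. (A z * A z') * (D z x * D z' x))" if "z \<in> ?Z" "z' \<in> ?Z" for z z'
      by (intro integrable_mult_right lin_eval_integrable_mult Dlin that)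
    show ?thesis using i
      by (subst Bochner_Integration.integral_sum) (auto intro!: sum.cong simp: Bochner_Integration.integral_sum)
  qed
  also have "\<dots> = (\<Sum>z\<in>?Z. \<Sum>z'\<in>?Z. if z = z' then (A z)\<^sup>2 * ((p (Suc (fst z)) - p (fst z)) * (r (Suc (snd z)) - r (snd z))) else 0)"
    by (intro sum.cong refl) (simp add: DD power2_eq_square)
  also have "\<dots> = (\<Sum>z\<in>?Z. (A z)\<^sup>2 * ((p (Suc (fst z)) - p (fst z)) * (r (Suc (snd z)) - r (snd z))))"
    by (intro sum.cong refl) (simp add: sum.delta')
  also have "\<dots> = RS_sum (\<lambda>p. (g p)\<^sup>2) (\<lambda>p. 1 * fst p ^ 1 * snd p ^ 1) d"
    unfolding d RS_sum.simps sum.cartesian_product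
    by (intro sum.cong refl) (auto simp: A_def rect_increment_def algebra_simps)
  finally show ?thesis .
qed

end

section \<open>Law and moments of Riemann--Stieltjes integrals against random paths\<close>

context yeh_wiener_space
begin

abbreviation grid :: "nat \<Rightarrow> tagged \<times> tagged" where
  "grid n \<equiv> (uniform_tagged S n, uniform_tagged T n)"

lemma RS_sum_uniform_tendsto:
  assumes "bounded_variation_HK S T g" "x \<in> space M"
  shows "(\<lambda>n. RS_sum g x (grid n)) \<longlonglongrightarrow> RS_integral S T g x"
proof -
  have "continuous_on (rect S T) x" using assms(2) space_M by (auto simp: C0_def)
  from has_RS_integral_continuous[OF assms(1) this ST] show ?thesis
    unfolding has_RS_integral_iff_tendsto by (rule filterlim_compose[OF _ uniform_tagged_mesh[OF ST]])
qed

lemma uniform_tagged_fine_ex: "\<exists>\<delta>. (grid n) \<in> fine_tagged S \<delta> \<times> fine_tagged T \<delta>"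
  using uniform_tagged_fine[OF ST(1), of n "S / real (Suc n) + T / real (Suc n)"]
    uniform_tagged_fine[OF ST(2), of n "S / real (Suc n) + T / real (Suc n)"] ST
  by (intro exI[of _ "S / real (Suc n) + T / real (Suc n)"]) (simp del: of_nat_Suc)

lemma RS_sum_uniform_normal: "centered_normal M (\<lambda>x. RS_sum g x (grid n))"
  using uniform_tagged_fine_ex[of n] lin_eval_normal[OF lin_eval_RS_sum] by blast

lemma RS_sum_uniform_measurable [measurable]:
  "(\<lambda>x. RS_sum g x (grid n)) \<in> borel_measurable M"
  using RS_sum_uniform_normal by (simp add: centered_normal_def)

lemma RS_integral_measurable [measurable (raw)]:
  assumes "bounded_variation_HK S T g"
  shows "(\<lambda>x. RS_integral S T g x) \<in> borel_measurable M"
  by (rule borel_measurable_LIMSEQ_real[OF RS_sum_uniform_tendsto[OF assms]]) measurable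

lemma RS_sum_uniform_second_moment:
  assumes "bounded_variation_HK S T g"
  shows "(\<lambda>n. \<integral>x. (RS_sum g x (grid n))\<^sup>2 \<partial>M) \<longlonglongrightarrow> L2_inner S T g g"
proof -
  obtain V W where "mono_controlled S T V W g" using HK_mono_controlled[OF assms ST] by blast
  then obtain V W where VW: "mono_controlled S T V W (\<lambda>p. (g p)\<^sup>2)" using mono_controlled_square ST by blast
  from has_RS_integral_density[OF VW has_density_monomial[of S T 1 1 1] ST]
  have "(RS_sum (\<lambda>p. (g p)\<^sup>2) (\<lambda>p. 1 * fst p ^ 1 * snd p ^ 1) \<longlongrightarrow> L2_inner S T g g) (mesh_filter S T)"
    unfolding has_RS_integral_iff_tendsto L2_inner_def by (simp add: power2_eq_square)
  moreover have "(\<integral>x. (RS_sum g x (grid n))\<^sup>2 \<partial>M) =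
      RS_sum (\<lambda>p. (g p)\<^sup>2) (\<lambda>p. 1 * fst p ^ 1 * snd p ^ 1) (grid n)" for n
    using uniform_tagged_fine_ex[of n] second_moment_RS_sum by blast
  ultimately show ?thesis
    using filterlim_compose[OF _ uniform_tagged_mesh[OF ST]] by (simp only:)
qed

lemma RS_integral_char:
  assumes g: "bounded_variation_HK S T g"
  shows "(\<integral>x. exp (\<i> * of_real (RS_integral S T g x)) \<partial>M) = of_real (exp (- L2_inner S T g g / 2))"
proof (rule LIMSEQ_unique)
  let ?R = "\<lambda>n x. RS_sum g x (grid n)"
  show "(\<lambda>n. \<integral>x. exp (\<i> * of_real (?R n x)) \<partial>M) \<longlonglongrightarrow> (\<integral>x. exp (\<i> * of_real (RS_integral S T g x)) \<partial>M)"
  proof (rule integral_dominated_convergence[where w = "\<lambda>_. 1"])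
    show "AE x in M. (\<lambda>n. exp (\<i> * of_real (?R n x))) \<longlonglongrightarrow> exp (\<i> * of_real (RS_integral S T g x))"
      using AE_space by eventually_elim (intro tendsto_intros RS_sum_uniform_tendsto g)
  qed (use g in \<open>auto intro!: measurable_compose[OF _ borel_measurable_exp] borel_measurable_times borel_measurable_of_real RS_integral_measurable RS_sum_uniform_measurable\<close>)
  have "(\<lambda>n. complex_of_real (exp (- (\<integral>x. (?R n x)\<^sup>2 \<partial>M) / 2))) \<longlonglongrightarrow> of_real (exp (- L2_inner S T g g / 2))"
    by (intro tendsto_intros RS_sum_uniform_second_moment g) simp
  then show "(\<lambda>n. \<integral>x. exp (\<i> * of_real (?R n x)) \<partial>M) \<longlonglongrightarrow> of_real (exp (- L2_inner S T g g / 2))"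
    by (simp add: centered_normal_moments(4)[OF RS_sum_uniform_normal])
qed

text \<open>The fourth moment of a centred normal variable is three times its squared variance;
  Fatou passes this to the limit as an inequality, the form used by the maximal inequality.\<close>

lemma RS_integral_fourth_moment:
  assumes g: "bounded_variation_HK S T g"
  shows "(\<integral>\<^sup>+x. ennreal (\<bar>RS_integral S T g x\<bar> ^ 4) \<partial>M) \<le> ennreal (3 * (L2_inner S T g g)\<^sup>2)"
proof -
  let ?R = "\<lambda>n x. RS_sum g x (grid n)"
  have "(\<integral>\<^sup>+x. ennreal (\<bar>RS_integral S T g x\<bar> ^ 4) \<partial>M) = (\<integral>\<^sup>+x. liminf (\<lambda>n. ennreal (\<bar>?R n x\<bar> ^ 4)) \<partial>M)"
  proof (rule nn_integral_cong)
    fix x assume "x \<in> space M"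
    then have "(\<lambda>n. ennreal (\<bar>?R n x\<bar> ^ 4)) \<longlonglongrightarrow> ennreal (\<bar>RS_integral S T g x\<bar> ^ 4)"
      by (intro tendsto_ennrealI tendsto_intros RS_sum_uniform_tendsto g)
    from lim_imp_Liminf[OF sequentially_bot this]
    show "ennreal (\<bar>RS_integral S T g x\<bar> ^ 4) = liminf (\<lambda>n. ennreal (\<bar>?R n x\<bar> ^ 4))" by (rule sym)
  qed
  also have "\<dots> \<le> liminf (\<lambda>n. \<integral>\<^sup>+x. ennreal (\<bar>?R n x\<bar> ^ 4) \<partial>M)"
    by (rule nn_integral_liminf) measurable
  also have "(\<lambda>n. \<integral>\<^sup>+x. ennreal (\<bar>?R n x\<bar> ^ 4) \<partial>M) = (\<lambda>n. ennreal (3 * (\<integral>x. (?R n x)\<^sup>2 \<partial>M)\<^sup>2))"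
  proof
    fix n
    show "(\<integral>\<^sup>+x. ennreal (\<bar>?R n x\<bar> ^ 4) \<partial>M) = ennreal (3 * (\<integral>x. (?R n x)\<^sup>2 \<partial>M)\<^sup>2)"
      using centered_normal_moments(2,3)[OF RS_sum_uniform_normal, of g n]
      by (subst nn_integral_eq_integral) auto
  qed
  also have "liminf \<dots> = ennreal (3 * (L2_inner S T g g)\<^sup>2)"
    by (intro lim_imp_Liminf tendsto_ennrealI tendsto_intros RS_sum_uniform_second_moment g) simp
  finally show ?thesis .
qed

end

section \<open>Convergence and law of the Paley--Wiener--Zygmund integral\<close>

locale pwz = yeh_wiener_space +
  fixes \<phi> :: "nat \<Rightarrow> planefun"
  assumes cons: "complete_orthonormal_BV S T \<phi>"
begin

lemma \<phi>_HK: "bounded_variation_HK S T (\<phi> j)"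
  using cons by (simp add: complete_orthonormal_BV_def)

lemma \<phi>_L2: "\<phi> j \<in> L2_carrier S T"
  using cons by (simp add: complete_orthonormal_BV_def)

lemma combination_HK: "bounded_variation_HK S T (\<lambda>p. \<Sum>j\<in>A. c j * \<phi> j p)"
  by (intro bounded_variation_HK_sum bounded_variation_HK_scale \<phi>_HK)

lemma RS_integral_combination:
  assumes "x \<in> space M"
  shows "RS_integral S T (\<lambda>p. \<Sum>j\<in>A. c j * \<phi> j p) x = (\<Sum>j\<in>A. c j * RS_integral S T (\<phi> j) x)"
proof (rule RS_integral_eqI[OF _ ST])
  have "continuous_on (rect S T) x" using assms space_M by (auto simp: C0_def)
  then show "has_RS_integral S T (\<lambda>p. \<Sum>j\<in>A. c j * \<phi> j p) x (\<Sum>j\<in>A. c j * RS_integral S T (\<phi> j) x)"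
    by (intro has_RS_integral_sum_left has_RS_integral_continuous \<phi>_HK ST)
qed

lemma PWZ_eq:
  assumes "x \<in> space M"
  shows "PWZ S T \<phi> v x = lim (\<lambda>n. \<Sum>j<n. L2_inner S T v (\<phi> j) * RS_integral S T (\<phi> j) x)"
  unfolding PWZ_def using RS_integral_combination[OF assms] by simp

text \<open>An increment of the partial sums is the Riemann--Stieltjes integral of a finite
  combination of the \<open>\<phi> j\<close>, with variance the corresponding block of squared
  coefficients. These blocks are increments of a sequence that converges by Parseval.\<close>

lemma PWZ_tendsto:
  assumes v: "v \<in> L2_carrier S T"
  shows "AE x in M. (\<lambda>n. \<Sum>j<n. L2_inner S T v (\<phi> j) * RS_integral S T (\<phi> j) x) \<longlonglongrightarrow> PWZ S T \<phi> v x"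
proof -
  define c where "c j = L2_inner S T v (\<phi> j)" for j
  let ?X = "\<lambda>n x. \<Sum>j<n. c j * RS_integral S T (\<phi> j) x"
  let ?t = "\<lambda>n. \<Sum>j<n. (c j)\<^sup>2"
  have "AE x in M. convergent (\<lambda>n. ?X n x)"
  proof (rule AE_convergent_from_fourth_moments)
    show "?X n \<in> borel_measurable M" for n
      by (intro borel_measurable_sum borel_measurable_times borel_measurable_const RS_integral_measurable \<phi>_HK)
    show "mono ?t" by (auto intro!: monoI sum_mono2)
    show "?t \<longlonglongrightarrow> L2_inner S T v v" using Parseval[OF cons v] by (simp add: sums_def c_def)
    fix a b :: nat assume ab: "a \<le> b"
    let ?g = "\<lambda>p. \<Sum>j\<in>{a..<b}. c j * \<phi> j p"
    have "(\<integral>\<^sup>+x. ennreal (\<bar>?X b x - ?X a x\<bar> ^ 4) \<partial>M) = (\<integral>\<^sup>+x. ennreal (\<bar>RS_integral S T ?g x\<bar> ^ 4) \<partial>M)"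
    proof (rule nn_integral_cong)
      fix x assume "x \<in> space M"
      then have "RS_integral S T ?g x = ?X b x - ?X a x"
        using ab by (simp add: RS_integral_combination sum_diff_nat_ivl atLeast0LessThan[symmetric])
      then show "ennreal (\<bar>?X b x - ?X a x\<bar> ^ 4) = ennreal (\<bar>RS_integral S T ?g x\<bar> ^ 4)" by simp
    qed
    also have "\<dots> \<le> ennreal (3 * (L2_inner S T ?g ?g)\<^sup>2)" by (intro RS_integral_fourth_moment combination_HK)
    also have "L2_inner S T ?g ?g = (\<Sum>j\<in>{a..<b}. (c j)\<^sup>2)" by (rule orthonormal_sum_inner[OF cons]) simp
    also have "\<dots> = ?t b - ?t a" using ab by (simp add: sum_diff_nat_ivl atLeast0LessThan[symmetric])
    finally show "(\<integral>\<^sup>+x. ennreal (\<bar>?X b x - ?X a x\<bar> ^ 4) \<partial>M) \<le> ennreal (3 * (?t b - ?t a)\<^sup>2)" .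
  qed
  then show ?thesis
    using AE_space by eventually_elim (simp add: PWZ_eq c_def convergent_LIMSEQ_iff)
qed

lemma PWZ_measurable [measurable (raw)]: "(\<lambda>x. PWZ S T \<phi> v x) \<in> borel_measurable M"
proof -
  have "(\<lambda>x. lim (\<lambda>n. \<Sum>j<n. L2_inner S T v (\<phi> j) * RS_integral S T (\<phi> j) x)) \<in> borel_measurable M"
    by (intro borel_measurable_lim_metric borel_measurable_sum borel_measurable_times borel_measurable_const RS_integral_measurable \<phi>_HK)
  then show ?thesis by (subst measurable_cong[OF PWZ_eq])
qed

lemma PWZ_char:
  assumes v: "v \<in> L2_carrier S T"
  shows "(\<integral>x. exp (\<i> * of_real (\<theta> * PWZ S T \<phi> v x)) \<partial>M) = of_real (exp (- \<theta>\<^sup>2 * L2_inner S T v v / 2))"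
proof (rule LIMSEQ_unique)
  define c where "c j = L2_inner S T v (\<phi> j)" for j
  \<comment> \<open>The factor \<theta> is moved into the coefficients, so that
    \<open>RS_integral_char\<close> applies to the scaled combination.\<close>
  let ?g = "\<lambda>n p. \<Sum>j<n. (\<theta> * c j) * \<phi> j p"
  have [measurable]: "(\<lambda>x. RS_integral S T (?g n) x) \<in> borel_measurable M" for n
    by (rule RS_integral_measurable[OF combination_HK])
  show "(\<lambda>n. \<integral>x. exp (\<i> * of_real (RS_integral S T (?g n) x)) \<partial>M) \<longlonglongrightarrow> (\<integral>x. exp (\<i> * of_real (\<theta> * PWZ S T \<phi> v x)) \<partial>M)"
  proof (rule integral_dominated_convergence[where w = "\<lambda>_. 1"])
    show "AE x in M. (\<lambda>n. exp (\<i> * of_real (RS_integral S T (?g n) x))) \<longlonglongrightarrow> exp (\<i> * of_real (\<theta> * PWZ S T \<phi> v x))"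
      using PWZ_tendsto[OF v] AE_space
    proof eventually_elim
      case (elim x)
      have "(\<lambda>n. \<theta> * (\<Sum>j<n. c j * RS_integral S T (\<phi> j) x)) \<longlonglongrightarrow> \<theta> * PWZ S T \<phi> v x"
        using elim(1) unfolding c_def by (intro tendsto_intros)
      moreover have "\<theta> * (\<Sum>j<n. c j * RS_integral S T (\<phi> j) x) = RS_integral S T (?g n) x" for n
        using RS_integral_combination[OF elim(2), of "\<lambda>j. \<theta> * c j"] by (simp add: sum_distrib_left mult.assoc)
      ultimately show ?case by (intro tendsto_intros) simp
    qed
  qed simp_all
  have "L2_inner S T (?g n) (?g n) = \<theta>\<^sup>2 * (\<Sum>j<n. (c j)\<^sup>2)" for n
    unfolding orthonormal_sum_inner(1)[OF cons finite_lessThan] by (simp add: sum_distrib_left power_mult_distrib)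
  moreover have "(\<lambda>n. complex_of_real (exp (- (\<theta>\<^sup>2 * (\<Sum>j<n. (c j)\<^sup>2)) / 2))) \<longlonglongrightarrow> of_real (exp (- (\<theta>\<^sup>2 * L2_inner S T v v) / 2))"
    using Parseval[OF cons v] by (intro tendsto_intros) (simp_all add: sums_def c_def)
  ultimately show "(\<lambda>n. \<integral>x. exp (\<i> * of_real (RS_integral S T (?g n) x)) \<partial>M) \<longlonglongrightarrow> of_real (exp (- \<theta>\<^sup>2 * L2_inner S T v v / 2))"
    by (simp add: RS_integral_char[OF combination_HK])
qed

end

section \<open>Measurability on \<open>L\<^sub>2(Q)\<close>\<close>

lemma space_L2_borel [simp]: "space (L2_borel S T) = L2_carrier S T"
  by (simp add: L2_borel_def space_measure_of_conv)

lemma L2_open_in_sets: "L2_open S T U \<Longrightarrow> U \<in> sets (L2_borel S T)"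
  unfolding L2_borel_def by (subst sets_measure_of) (auto simp: L2_open_def intro: sigma_sets.Basic)

lemma L2_inner_borel_measurable:
  assumes k: "k \<in> L2_carrier S T"
  shows "(\<lambda>u. L2_inner S T u k) \<in> borel_measurable (L2_borel S T)"
proof (rule borel_measurableI)
  fix A :: "real set" assume A: "open A"
  show "(\<lambda>u. L2_inner S T u k) -` A \<inter> space (L2_borel S T) \<in> sets (L2_borel S T)"
  proof (rule L2_open_in_sets, unfold L2_open_def, intro conjI ballI)
    fix u assume "u \<in> (\<lambda>u. L2_inner S T u k) -` A \<inter> space (L2_borel S T)"
    then have u: "u \<in> L2_carrier S T" "L2_inner S T u k \<in> A" by auto
    from A u(2) obtain e where e: "e > 0" "\<And>y. dist y (L2_inner S T u k) < e \<Longrightarrow> y \<in> A" by (auto simp: open_dist)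
    \<comment> \<open>The summand 1 keeps the quotient defined when \<open>k\<close> has norm
      0.\<close>
    define \<delta> where "\<delta> = e / (L2_norm S T k + 1)"
    have pos: "0 < L2_norm S T k + 1" using L2_norm_nonneg[of S T k] by linarith
    have "v \<in> (\<lambda>u. L2_inner S T u k) -` A \<inter> space (L2_borel S T)"
      if v: "v \<in> L2_carrier S T" and d: "L2_norm S T (\<lambda>p. v p - u p) < \<delta>" for v
    proof -
      have "\<bar>L2_inner S T v k - L2_inner S T u k\<bar> \<le> L2_norm S T (\<lambda>p. v p - u p) * L2_norm S T k"
        using L2_Cauchy_Schwarz[OF L2_diff[OF v u(1)] k] L2_inner_diff_left[OF v u(1) k] by simp
      also have "\<dots> \<le> L2_norm S T (\<lambda>p. v p - u p) * (L2_norm S T k + 1)"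
        by (intro mult_left_mono L2_norm_nonneg) simp
      also have "\<dots> < \<delta> * (L2_norm S T k + 1)" using d pos by (rule mult_strict_right_mono)
      also have "\<dots> = e" using pos by (simp add: \<delta>_def)
      finally show ?thesis using e(2) v by (simp add: dist_real_def)
    qed
    moreover have "\<delta> > 0" using e(1) pos by (simp add: \<delta>_def)
    ultimately show "\<exists>\<epsilon>>0. \<forall>v\<in>L2_carrier S T. L2_norm S T (\<lambda>p. v p - u p) < \<epsilon> \<longrightarrow>
        v \<in> (\<lambda>u. L2_inner S T u k) -` A \<inter> space (L2_borel S T)" by blast
  qed auto
qed

context pwz
begin

text \<open>The factor \<open>h\<close> moves to the other side, giving the inner product of
  \<open>u\<close> with the fixed vector \<open>\<phi> j * h\<close>, which is continuous in
  \<open>u\<close>.\<close>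

lemma L2_inner_mult_borel_measurable:
  assumes "bounded_variation_HK S T h"
  shows "(\<lambda>u. L2_inner S T (\<lambda>p. u p * h p) (\<phi> j)) \<in> borel_measurable (L2_borel S T)"
proof -
  have "(\<lambda>p. \<phi> j p * h p) \<in> L2_carrier S T" by (rule HK_L2_mult[OF assms ST \<phi>_L2])
  from L2_inner_borel_measurable[OF this] show ?thesis by (simp add: L2_inner_def ac_simps)
qed

text \<open>Needed for Fubini. In each term the coefficient depends only on \<open>u\<close> and the
  Riemann--Stieltjes integral only on \<open>x\<close>; \<open>lim\<close> preserves measurability
  even where the limit fails to exist.\<close>

lemma PWZ_mult_jointly_measurable:
  assumes h: "bounded_variation_HK S T h"
  shows "(\<lambda>(u, x). PWZ S T \<phi> (\<lambda>p. u p * h p) x) \<in> borel_measurable (L2_borel S T \<Otimes>\<^sub>M M)"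
proof -
  note [measurable] = L2_inner_mult_borel_measurable[OF h] RS_integral_measurable[OF \<phi>_HK]
  have "(\<lambda>z. lim (\<lambda>n. \<Sum>j<n. L2_inner S T (\<lambda>p. fst z p * h p) (\<phi> j) * RS_integral S T (\<phi> j) (snd z)))
      \<in> borel_measurable (L2_borel S T \<Otimes>\<^sub>M M)"
    by measurable
  then show ?thesis
    by (subst measurable_cong[where g = "\<lambda>z. lim (\<lambda>n. \<Sum>j<n. L2_inner S T (\<lambda>p. fst z p * h p) (\<phi> j) * RS_integral S T (\<phi> j) (snd z))"])
       (auto simp: space_pair_measure PWZ_eq)
qed

lemma PWZ_mult_borel_measurable:
  assumes h: "bounded_variation_HK S T h" and x: "x \<in> space M"
  shows "(\<lambda>u. PWZ S T \<phi> (\<lambda>p. u p * h p) x) \<in> borel_measurable (L2_borel S T)"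
  using measurable_Pair1[OF PWZ_mult_jointly_measurable[OF h] x] by simp

text \<open>Parseval writes the squared norm as a countable sum of squared measurable
  coordinates.\<close>

lemma L2_norm_mult_borel_measurable:
  assumes h: "bounded_variation_HK S T h"
  shows "(\<lambda>u. (L2_norm S T (\<lambda>p. u p * h p))\<^sup>2) \<in> borel_measurable (L2_borel S T)"
proof -
  note [measurable] = L2_inner_mult_borel_measurable[OF h]
  have "(\<lambda>u. \<Sum>j. (L2_inner S T (\<lambda>p. u p * h p) (\<phi> j))\<^sup>2) \<in> borel_measurable (L2_borel S T)" by measurable
  moreover have "(L2_norm S T (\<lambda>p. u p * h p))\<^sup>2 = (\<Sum>j. (L2_inner S T (\<lambda>p. u p * h p) (\<phi> j))\<^sup>2)"
    if "u \<in> space (L2_borel S T)" for u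
    using Parseval[OF cons HK_L2_mult[OF h ST]] that by (simp add: L2_norm_power2 sums_iff)
  ultimately show ?thesis by (subst measurable_cong)
qed

end

section \<open>Integration against complex measures\<close>

definition signed_measure :: "'a measure \<Rightarrow> ('a set \<Rightarrow> real) \<Rightarrow> bool" where
  "signed_measure N r \<longleftrightarrow> (\<forall>A :: nat \<Rightarrow> 'a set. range A \<subseteq> sets N \<longrightarrow> disjoint_family A \<longrightarrow>
     (\<lambda>i. r (A i)) sums r (\<Union>i. A i))"

text \<open>Countable additivity on the constant sequence of empty sets: the terms of a convergent
  series tend to 0.\<close>

lemma signed_measure_empty:
  assumes "signed_measure N r"
  shows "r {} = 0"
proof -
  have "(\<lambda>i::nat. r {}) sums r (\<Union>i::nat. {})"
    using assms unfolding signed_measure_def by (elim allE[of _ "\<lambda>_. {}"]) (auto simp: disjoint_family_on_def)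
  then have "(\<lambda>i::nat. r {}) \<longlonglongrightarrow> 0" using summable_LIMSEQ_zero sums_summable by blast
  then show ?thesis by (simp add: LIMSEQ_const_iff)
qed

lemma signed_measure_Un:
  assumes r: "signed_measure N r" and AB: "A \<in> sets N" "B \<in> sets N" "A \<inter> B = {}"
  shows "r (A \<union> B) = r A + r B"
proof -
  have "disjoint_family (binaryset A B)" using AB(3) by (auto simp: disjoint_family_on_def binaryset_def)
  then have "(\<lambda>i. r (binaryset A B i)) sums r (A \<union> B)"
    using r AB unfolding signed_measure_def by (metis UN_binaryset_eq range_binaryset_eq empty_subsetI insert_subset sets.empty_sets)
  with binaryset_sums[of r A B, OF signed_measure_empty[OF r]] show ?thesis using sums_unique2 by blast
qed

text \<open>If \<open>r\<close> were unbounded, one could repeatedly cut a set on which \<open>r\<close> is unbounded into a piece of large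
  measure and a remainder on which \<open>r\<close> is still unbounded; the pieces contradict countable additivity.\<close>

lemma signed_measure_bounded:
  assumes r: "signed_measure N r"
  shows "\<exists>C. \<forall>B\<in>sets N. \<bar>r B\<bar> \<le> C"
proof (rule ccontr)
  assume unb: "\<nexists>C. \<forall>B\<in>sets N. \<bar>r B\<bar> \<le> C"
  define big where "big A \<longleftrightarrow> A \<in> sets N \<and> (\<forall>C. \<exists>B\<in>sets N. B \<subseteq> A \<and> \<bar>r B\<bar> > C)" for A
  have "big (space N)" unfolding big_def using unb sets.sets_into_space by (metis not_less sets.top)
  have step: "\<exists>A'. big A' \<and> A' \<subseteq> A \<and> \<bar>r (A - A')\<bar> \<ge> 1" if bigA: "big A" for A
  proof -
    have A: "A \<in> sets N" using bigA by (simp add: big_def)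
    \<comment> \<open>The margin \<open>\<bar>r A\<bar> + 1\<close> makes both \<open>B\<close> and
      \<open>A - B\<close> large, so either of them may be the discarded piece.\<close>
    obtain B where B: "B \<in> sets N" "B \<subseteq> A" "\<bar>r B\<bar> > \<bar>r A\<bar> + 1" using bigA unfolding big_def by blast
    have "r A = r B + r (A - B)"
      using signed_measure_Un[OF r B(1), of "A - B"] A B by (simp add: Un_absorb1)
    then have large: "\<bar>r B\<bar> \<ge> 1" "\<bar>r (A - B)\<bar> \<ge> 1" using B(3) by linarith+
    have "big B \<or> big (A - B)"
    proof (rule ccontr)
      assume "\<not> (big B \<or> big (A - B))"
      then have nb: "\<not> big B" "\<not> big (A - B)" by blast+
      obtain C1 where C1: "\<And>E. E \<in> sets N \<Longrightarrow> E \<subseteq> B \<Longrightarrow> \<bar>r E\<bar> \<le> C1"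
        using nb(1) B(1) unfolding big_def not_less[symmetric] by blast
      obtain C2 where C2: "\<And>E. E \<in> sets N \<Longrightarrow> E \<subseteq> A - B \<Longrightarrow> \<bar>r E\<bar> \<le> C2"
        using nb(2) A B(1) unfolding big_def not_less[symmetric] by blast
      obtain E where E: "E \<in> sets N" "E \<subseteq> A" "\<bar>r E\<bar> > C1 + C2" using bigA unfolding big_def by blast
      have "r E = r (E \<inter> B) + r (E - B)"
      proof -
        have "E \<inter> B \<union> (E - B) = E" "(E \<inter> B) \<inter> (E - B) = {}" by blast+
        then show ?thesis using signed_measure_Un[OF r, of "E \<inter> B" "E - B"] E(1) B(1) by simp
      qed
      moreover have "\<bar>r (E \<inter> B)\<bar> \<le> C1" using E B(1) by (intro C1) auto
      moreover have "\<bar>r (E - B)\<bar> \<le> C2" using E B(1) by (intro C2) auto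
      ultimately show False using E(3) by linarith
    qed
    then show ?thesis
    proof
      assume "big B"
      then show ?thesis using B(2) large(2) by blast
    next
      assume "big (A - B)"
      moreover have "A - (A - B) = B" using B(2) by blast
      ultimately show ?thesis using large(1) by (intro exI[of _ "A - B"]) auto
    qed
  qed
  have "\<exists>f. \<forall>n::nat. big (f n) \<and> (f (Suc n) \<subseteq> f n \<and> \<bar>r (f n - f (Suc n))\<bar> \<ge> 1)"
    by (rule dependent_nat_choice) (use \<open>big (space N)\<close> step in blast)+
  then obtain f where f: "\<And>n::nat. big (f n)" "\<And>n. f (Suc n) \<subseteq> f n" "\<And>n. \<bar>r (f n - f (Suc n))\<bar> \<ge> 1" by blast
  have dec: "m \<le> n \<Longrightarrow> f n \<subseteq> f m" for m n by (rule lift_Suc_antimono_le[of f]) (use f(2) in auto)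
  have "disjoint_family (\<lambda>n. f n - f (Suc n))"
    unfolding disjoint_family_on_def
  proof (intro ballI impI)
    fix m n :: nat assume "m \<noteq> n"
    then consider "Suc m \<le> n" | "Suc n \<le> m" by linarith
    then show "(f m - f (Suc m)) \<inter> (f n - f (Suc n)) = {}"
      by cases (use dec[of "Suc m" n] dec[of "Suc n" m] in blast)+
  qed
  moreover have "range (\<lambda>n. f n - f (Suc n)) \<subseteq> sets N" using f(1) by (auto simp: big_def)
  ultimately have "(\<lambda>n. r (f n - f (Suc n))) sums r (\<Union>n. f n - f (Suc n))" using r unfolding signed_measure_def by blast
  then have "(\<lambda>n. r (f n - f (Suc n))) \<longlonglongrightarrow> 0" using summable_LIMSEQ_zero sums_summable by blast
  then have "\<forall>\<^sub>F n in sequentially. dist (r (f n - f (Suc n))) 0 < 1" by (rule tendstoD) simp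
  then show False using f(3) by (auto simp: dist_real_def not_less[symmetric])
qed

lemma sets_positive_variation [simp]: "sets (positive_variation N r) = sets N"
  by (simp add: positive_variation_def sets.sets_measure_of_eq)

lemma space_positive_variation [simp]: "space (positive_variation N r) = space N"
  by (simp add: positive_variation_def sets.space_measure_of_eq)

text \<open>Only finiteness matters below; that this is the Jordan decomposition plays no role.\<close>

lemma finite_measure_positive_variation:
  assumes "signed_measure N r"
  shows "finite_measure (positive_variation N r)"
proof
  obtain C where C: "\<And>B. B \<in> sets N \<Longrightarrow> \<bar>r B\<bar> \<le> C" using signed_measure_bounded[OF assms] by blast
  have "ennreal (r B) \<le> ennreal C" if "B \<in> sets N" for B using C[OF that] by (intro ennreal_leI) linarith
  then have "(SUP B\<in>{B \<in> sets N. B \<subseteq> space N}. ennreal (r B)) \<le> ennreal C" by (intro SUP_least) auto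
  then have "emeasure (positive_variation N r) (space N) \<le> ennreal C"
    \<comment> \<open>The measure of the space is either this supremum or the default value 0 of
      \<open>measure_of\<close>; the bound covers both.\<close>
    unfolding positive_variation_def emeasure_measure_of_conv by auto
  then show "emeasure (positive_variation N r) (space (positive_variation N r)) \<noteq> \<infinity>"
    by (simp add: top.not_eq_extremum order.strict_trans1)
qed

lemma complex_measure_parts:
  assumes "f \<in> complex_measures N"
  shows "signed_measure N (\<lambda>A. Re (f A))" "signed_measure N (\<lambda>A. - Re (f A))"
    "signed_measure N (\<lambda>A. Im (f A))" "signed_measure N (\<lambda>A. - Im (f A))"
  using assms unfolding complex_measures_def signed_measure_def
  by (auto intro!: sums_Re sums_Im sums_minus[OF sums_Re] sums_minus[OF sums_Im])

lemmas finite_measure_parts = complex_measure_parts[THEN finite_measure_positive_variation]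

section \<open>Fubini, dominated convergence and holomorphy for complex measures\<close>

lemma cm_integral_cong:
  assumes "\<And>u. u \<in> space N \<Longrightarrow> g u = h u"
  shows "cm_integral N f g = cm_integral N f h"
  unfolding cm_integral_def using assms
  by (intro arg_cong2[where f = "(+)"] arg_cong2[where f = "(-)"] arg_cong2[where f = "(*)"] refl
      Bochner_Integration.integral_cong) auto

lemma finite_measure_Fubini:
  fixes k :: "'a \<Rightarrow> 'b \<Rightarrow> complex"
  assumes \<mu>: "finite_measure \<mu>" "sets \<mu> = sets N" and M: "finite_measure M"
    and k: "case_prod k \<in> borel_measurable (N \<Otimes>\<^sub>M M)"
    and bd: "\<And>u x. u \<in> space N \<Longrightarrow> x \<in> space M \<Longrightarrow> norm (k u x) \<le> B"
  shows "integrable M (\<lambda>x. \<integral>u. k u x \<partial>\<mu>)" "(\<integral>x. (\<integral>u. k u x \<partial>\<mu>) \<partial>M) = (\<integral>u. (\<integral>x. k u x \<partial>M) \<partial>\<mu>)"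
proof -
  interpret \<mu>: finite_measure \<mu> by fact
  interpret M: finite_measure M by fact
  interpret P: pair_sigma_finite \<mu> M ..
  have m: "case_prod k \<in> borel_measurable (\<mu> \<Otimes>\<^sub>M M)"
    using k measurable_cong_sets[OF sets_pair_measure_cong[OF \<mu>(2) refl[of "sets M"]] refl] by blast
  have sp: "space \<mu> = space N" using \<mu>(2) by (rule sets_eq_imp_space_eq)
  have "finite_measure (\<mu> \<Otimes>\<^sub>M M)" by (rule finite_measure_pair_measure) fact+
  then have int: "integrable (\<mu> \<Otimes>\<^sub>M M) (case_prod k)"
    using m bd sp by (intro finite_measure.integrable_const_bound[where B = B]) (auto simp: space_pair_measure)
  show "integrable M (\<lambda>x. \<integral>u. k u x \<partial>\<mu>)" by (rule P.integrable_snd[OF int])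
  show "(\<integral>x. (\<integral>u. k u x \<partial>\<mu>) \<partial>M) = (\<integral>u. (\<integral>x. k u x \<partial>M) \<partial>\<mu>)" by (rule P.Fubini_integral[OF int])
qed

lemma cm_integral_Fubini:
  fixes k :: "'a \<Rightarrow> 'b \<Rightarrow> complex"
  assumes f: "f \<in> complex_measures N" and M: "finite_measure M"
    and k: "case_prod k \<in> borel_measurable (N \<Otimes>\<^sub>M M)"
    and bd: "\<And>u x. u \<in> space N \<Longrightarrow> x \<in> space M \<Longrightarrow> norm (k u x) \<le> B"
  shows "integrable M (\<lambda>x. cm_integral N f (\<lambda>u. k u x))"
    "(\<integral>x. cm_integral N f (\<lambda>u. k u x) \<partial>M) = cm_integral N f (\<lambda>u. \<integral>x. k u x \<partial>M)"
proof -
  have F: "integrable M (\<lambda>x. \<integral>u. k u x \<partial>\<mu>)" "(\<integral>x. (\<integral>u. k u x \<partial>\<mu>) \<partial>M) = (\<integral>u. (\<integral>x. k u x \<partial>M) \<partial>\<mu>)"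
    if "finite_measure \<mu>" "sets \<mu> = sets N" for \<mu>
    by (rule finite_measure_Fubini[OF that M k]; rule bd; assumption)+
  note F1 = F[OF finite_measure_parts(1)[OF f] sets_positive_variation]
    and F2 = F[OF finite_measure_parts(2)[OF f] sets_positive_variation]
    and F3 = F[OF finite_measure_parts(3)[OF f] sets_positive_variation]
    and F4 = F[OF finite_measure_parts(4)[OF f] sets_positive_variation]
  show "integrable M (\<lambda>x. cm_integral N f (\<lambda>u. k u x))"
    unfolding cm_integral_def
    by (intro Bochner_Integration.integrable_add Bochner_Integration.integrable_diff integrable_mult_right F1 F2 F3 F4)
  show "(\<integral>x. cm_integral N f (\<lambda>u. k u x) \<partial>M) = cm_integral N f (\<lambda>u. \<integral>x. k u x \<partial>M)"
    unfolding cm_integral_def F1(2)[symmetric] F2(2)[symmetric] F3(2)[symmetric] F4(2)[symmetric]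
    using F1(1) F2(1) F3(1) F4(1)
    by (simp only: Bochner_Integration.integral_add Bochner_Integration.integral_diff Bochner_Integration.integrable_diff
        integrable_mult_right integral_mult_right_zero)
qed

text \<open>Dominated convergence for each of the four positive measures in
  \<open>cm_integral\<close>; their finiteness makes the constant \<open>B\<close>
  integrable.\<close>

lemma cm_integral_tendsto_sequentially:
  assumes f: "f \<in> complex_measures N"
    and k: "\<And>i. k i \<in> borel_measurable N" and g: "g \<in> borel_measurable N"
    and lim: "\<And>u. u \<in> space N \<Longrightarrow> (\<lambda>i. k i u) \<longlonglongrightarrow> g u"
    and bd: "\<And>i u. u \<in> space N \<Longrightarrow> norm (k i u) \<le> B"
  shows "(\<lambda>i. cm_integral N f (k i)) \<longlonglongrightarrow> cm_integral N f g"
proof -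
  have *: "(\<lambda>i. \<integral>u. k i u \<partial>\<mu>) \<longlonglongrightarrow> (\<integral>u. g u \<partial>\<mu>)" if "finite_measure \<mu>" "sets \<mu> = sets N" for \<mu>
  proof (rule integral_dominated_convergence[where w = "\<lambda>_. B"])
    interpret finite_measure \<mu> by fact
    have sp: "space \<mu> = space N" using that(2) by (rule sets_eq_imp_space_eq)
    show "integrable \<mu> (\<lambda>_. B)" by simp
    show "AE u in \<mu>. (\<lambda>i. k i u) \<longlonglongrightarrow> g u" "\<And>i. AE u in \<mu>. norm (k i u) \<le> B" using lim bd sp by auto
    show "g \<in> borel_measurable \<mu>" "\<And>i. k i \<in> borel_measurable \<mu>"
      using g k measurable_cong_sets[OF that(2) refl] by blast+
  qed
  show ?thesis unfolding cm_integral_def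
    by (intro tendsto_intros * finite_measure_parts f sets_positive_variation)
qed

text \<open>From \<open>b * r \<le> exp (b * r)\<close>. The bound is uniform in \<open>b\<close>,
  which later stands for an unbounded function of \<open>u\<close>.\<close>

lemma exp_decay_bound:
  fixes z :: complex
  assumes "r > 0" "b \<ge> 0" "r \<le> Re z"
  shows "norm (of_real b * exp (- of_real b * z)) \<le> 1 / r"
proof -
  have "b * r \<le> exp (b * r)" using exp_ge_add_one_self[of "b * r"] by linarith
  then have "b * exp (- (b * r)) \<le> 1 / r" using assms(1) by (simp add: exp_minus field_simps)
  moreover have "exp (- (b * Re z)) \<le> exp (- (b * r))" using assms by (simp add: mult_left_mono)
  then have "b * exp (- (b * Re z)) \<le> b * exp (- (b * r))" using assms(2) by (rule mult_left_mono)
  ultimately show ?thesis using assms(2) by (simp add: norm_mult)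
qed

text \<open>Derivative under the integral sign: on \<open>Re z > r\<close> the integrand is Lipschitz with constant \<open>1/r\<close>
  uniformly in \<open>b u\<close>, which dominates the difference quotients.\<close>

lemma cm_integral_exp_holomorphic:
  assumes f: "f \<in> complex_measures N"
    and E: "E \<in> borel_measurable N" "\<And>u. u \<in> space N \<Longrightarrow> norm (E u) \<le> 1"
    and b: "b \<in> borel_measurable N" "\<And>u. u \<in> space N \<Longrightarrow> 0 \<le> b u"
  shows "(\<lambda>z. cm_integral N f (\<lambda>u. E u * exp (- of_real (b u) * z))) holomorphic_on {z. Re z > 0}"
proof -
  note [measurable] = E(1) b(1)
  let ?G = "\<lambda>z. cm_integral N f (\<lambda>u. E u * exp (- of_real (b u) * z))"
  have "(?G has_field_derivative cm_integral N f (\<lambda>u. E u * (- of_real (b u) * exp (- of_real (b u) * z0)))) (at z0)"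
    if "Re z0 > 0" for z0
  proof -
    \<comment> \<open>Half the real part puts \<open>z0\<close> inside an open half-plane at
      positive distance from the imaginary axis; its convexity is what the mean value estimate
      requires.\<close>
    define r where "r = Re z0 / 2"
    have r: "r > 0" "r < Re z0" using that by (auto simp: r_def)
    define H where "H = {z. Re z > r}"
    have H: "open H" "convex H" "z0 \<in> H"
      using r by (auto simp: H_def open_halfspace_Re_gt convex_halfspace_Re_gt)
    have der: "((\<lambda>z. exp (- of_real (b u) * z)) has_field_derivative - of_real (b u) * exp (- of_real (b u) * z)) (at z within A)"
      for u z A by (auto intro!: derivative_eq_intros)
    have lip: "norm (exp (- of_real (b u) * z) - exp (- of_real (b u) * z0)) \<le> 1 / r * norm (z - z0)"
      if "z \<in> H" "u \<in> space N" for z u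
      using exp_decay_bound[OF r(1) b(2)[OF that(2)]] that(1) H
      by (intro field_differentiable_bound[OF H(2) der]) (auto simp: H_def norm_mult)
    have "((\<lambda>z. (?G z - ?G z0) / (z - z0)) \<longlongrightarrow> cm_integral N f (\<lambda>u. E u * (- of_real (b u) * exp (- of_real (b u) * z0)))) (at z0 within H)"
      unfolding tendsto_at_iff_sequentially comp_def
    proof safe
      fix X assume X: "\<forall>i. X i \<in> H - {z0}" "X \<longlonglongrightarrow> z0"
      let ?k = "\<lambda>i u. E u * ((exp (- of_real (b u) * X i) - exp (- of_real (b u) * z0)) / (X i - z0))"
      have "(\<lambda>i. cm_integral N f (?k i)) \<longlonglongrightarrow> cm_integral N f (\<lambda>u. E u * (- of_real (b u) * exp (- of_real (b u) * z0)))"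
      proof (rule cm_integral_tendsto_sequentially[OF f, where B = "1 / r"])
        show "(\<lambda>i. ?k i u) \<longlonglongrightarrow> E u * (- of_real (b u) * exp (- of_real (b u) * z0))" for u
        proof (intro tendsto_intros)
          show "(\<lambda>i. (exp (- of_real (b u) * X i) - exp (- of_real (b u) * z0)) / (X i - z0)) \<longlonglongrightarrow> - of_real (b u) * exp (- of_real (b u) * z0)"
            using der[of u z0 UNIV] X unfolding has_field_derivative_iff tendsto_at_iff_sequentially comp_def by blast
        qed
        fix i u assume u: "u \<in> space N"
        have "norm ((exp (- of_real (b u) * X i) - exp (- of_real (b u) * z0)) / (X i - z0)) \<le> 1 / r"
          using lip[of "X i" u] u X(1) by (auto simp: norm_divide divide_le_eq)
        with E(2)[OF u] have "norm (E u) * norm ((exp (- of_real (b u) * X i) - exp (- of_real (b u) * z0)) / (X i - z0)) \<le> 1 * (1 / r)"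
          by (intro mult_mono) auto
        then show "norm (?k i u) \<le> 1 / r" unfolding norm_mult by (simp only: mult_1)
      qed measurable
      moreover have "cm_integral N f (?k i) = (?G (X i) - ?G z0) / (X i - z0)" for i
      proof -
        have *: "(\<integral>u. ?k i u \<partial>\<mu>) = ((\<integral>u. E u * exp (- of_real (b u) * X i) \<partial>\<mu>) - (\<integral>u. E u * exp (- of_real (b u) * z0) \<partial>\<mu>)) / (X i - z0)"
          if \<mu>: "finite_measure \<mu>" "sets \<mu> = sets N" for \<mu>
        proof -
          interpret finite_measure \<mu> by fact
          have sp: "space \<mu> = space N" using \<mu>(2) by (rule sets_eq_imp_space_eq)
          have [measurable]: "E \<in> borel_measurable \<mu>" "b \<in> borel_measurable \<mu>"
            using E(1) b(1) measurable_cong_sets[OF \<mu>(2) refl] by blast+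
          have "integrable \<mu> (\<lambda>u. E u * exp (- of_real (b u) * z))" if "z \<in> H" for z
          proof (rule integrable_const_bound[where B = 1])
            have "norm (E u) * norm (exp (- of_real (b u) * z)) \<le> 1 * 1" if "u \<in> space N" for u
              using E(2)[OF that] b(2)[OF that] \<open>z \<in> H\<close> r(1) by (intro mult_mono) (auto simp: H_def)
            then show "AE u in \<mu>. norm (E u * exp (- of_real (b u) * z)) \<le> 1" using sp by (auto simp: norm_mult)
          qed measurable
          from this[of "X i"] this[of z0] show ?thesis using X(1) H(3)
            by (simp add: right_diff_distrib diff_divide_distrib)
        qed
        show ?thesis unfolding cm_integral_def
          unfolding *[OF finite_measure_parts(1)[OF f] sets_positive_variation] *[OF finite_measure_parts(2)[OF f] sets_positive_variation]
            *[OF finite_measure_parts(3)[OF f] sets_positive_variation] *[OF finite_measure_parts(4)[OF f] sets_positive_variation]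
          by (simp add: field_simps diff_divide_distrib add_divide_distrib)
      qed
      ultimately show "(\<lambda>i. (?G (X i) - ?G z0) / (X i - z0)) \<longlonglongrightarrow> cm_integral N f (\<lambda>u. E u * (- of_real (b u) * exp (- of_real (b u) * z0)))"
        by simp
    qed
    then show ?thesis
      unfolding has_field_derivative_iff using at_within_open[OF H(3,1)] by simp
  qed
  then show ?thesis
    unfolding holomorphic_on_def field_differentiable_def by (auto intro: has_field_derivative_at_within)
qed

section \<open>Analytic Yeh--Feynman integrals\<close>

text \<open>Makes the filter at \<open>- \<i> * of_real q\<close> within the half-plane nontrivial,
  so that the Feynman limit is unique.\<close>

lemma right_half_plane_boundary_islimpt:
  assumes "Re z \<ge> 0"
  shows "z islimpt {w. Re w > 0}"
  unfolding islimpt_approachable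
proof (intro allI impI)
  fix e :: real assume "e > 0"
  then show "\<exists>w\<in>{w. Re w > 0}. w \<noteq> z \<and> dist w z < e"
    using assms by (intro bexI[of _ "z + of_real (e / 2)"]) (auto simp: dist_norm)
qed

text \<open>Two extensions agree on the positive reals, which accumulate at 1 inside the connected
  half-plane; the identity theorem does the rest.\<close>

lemma is_yw_extension_unique:
  assumes J: "is_yw_extension S T m \<phi> h F z J" and K: "is_yw_extension S T m \<phi> h F z K" and "Re w > 0"
  shows "J w = K w"
proof -
  let ?U = "(\<lambda>a. complex_of_real a) ` {0<..}"
  have eq: "J w = K w" if "w \<in> ?U" for w using that J K by (auto simp: is_yw_extension_def Let_def)
  have lim: "(1::complex) islimpt ?U"
    unfolding islimpt_approachable
  proof (intro allI impI)
    fix e :: real assume "e > 0"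
    then show "\<exists>w\<in>?U. w \<noteq> 1 \<and> dist w 1 < e"
    proof (intro bexI[of _ "of_real (1 + e / 2)"] conjI imageI)
      have "dist (complex_of_real (1 + e / 2)) 1 = e / 2"
        using dist_of_real[of "1 + e / 2" 1, where 'a = complex] \<open>e > 0\<close> by (simp add: dist_real_def)
      then show "dist (complex_of_real (1 + e / 2)) 1 < e" "complex_of_real (1 + e / 2) \<noteq> 1"
        using \<open>e > 0\<close> by auto
    qed (use \<open>e > 0\<close> in simp)
  qed
  have hol: "(\<lambda>w. J w - K w) holomorphic_on {w. Re w > 0}"
    using J K by (intro holomorphic_on_diff analytic_imp_holomorphic) (simp_all add: is_yw_extension_def)
  have conn: "connected {w. Re w > 0}" by (intro convex_connected convex_halfspace_Re_gt)
  have U: "?U \<subseteq> {w. Re w > 0}" by auto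
  have one: "1 \<in> {w. Re w > 0}" by simp
  have "J w - K w = 0"
    by (rule analytic_continuation[OF hol open_halfspace_Re_gt conn U one lim]) (use eq \<open>Re w > 0\<close> in \<open>auto simp del: image_iff\<close>)
  then show ?thesis by simp
qed

lemma has_yf_integral_unique:
  assumes v: "has_yf_integral S T m \<phi> q h F z v" and w: "has_yf_integral S T m \<phi> q h F z w"
  shows "v = w"
proof -
  obtain J K where J: "is_yw_extension S T m \<phi> h F z J" "(J \<longlongrightarrow> v) (at (- \<i> * of_real q) within {w. Re w > 0})"
    and K: "is_yw_extension S T m \<phi> h F z K" "(K \<longlongrightarrow> w) (at (- \<i> * of_real q) within {w. Re w > 0})"
    using v w by (auto simp: has_yf_integral_def)
  have "\<forall>\<^sub>F w in at (- \<i> * of_real q) within {w. Re w > 0}. J w = K w"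
    unfolding eventually_at_topological using is_yw_extension_unique[OF J(1) K(1)] by blast
  then have "(K \<longlongrightarrow> v) (at (- \<i> * of_real q) within {w. Re w > 0})"
    using J(2) by (rule Lim_transform_eventually[rotated])
  moreover have "\<not> trivial_limit (at (- \<i> * of_real q) within {w. Re w > 0})"
    using right_half_plane_boundary_islimpt[of "- \<i> * of_real q"] by (simp add: trivial_limit_within)
  ultimately show ?thesis using K(2) tendsto_unique by blast
qed

lemma yf_integral_eqI:
  assumes "has_yf_integral S T m \<phi> q h F z v"
  shows "yf_integral S T m \<phi> q h F z = Some v"
proof -
  have "(THE v. has_yf_integral S T m \<phi> q h F z v) = v"
    by (intro the_equality assms has_yf_integral_unique[OF _ assms])
  then show ?thesis unfolding yf_integral_def using assms by auto
qed

lemma Re_minus_of_real_mult: "Re (- of_real c * z) = - (c * Re z)"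
  by simp

context pwz
begin

text \<open>\<open>K u\<close> collects everything free of the current variable: the Gaussian
  factors already integrated and the phases of the variables still to come. Its modulus is at most 1
  at every stage, so the lemma can be iterated.\<close>

lemma yf_integral_step:
  fixes G :: functional
  assumes f: "f \<in> complex_measures (L2_borel S T)" and h: "bounded_variation_HK S T h" and q: "q \<noteq> 0"
    and K: "K \<in> borel_measurable (L2_borel S T)" "\<And>u. u \<in> L2_carrier S T \<Longrightarrow> norm (K u) \<le> 1"
    and G: "\<And>a. a > 0 \<Longrightarrow> AE x in completion M. G (\<lambda>p. a powr (-1/2) * gauss_path S T \<phi> h x p + z p) =
      Some (cm_integral (L2_borel S T) f (\<lambda>u. K u * exp (\<i> * of_real (a powr (-1/2) * PWZ S T \<phi> (\<lambda>p. u p * h p) x))))"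
  shows "yf_integral S T (completion M) \<phi> q h G z =
    Some (cm_integral (L2_borel S T) f (\<lambda>u. K u * exp (- (\<i> / (2 * of_real q)) * of_real ((L2_norm S T (\<lambda>p. u p * h p))\<^sup>2))))"
proof (rule yf_integral_eqI)
  let ?N = "L2_borel S T"
  let ?I = "\<lambda>k. cm_integral ?N f k"
  define b where "b u = (L2_norm S T (\<lambda>p. u p * h p))\<^sup>2" for u
  have b[measurable]: "b \<in> borel_measurable ?N" unfolding b_def by (rule L2_norm_mult_borel_measurable[OF h])
  have b0: "0 \<le> b u" for u by (simp add: b_def)
  note [measurable] = K(1)
  \<comment> \<open>At \<open>w = a > 0\<close> the Gaussian expectation has exponent
    \<open>- b u / (2 * a)\<close>. The map from \<open>w\<close> to \<open>1 / (2 * w)\<close>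
    preserves the right half-plane, which reduces holomorphy of \<open>J\<close> to the exponential
    in \<open>z = 1 / (2 * w)\<close>.\<close>
  define J where "J w = ?I (\<lambda>u. K u * exp (- of_real (b u) * (1 / (2 * w))))" for w
  have inv_pos: "Re (1 / (2 * w)) > 0" if "Re w > 0" for w :: complex
    using that by (simp add: Re_divide cmod_power2 complex_neq_0 add_pos_nonneg power2_eq_square)
  have "J holomorphic_on {w. Re w > 0}"
  proof -
    have "(\<lambda>z. ?I (\<lambda>u. K u * exp (- of_real (b u) * z))) \<circ> (\<lambda>w. 1 / (2 * w)) holomorphic_on {w. Re w > 0}"
      by (rule holomorphic_on_compose_gen[OF _ cm_integral_exp_holomorphic[OF f K(1) _ b]])
         (use K(2) b0 inv_pos in \<open>auto intro!: holomorphic_intros\<close>)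
    then show ?thesis by (simp add: J_def[abs_def] comp_def)
  qed
  then have J_an: "J analytic_on {w. Re w > 0}" by (simp add: analytic_on_open open_halfspace_Re_gt)
  have "(\<forall>a::real. a > 0 \<longrightarrow>
      (let H = (\<lambda>x. G (\<lambda>p. a powr (-1/2) * gauss_path S T \<phi> h x p + z p)) in
        (AE x in completion M. H x \<noteq> None) \<and> integrable (completion M) (\<lambda>x. the (H x)) \<and>
        J (of_real a) = (\<integral>x. the (H x) \<partial>completion M)))"
    unfolding Let_def
  proof (intro allI impI)
    fix a :: real assume a: "a > 0"
    define \<theta> where "\<theta> = a powr (-1/2)"
    have \<theta>2: "\<theta>\<^sup>2 = 1 / a" using a by (simp add: \<theta>_def power2_eq_square powr_add[symmetric] powr_minus_divide)
    define H where "H x = G (\<lambda>p. \<theta> * gauss_path S T \<phi> h x p + z p)" for x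
    define k where "k u x = K u * exp (\<i> * of_real (\<theta> * PWZ S T \<phi> (\<lambda>p. u p * h p) x))" for u x
    have H: "AE x in completion M. H x = Some (?I (\<lambda>u. k u x))"
      using G[OF a] by (simp add: H_def k_def \<theta>_def)
    note [measurable] = PWZ_mult_jointly_measurable[OF h]
    have k_meas: "case_prod k \<in> borel_measurable (?N \<Otimes>\<^sub>M M)" unfolding k_def by measurable
    have k_bd: "norm (k u x) \<le> 1" if "u \<in> space ?N" for u x using K(2) that by (simp add: k_def norm_mult)
    note F = cm_integral_Fubini[OF f finite_measure_axioms k_meas k_bd]
    have F1: "integrable (completion M) (\<lambda>x. ?I (\<lambda>u. k u x))"
      using F(1) by (simp add: integrable_completion)
    have ae: "AE x in completion M. the (H x) = ?I (\<lambda>u. k u x)" using H by eventually_elim simp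
    \<comment> \<open>\<open>H\<close> is known only almost everywhere; measurability comes from
      completeness.\<close>
    have meas: "(\<lambda>x. the (H x)) \<in> borel_measurable (completion M)"
      by (rule completion.borel_measurable_AE_eq[OF borel_measurable_integrable[OF F1] ae])
    have "AE x in completion M. H x \<noteq> None" using H by eventually_elim simp
    moreover have "integrable (completion M) (\<lambda>x. the (H x))"
      using integrable_cong_AE[OF meas borel_measurable_integrable[OF F1] ae] F1 by simp
    moreover have "J (of_real a) = (\<integral>x. the (H x) \<partial>completion M)"
    proof -
      have "(\<integral>x. the (H x) \<partial>completion M) = (\<integral>x. ?I (\<lambda>u. k u x) \<partial>completion M)"
        by (rule integral_cong_AE[OF meas borel_measurable_integrable[OF F1] ae])
      also have "\<dots> = (\<integral>x. ?I (\<lambda>u. k u x) \<partial>M)"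
        by (rule integral_completion[OF borel_measurable_integrable[OF F(1)]])
      also have "\<dots> = ?I (\<lambda>u. \<integral>x. k u x \<partial>M)" by (rule F(2))
      also have "\<dots> = ?I (\<lambda>u. K u * exp (- of_real (b u) * (1 / (2 * of_real a))))"
      proof (rule cm_integral_cong)
        fix u assume "u \<in> space ?N"
        then have "(\<lambda>p. u p * h p) \<in> L2_carrier S T" using HK_L2_mult[OF h ST] by simp
        from PWZ_char[OF this, of \<theta>] show "(\<integral>x. k u x \<partial>M) = K u * exp (- of_real (b u) * (1 / (2 * of_real a)))"
          by (simp add: k_def b_def L2_norm_power2 \<theta>2 exp_of_real[symmetric] mult.commute[of _ 2] del: exp_of_real)
      qed
      finally show ?thesis by (simp add: J_def)
    qed
    ultimately show "(AE x in completion M. G (\<lambda>p. a powr (-1/2) * gauss_path S T \<phi> h x p + z p) \<noteq> None) \<and>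
      integrable (completion M) (\<lambda>x. the (G (\<lambda>p. a powr (-1/2) * gauss_path S T \<phi> h x p + z p))) \<and>
      J (of_real a) = (\<integral>x. the (G (\<lambda>p. a powr (-1/2) * gauss_path S T \<phi> h x p + z p)) \<partial>completion M)"
      unfolding H_def \<theta>_def by blast
  qed
  then have ext: "is_yw_extension S T (completion M) \<phi> h G z J"
    using J_an by (simp add: is_yw_extension_def)
  have "(J \<longlongrightarrow> ?I (\<lambda>u. K u * exp (- (\<i> / (2 * of_real q)) * of_real (b u)))) (at (- \<i> * of_real q) within {w. Re w > 0})"
    unfolding tendsto_at_iff_sequentially comp_def J_def
  proof safe
    fix X assume X: "\<forall>i. X i \<in> {w. Re w > 0} - {- \<i> * of_real q}" "X \<longlonglongrightarrow> - \<i> * of_real q"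
    show "(\<lambda>i. ?I (\<lambda>u. K u * exp (- of_real (b u) * (1 / (2 * X i))))) \<longlonglongrightarrow> ?I (\<lambda>u. K u * exp (- (\<i> / (2 * of_real q)) * of_real (b u)))"
    proof (rule cm_integral_tendsto_sequentially[OF f, where B = 1])
      fix u
      have "(\<lambda>i. K u * exp (- of_real (b u) * (1 / (2 * X i)))) \<longlonglongrightarrow> K u * exp (- of_real (b u) * (1 / (2 * (- \<i> * of_real q))))"
        using q by (intro tendsto_intros X(2)) simp
      moreover have "- of_real (b u) * (1 / (2 * (- \<i> * of_real q))) = - (\<i> / (2 * of_real q)) * complex_of_real (b u)"
        using q by (simp add: field_simps)
      ultimately show "(\<lambda>i. K u * exp (- of_real (b u) * (1 / (2 * X i)))) \<longlonglongrightarrow> K u * exp (- (\<i> / (2 * of_real q)) * of_real (b u))" by simp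
    next
      fix i u assume u: "u \<in> space ?N"
      \<comment> \<open>The sequence stays in the open half-plane, where the exponent has
        nonpositive real part. The constant 1 therefore dominates, although the limiting integrand
        is purely oscillatory in \<open>b u\<close>.\<close>
      have "0 < Re (1 / (2 * X i))" using inv_pos X(1) by blast
      then have "0 \<le> b u * Re (1 / (2 * X i))" using b0 by simp
      then have "norm (K u) * norm (exp (- of_real (b u) * (1 / (2 * X i)))) \<le> 1 * 1"
        using K(2) u by (intro mult_mono) (simp_all only: norm_exp_eq_Re Re_minus_of_real_mult, simp_all)
      then show "norm (K u * exp (- of_real (b u) * (1 / (2 * X i)))) \<le> 1" by (simp add: norm_mult)
    qed measurable
  qed
  with ext show "has_yf_integral S T (completion M) \<phi> q h G z
     (?I (\<lambda>u. K u * exp (- (\<i> / (2 * of_real q)) * of_real ((L2_norm S T (\<lambda>p. u p * h p))\<^sup>2))))"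
    unfolding has_yf_integral_def b_def by blast
qed

end

text \<open>The exceptional set of \<open>P\<close> may be nonmeasurable, so it is enclosed in a
  measurable null set \<open>A\<close>; by Tonelli almost every section of \<open>A\<close> is
  null.\<close>

lemma AE_PiM_insert:
  assumes m: "prob_space m" and I: "finite I" "i \<notin> I" and ae: "AE y in PiM (insert i I) (\<lambda>_. m). P y"
  shows "AE y in PiM I (\<lambda>_. m). AE x in m. P (y(i := x))"
proof -
  interpret product_prob_space "\<lambda>_. m" UNIV
    by (intro product_prob_spaceI m)
  obtain A where A: "A \<in> null_sets (PiM (insert i I) (\<lambda>_. m))" "{y \<in> space (PiM (insert i I) (\<lambda>_. m)). \<not> P y} \<subseteq> A"
    using ae by (auto simp: eventually_ae_filter)
  have [measurable]: "A \<in> sets (PiM (insert i I) (\<lambda>_. m))" using A(1) by auto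
  have upd: "(\<lambda>x. y(i := x)) \<in> measurable m (PiM (insert i I) (\<lambda>_. m))" if "y \<in> space (PiM I (\<lambda>_. m))" for y
    using that by (intro measurable_fun_upd[where J = I]) auto
  have "0 = (\<integral>\<^sup>+y. indicator A y \<partial>PiM (insert i I) (\<lambda>_. m))" using A(1) by auto
  also have "\<dots> = (\<integral>\<^sup>+y. (\<integral>\<^sup>+x. indicator A (y(i := x)) \<partial>m) \<partial>PiM I (\<lambda>_. m))"
    by (rule product_nn_integral_insert[OF I]) measurable
  finally have "AE y in PiM I (\<lambda>_. m). (\<integral>\<^sup>+x. indicator A (y(i := x)) \<partial>m) = 0"
    by (subst nn_integral_0_iff_AE[symmetric]) (auto intro!: sigma_finite_measure.borel_measurable_nn_integral
        sigma_finite_measures measurable_compose[OF measurable_add_dim])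
  then show ?thesis
    using AE_space
  proof eventually_elim
    case (elim y)
    have "(\<lambda>x. indicator A (y(i := x)) :: ennreal) \<in> borel_measurable m"
      by (rule measurable_compose[OF upd[OF elim(2)]]) measurable
    then have "AE x in m. indicator A (y(i := x)) = (0::ennreal)" using elim(1) by (simp add: nn_integral_0_iff_AE)
    then show ?case
      using AE_space
    proof eventually_elim
      case (elim x)
      then show ?case using A(2) measurable_space[OF upd[OF \<open>y \<in> space (PiM I (\<lambda>_. m))\<close>] elim(2)]
        by (auto split: split_indicator_asm)
    qed
  qed
qed

text \<open>The induction invariant after \<open>k\<close> integrations. The quantifier over
  \<open>c\<close> stands inside the almost-everywhere statement because the next integral, at one
  fixed choice of the remaining paths, uses the coefficient \<open>a powr (-1/2)\<close> for all
  \<open>a > 0\<close>.\<close>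

lemma (in pwz) iterated_yf_integral_partial:
  assumes f: "f \<in> complex_measures (L2_borel S T)" and q: "q \<noteq> 0"
    and h: "\<And>j. j \<in> {1..n} \<Longrightarrow> bounded_variation_HK S T (h j)"
    and F: "AE y in PiM {1..n} (\<lambda>_. completion M). \<forall>c. F (\<lambda>p. \<Sum>j=1..n. c j * gauss_path S T \<phi> (h j) (y j) p) =
      Some (cm_integral (L2_borel S T) f (\<lambda>u. exp (\<i> * of_real (\<Sum>j=1..n. c j * PWZ S T \<phi> (\<lambda>p. u p * h j p) (y j)))))"
    and "k \<le> n"
  shows "AE y in PiM {Suc k..n} (\<lambda>_. completion M). \<forall>c.
    iterated_yf_integral S T (completion M) \<phi> q (map h [1..<Suc k]) F (\<lambda>p. \<Sum>j=Suc k..n. c j * gauss_path S T \<phi> (h j) (y j) p) =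
    Some (cm_integral (L2_borel S T) f (\<lambda>u.
      exp (- (\<i> / (2 * of_real q)) * of_real (\<Sum>j=1..k. (L2_norm S T (\<lambda>p. u p * h j p))\<^sup>2)) *
      exp (\<i> * of_real (\<Sum>j=Suc k..n. c j * PWZ S T \<phi> (\<lambda>p. u p * h j p) (y j)))))"
  using \<open>k \<le> n\<close>
proof (induction k)
  case 0
  then show ?case using F unfolding One_nat_def by (simp add: iterated_yf_integral_def)
next
  case (Suc k)
  let ?m = "completion M" and ?N = "L2_borel S T"
  let ?G = "\<lambda>k. iterated_yf_integral S T ?m \<phi> q (map h [1..<Suc k]) F"
  let ?A = "\<lambda>k u. exp (- (\<i> / (2 * of_real q)) * of_real (\<Sum>j=1..k. (L2_norm S T (\<lambda>p. u p * h j p))\<^sup>2)) :: complex"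
  have set_eq: "{Suc k..n} = insert (Suc k) {Suc (Suc k)..n}" using Suc.prems by auto
  have ps: "prob_space ?m" by (rule prob_space_completion)
  from Suc have "AE y in PiM (insert (Suc k) {Suc (Suc k)..n}) (\<lambda>_. ?m). \<forall>c.
    ?G k (\<lambda>p. \<Sum>j=Suc k..n. c j * gauss_path S T \<phi> (h j) (y j) p) =
    Some (cm_integral ?N f (\<lambda>u. ?A k u * exp (\<i> * of_real (\<Sum>j=Suc k..n. c j * PWZ S T \<phi> (\<lambda>p. u p * h j p) (y j)))))"
    unfolding set_eq[symmetric] by simp
  from AE_PiM_insert[OF ps _ _ this]
  have "AE y in PiM {Suc (Suc k)..n} (\<lambda>_. ?m). AE x in ?m. \<forall>c.
    ?G k (\<lambda>p. \<Sum>j=Suc k..n. c j * gauss_path S T \<phi> (h j) ((y(Suc k := x)) j) p) =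
    Some (cm_integral ?N f (\<lambda>u. ?A k u * exp (\<i> * of_real (\<Sum>j=Suc k..n. c j * PWZ S T \<phi> (\<lambda>p. u p * h j p) ((y(Suc k := x)) j)))))"
    by simp
  then show ?case
    using AE_space
  proof eventually_elim
    case (elim y)
    show ?case
    proof
      fix c :: "nat \<Rightarrow> real"
      let ?z = "\<lambda>p. \<Sum>j=Suc (Suc k)..n. c j * gauss_path S T \<phi> (h j) (y j) p"
      let ?r = "\<lambda>u. \<Sum>j=Suc (Suc k)..n. c j * PWZ S T \<phi> (\<lambda>p. u p * h j p) (y j)"
      define K where "K u = ?A k u * exp (\<i> * of_real (?r u))" for u
      have y: "y j \<in> space M" if "j \<in> {Suc (Suc k)..n}" for j
        using elim(2) that by (auto simp: space_PiM PiE_def Pi_def)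
      have K_meas: "K \<in> borel_measurable ?N"
      proof -
        have "(\<lambda>u. (L2_norm S T (\<lambda>p. u p * h j p))\<^sup>2) \<in> borel_measurable ?N" if "j \<in> {1..k}" for j
          using that Suc.prems by (intro L2_norm_mult_borel_measurable h) auto
        then have [measurable]: "(\<lambda>u. \<Sum>j=1..k. (L2_norm S T (\<lambda>p. u p * h j p))\<^sup>2) \<in> borel_measurable ?N"
          by (rule borel_measurable_sum)
        have "(\<lambda>u. c j * PWZ S T \<phi> (\<lambda>p. u p * h j p) (y j)) \<in> borel_measurable ?N" if "j \<in> {Suc (Suc k)..n}" for j
          using that by (intro borel_measurable_times borel_measurable_const PWZ_mult_borel_measurable h y) auto
        then have [measurable]: "?r \<in> borel_measurable ?N" by (rule borel_measurable_sum)
        show ?thesis unfolding K_def by measurable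
      qed
      have K_norm: "norm (K u) \<le> 1" for u by (simp add: K_def norm_mult)
      have "yf_integral S T ?m \<phi> q (h (Suc k)) (?G k) ?z =
        Some (cm_integral ?N f (\<lambda>u. K u * exp (- (\<i> / (2 * of_real q)) * of_real ((L2_norm S T (\<lambda>p. u p * h (Suc k) p))\<^sup>2))))"
      proof (rule yf_integral_step[OF f _ q K_meas K_norm])
        show "bounded_variation_HK S T (h (Suc k))" using Suc.prems by (intro h) auto
        fix a :: real assume "a > 0"
        \<comment> \<open>The current path receives the coefficient \<lambda> to the power -1/2 at
          \<lambda> = \<open>a\<close>, while the outer paths keep theirs.\<close>
        define c' where "c' = c(Suc k := a powr (-1/2))"
        have split: "(\<Sum>j=Suc k..n. c' j * g j ((y(Suc k := x)) j)) =
            a powr (-1/2) * g (Suc k) x + (\<Sum>j=Suc (Suc k)..n. c j * g j (y j))" for g :: "nat \<Rightarrow> planefun \<Rightarrow> real" and x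
        proof -
          have "(\<Sum>j=Suc (Suc k)..n. c' j * g j ((y(Suc k := x)) j)) = (\<Sum>j=Suc (Suc k)..n. c j * g j (y j))"
            by (intro sum.cong) (auto simp: c'_def)
          then show ?thesis unfolding set_eq by (simp add: c'_def)
        qed
        show "AE x in ?m. ?G k (\<lambda>p. a powr (-1/2) * gauss_path S T \<phi> (h (Suc k)) x p + ?z p) =
          Some (cm_integral ?N f (\<lambda>u. K u * exp (\<i> * of_real (a powr (-1/2) * PWZ S T \<phi> (\<lambda>p. u p * h (Suc k) p) x))))"
          using elim(1)
        proof eventually_elim
          case (elim x)
          from elim[THEN spec, of c'] show ?case
            unfolding split[of "\<lambda>j x. gauss_path S T \<phi> (h j) x _"] split[of "\<lambda>j x. PWZ S T \<phi> (\<lambda>p. _ p * h j p) x"]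
            by (simp only: K_def of_real_add distrib_left exp_add mult_ac)
        qed
      qed
      moreover have "K u * exp (- (\<i> / (2 * of_real q)) * of_real ((L2_norm S T (\<lambda>p. u p * h (Suc k) p))\<^sup>2)) =
        ?A (Suc k) u * exp (\<i> * of_real (?r u))" for u
      proof -
        have "(\<Sum>j=1..Suc k. g j) = (\<Sum>j=1..k. g j) + g (Suc k)" for g :: "nat \<Rightarrow> real" by simp
        then show ?thesis unfolding K_def by (simp only: of_real_add distrib_left exp_add mult_ac)
      qed
      moreover have "?G (Suc k) = yf_integral S T ?m \<phi> q (h (Suc k)) (?G k)"
        by (simp add: iterated_yf_integral_def)
      ultimately show "?G (Suc k) ?z = Some (cm_integral ?N f (\<lambda>u. ?A (Suc k) u * exp (\<i> * of_real (?r u))))" by simp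
    qed
  qed
qed

lemma (in pwz) iterated_yf_integral_eq:
  assumes f: "f \<in> complex_measures (L2_borel S T)" and q: "q \<noteq> 0"
    and h: "\<forall>j\<in>{1..n}. h j \<in> Supp_BV S T"
    and F: "evaluates_along_gauss_paths S T (completion M) \<phi> f F"
  shows "iterated_yf_integral S T (completion M) \<phi> q (map h [1..<Suc n]) F (\<lambda>_. 0) =
    Some (cm_integral (L2_borel S T) f
      (\<lambda>u. exp (- (\<i> / (2 * of_real q)) * of_real (\<Sum>j=1..n. (L2_norm S T (\<lambda>p. u p * h j p))\<^sup>2))))"
proof -
  from F h have F': "AE y in PiM {1..n} (\<lambda>_. completion M). \<forall>c. F (\<lambda>p. \<Sum>j=1..n. c j * gauss_path S T \<phi> (h j) (y j) p) =
      Some (cm_integral (L2_borel S T) f (\<lambda>u. exp (\<i> * of_real (\<Sum>j=1..n. c j * PWZ S T \<phi> (\<lambda>p. u p * h j p) (y j)))))"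
    unfolding evaluates_along_gauss_paths_def by blast
  have h': "bounded_variation_HK S T (h j)" if "j \<in> {1..n}" for j using h that by (auto simp: Supp_BV_def)
  \<comment> \<open>For \<open>k = n\<close> no path remains: the product over the empty index set
    lives on one point, so the almost-everywhere statement becomes a plain one, and the empty sum is
    the zero shift.\<close>
  have empty: "{Suc n..n} = {}" by simp
  from iterated_yf_integral_partial[OF f q h' F' order.refl] show ?thesis
    unfolding empty PiM_empty AE_count_space by simp
qed

theorem corollary4p4:
  fixes S T q :: real and n :: nat
    and m :: "planefun measure" and \<phi> h :: "nat \<Rightarrow> planefun"
    and f :: "planefun set \<Rightarrow> complex" and F :: functional
  assumes "S > 0" and "T > 0"
    and "yeh_wiener S T m"
    and "complete_orthonormal_BV S T \<phi>"
    and "n \<ge> 1"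
    and "\<forall>j\<in>{1..n}. h j \<in> Supp_BV S T"
    and "fresnel_rep S T m \<phi> f F"
    and "evaluates_along_gauss_paths S T m \<phi> f F"
    and "q \<noteq> 0"
  shows "iterated_yf_integral S T m \<phi> q (map h [1..<Suc n]) F (\<lambda>_. 0) =
           Some (cm_integral (L2_borel S T) f
             (\<lambda>u. exp (- (\<i> / (2 * of_real q)) *
               of_real (\<Sum>j=1..n. (L2_norm S T (\<lambda>p. u p * h j p))\<^sup>2))))
       \<and> (\<forall>s\<in>Supp_BV S T.
           (AE p in lebesgue_on (rect S T). (s p)\<^sup>2 = (\<Sum>j=1..n. (h j p)\<^sup>2)) \<longrightarrow>
           iterated_yf_integral S T m \<phi> q (map h [1..<Suc n]) F (\<lambda>_. 0) =
           yf_integral S T m \<phi> q s F (\<lambda>_. 0))"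
proof -
  obtain m0 where m0: "prob_space m0" "space m0 = C0 S T"
    "\<And>P c. finite P \<Longrightarrow> P \<subseteq> rect S T \<Longrightarrow> centered_normal m0 (\<lambda>x. \<Sum>p\<in>P. c p * x p)"
    "\<forall>(s, t)\<in>rect S T. \<forall>(s', t')\<in>rect S T. (\<integral>x. x (s, t) * x (s', t') \<partial>m0) = min s s' * min t t'"
    and m: "m = completion m0"
    using assms(3) unfolding yeh_wiener_def by blast
  interpret prob_space m0 by (rule m0(1))
  interpret pwz m0 S T \<phi>
    by unfold_locales (use assms(1,2,4) m0 in auto)
  have f: "f \<in> complex_measures (L2_borel S T)" using assms(7) by (simp add: fresnel_rep_def)
  have F: "evaluates_along_gauss_paths S T (completion m0) \<phi> f F" using assms(8) m by simp
  note it = iterated_yf_integral_eq[OF f assms(9) assms(6) F]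
  have "yf_integral S T (completion m0) \<phi> q s F (\<lambda>_. 0) = Some (cm_integral (L2_borel S T) f
      (\<lambda>u. exp (- (\<i> / (2 * of_real q)) * of_real (\<Sum>j=1..n. (L2_norm S T (\<lambda>p. u p * h j p))\<^sup>2))))"
    if s: "s \<in> Supp_BV S T" and ae: "AE p in lebesgue_on (rect S T). (s p)\<^sup>2 = (\<Sum>j=1..n. (h j p)\<^sup>2)" for s
  proof -
    have "yf_integral S T (completion m0) \<phi> q s F (\<lambda>_. 0) = Some (cm_integral (L2_borel S T) f
      (\<lambda>u. exp (- (\<i> / (2 * of_real q)) * of_real ((L2_norm S T (\<lambda>p. u p * s p))\<^sup>2))))"
      \<comment> \<open>A single integral is the iterated one for the constant family
        \<open>s\<close> with one member; the evaluation convention for \<open>F\<close> covers this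
        family too.\<close>
      using iterated_yf_integral_eq[OF f assms(9) _ F, of 1 "\<lambda>_. s"] s by (simp add: iterated_yf_integral_def)
    also have "cm_integral (L2_borel S T) f (\<lambda>u. exp (- (\<i> / (2 * of_real q)) * of_real ((L2_norm S T (\<lambda>p. u p * s p))\<^sup>2))) =
      cm_integral (L2_borel S T) f (\<lambda>u. exp (- (\<i> / (2 * of_real q)) * of_real (\<Sum>j=1..n. (L2_norm S T (\<lambda>p. u p * h j p))\<^sup>2)))"
    proof (rule cm_integral_cong)
      fix u assume u: "u \<in> space (L2_borel S T)"
      then have us: "(\<lambda>p. u p * s p) \<in> L2_carrier S T" and uh: "\<And>j. j \<in> {1..n} \<Longrightarrow> (\<lambda>p. u p * h j p) \<in> L2_carrier S T"
        using s assms(1,2,6) by (auto simp: Supp_BV_def intro: HK_L2_mult)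
      have "(L2_norm S T (\<lambda>p. u p * s p))\<^sup>2 = (\<integral>p. (u p * s p) * (u p * s p) \<partial>leb_rect S T)"
        by (simp add: L2_norm_power2 L2_inner_def)
      also have "\<dots> = (\<integral>p. (\<Sum>j=1..n. (u p * h j p) * (u p * h j p)) \<partial>leb_rect S T)"
      proof (rule integral_cong_AE)
        show "AE p in leb_rect S T. (u p * s p) * (u p * s p) = (\<Sum>j=1..n. (u p * h j p) * (u p * h j p))"
          using ae
        proof eventually_elim
          case (elim p)
          have "(u p * s p) * (u p * s p) = (u p)\<^sup>2 * (s p)\<^sup>2" by (simp add: power2_eq_square ac_simps)
          also have "\<dots> = (\<Sum>j=1..n. (u p)\<^sup>2 * (h j p)\<^sup>2)" unfolding elim by (rule sum_distrib_left)
          finally show ?case by (simp add: power2_eq_square ac_simps)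
        qed
        show "(\<lambda>p. (u p * s p) * (u p * s p)) \<in> borel_measurable (leb_rect S T)"
          using L2_integrable_mult[OF us us] by (rule borel_measurable_integrable)
        show "(\<lambda>p. \<Sum>j=1..n. (u p * h j p) * (u p * h j p)) \<in> borel_measurable (leb_rect S T)"
          using L2_integrable_mult[OF uh uh] by (intro borel_measurable_sum borel_measurable_integrable)
      qed
      also have "\<dots> = (\<Sum>j=1..n. (L2_norm S T (\<lambda>p. u p * h j p))\<^sup>2)"
        unfolding L2_norm_power2 L2_inner_def
        by (rule Bochner_Integration.integral_sum) (rule L2_integrable_mult[OF uh uh])
      finally show "exp (- (\<i> / (2 * of_real q)) * of_real ((L2_norm S T (\<lambda>p. u p * s p))\<^sup>2)) =
        exp (- (\<i> / (2 * of_real q)) * of_real (\<Sum>j=1..n. (L2_norm S T (\<lambda>p. u p * h j p))\<^sup>2))" by simp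
    qed
    finally show ?thesis .
  qed
  with it show ?thesis unfolding m by simp
qed

end
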